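(* Let $G,N$ be Banach--Lie groups, and let $\pi: G\to \mathrm{Aut}(N)$ be a homomorphism defining a continuous action of $G$ on $N$. Then the half-Lie group $H:=N\rtimes_{\pi}G$ has the Trotter property: for all $C^1$ one-parameter subgroups $\gamma_1,\gamma_2:\mathbb R\to H$ (i.e. $C^1$ group homomorphisms), $$\lim_{n\to\infty}\big(\gamma_1(\tfrac{t}{n})\gamma_2(\tfrac{t}{n})\big)^n=\exp_{H}\big(t(\gamma_1'(0)+\gamma_2'(0))\big)$$ uniformly in $t$ on compact subsets of $\mathbb R$.
   Context: $\mathrm{Aut}(N)$ is the group of Lie group automorphisms of $N$; "$\pi$ defines a continuous action" means that $G\times N\to N$, $(g,n)\mapsto \pi(g)n$, is continuous. $H=N\rtimes_\pi G$ is the product Banach manifold $N\times G$ with multiplication $(n_1,g_1)(n_2,g_2)=(n_1\cdot\pi(g_1)n_2,\,g_1g_2)$; it is a topological group whose left multiplications $\lambda_h: x\mapsto hx$ are smooth (right multiplications are in general only continuous). Put $\mathfrak h:=T_1H=\mathfrak n\times\mathfrak g$ and, for $h\in H$, $x\in\mathfrak h$, $h.x:=T_1(\lambda_h)x\in T_hH$. The exponential function $\exp_H:\mathfrak h\to H$ is $\exp_H(x):=\eta(1)$, where $\eta:[0,1]\to H$ is the unique (existing) $C^1$ solution of $\eta'(t)=\eta(t).x$, $\eta(0)=1_H$; then $t\mapsto \exp_H(tx)$ is a $C^1$ one-parameter group with derivative $x$ at $0$. Uniform convergence $\gamma_n(t)\to\gamma(t)$ on a compact set means: for each identity neighbourhood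 $U$ in $H$ one has $\gamma(t)^{-1}\gamma_n(t)\in U$ for all $t$ in that set and all large $n$. *)

theory Defs
  imports "HOL-Analysis.Analysis" "HOL-Algebra.Bij"
begin

section \<open>Smooth maps between Banach spaces\<close>

text \<open>
  Smooth means infinitely often Fr\'echet differentiable, the derivatives being taken in operator
  norm.  The type of the iterated derivative changes with its order, so the derivative of order
  \<open>k\<close> at \<open>x\<close> is encoded as a function \<open>D x\<close> on the lists of length \<open>k\<close>; the list
  \<open>[v\<^sub>1, \<dots>, v\<^sub>k]\<close> stands for the argument \<open>(v\<^sub>1, \<dots>, v\<^sub>k)\<close> of the \<open>k\<close>-linear map.  The third
  clause is boundedness of that map, the fourth is Fr\'echet differentiability of
  \<open>y \<mapsto> D y\<close> (on lists of length \<open>k\<close>) with derivative \<open>h \<mapsto> D x (h # \<cdot>)\<close>.  Linearity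
  in the arguments behind the first one follows, see \<open>smooth_tower_linear\<close>.
\<close>

definition smooth_tower ::
    "'a::real_normed_vector set \<Rightarrow> ('a \<Rightarrow> 'b::real_normed_vector) \<Rightarrow> ('a \<Rightarrow> 'a list \<Rightarrow> 'b) \<Rightarrow> bool" where
  "smooth_tower U f D \<longleftrightarrow>
     (\<forall>x\<in>U. D x [] = f x) \<and>
     (\<forall>x\<in>U. \<forall>vs. bounded_linear (\<lambda>h. D x (h # vs))) \<and>
     (\<forall>x\<in>U. \<forall>k. \<exists>C. \<forall>vs. length vs = k \<longrightarrow> norm (D x vs) \<le> C * prod_list (map norm vs)) \<and>
     (\<forall>x\<in>U. \<forall>k. \<forall>e>0. \<exists>d>0. \<forall>y\<in>U. norm (y - x) < d \<longrightarrow>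
        (\<forall>vs. length vs = k \<longrightarrow>
           norm (D y vs - D x vs - D x ((y - x) # vs))
             \<le> e * norm (y - x) * prod_list (map norm vs)))"

definition smooth_on ::
    "'a::real_normed_vector set \<Rightarrow> ('a \<Rightarrow> 'b::real_normed_vector) \<Rightarrow> bool" where
  "smooth_on U f \<longleftrightarrow> open U \<and> (\<exists>D. smooth_tower U f D)"

lemma smooth_tower_has_derivative:
  assumes "smooth_tower U f D" "open U" "x \<in> U"
  shows "((\<lambda>y. D y vs) has_derivative (\<lambda>h. D x (h # vs))) (at x)"
proof -
  have "((\<lambda>y. D y vs) has_derivative (\<lambda>h. D x (h # vs))) (at x within U)"
    unfolding has_derivative_within_alt2
  proof (intro conjI allI impI)
    show "bounded_linear (\<lambda>h. D x (h # vs))"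
      using assms unfolding smooth_tower_def by blast
    fix e :: real
    assume e: "e > 0"
    define P where "P = prod_list (map norm vs)"
    have P: "P \<ge> 0" unfolding P_def by (rule prod_list_nonneg) auto
    define e' where "e' = e / (P + 1)"
    have e': "e' > 0" using e P by (simp add: e'_def)
    have "\<forall>k. \<forall>e>0. \<exists>d>0. \<forall>y\<in>U. norm (y - x) < d \<longrightarrow> (\<forall>vs. length vs = k \<longrightarrow>
        norm (D y vs - D x vs - D x ((y - x) # vs)) \<le> e * norm (y - x) * prod_list (map norm vs))"
      using assms(1,3) unfolding smooth_tower_def by fast
    from this[rule_format, OF e', of "length vs"]
    obtain d where d: "d > 0" and
      b: "\<And>y. y \<in> U \<Longrightarrow> norm (y - x) < d \<Longrightarrow>
        norm (D y vs - D x vs - D x ((y - x) # vs)) \<le> e' * norm (y - x) * P"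
      unfolding P_def by blast
    have "e' * P \<le> e" using e P by (simp add: e'_def field_simps)
    then have "norm (D y vs - D x vs - D x ((y - x) # vs)) \<le> e * norm (y - x)"
      if "y \<in> U" "norm (y - x) < d" for y
      using b[OF that] mult_right_mono[of "e' * P" e "norm (y - x)"] by (simp add: mult_ac)
    then show "\<forall>\<^sub>F y in at x within U.
        norm (D y vs - D x vs - D x ((y - x) # vs)) \<le> e * norm (y - x)"
      unfolding eventually_at dist_norm using d by blast
  qed
  then show ?thesis by (simp only: at_within_open[OF assms(3,2)])
qed

lemma smooth_tower_linear:
  assumes D: "smooth_tower U f D" and U: "open U" and "x \<in> U"
  shows "linear (\<lambda>v. D x (us @ v # ws))"
  using \<open>x \<in> U\<close>
proof (induction us arbitrary: x)
  case Nil
  then show ?case using D unfolding smooth_tower_def by (simp add: bounded_linear.linear)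
next
  case (Cons h us)
  note der = smooth_tower_has_derivative[OF D U Cons.prems]
  have "D x (h # us @ (a + b) # ws) = D x (h # us @ a # ws) + D x (h # us @ b # ws)" for a b
  proof -
    have "((\<lambda>y. D y (us @ (a + b) # ws)) has_derivative
        (\<lambda>h. D x (h # us @ a # ws) + D x (h # us @ b # ws))) (at x)"
      by (rule has_derivative_transform_within_open[OF has_derivative_add[OF der der] U Cons.prems])
        (simp add: linear_add[OF Cons.IH])
    from has_derivative_unique[OF this der] show ?thesis by metis
  qed
  moreover have "D x (h # us @ (r *\<^sub>R a) # ws) = r *\<^sub>R D x (h # us @ a # ws)" for r a
  proof -
    have "((\<lambda>y. D y (us @ (r *\<^sub>R a) # ws)) has_derivative
        (\<lambda>h. r *\<^sub>R D x (h # us @ a # ws))) (at x)"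
      by (rule has_derivative_transform_within_open[OF has_derivative_scaleR_right[OF der] U Cons.prems])
        (simp add: linear_scale[OF Cons.IH])
    from has_derivative_unique[OF this der] show ?thesis by metis
  qed
  ultimately show ?case by (intro linearI) auto
qed

lemma smooth_on_differentiable:
  assumes "smooth_on U f" "x \<in> U"
  shows "f differentiable (at x)"
proof -
  from assms obtain D where D: "smooth_tower U f D" and U: "open U"
    unfolding smooth_on_def by blast
  have "(f has_derivative (\<lambda>h. D x [h])) (at x)"
    by (rule has_derivative_transform_within_open[OF smooth_tower_has_derivative[OF D U assms(2)] U assms(2)])
      (use D in \<open>simp add: smooth_tower_def\<close>)
  then show ?thesis unfolding differentiable_def by blast
qed


section \<open>Banach manifolds\<close>

type_synonym ('m, 'a) chart = "'m set \<times> ('m \<Rightarrow> 'a)"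

record ('m, 'a) manifold =
  mfd_top :: "'m topology"
  atlas :: "('m, 'a) chart set"

definition banach_manifold :: "('m, 'a::banach) manifold \<Rightarrow> bool" where
  "banach_manifold M \<longleftrightarrow>
     Hausdorff_space (mfd_top M) \<and>
     (\<Union>(U, \<phi>)\<in>atlas M. U) = topspace (mfd_top M) \<and>
     (\<forall>(U, \<phi>)\<in>atlas M. openin (mfd_top M) U \<and> open (\<phi> ` U) \<and>
        homeomorphic_map (subtopology (mfd_top M) U) (top_of_set (\<phi> ` U)) \<phi>) \<and>
     (\<forall>(U, \<phi>)\<in>atlas M. \<forall>(V, \<psi>)\<in>atlas M.
        smooth_on (\<phi> ` (U \<inter> V)) (\<psi> \<circ> inv_into U \<phi>))"

definition prod_manifold ::
    "('m, 'a::banach) manifold \<Rightarrow> ('n, 'b::banach) manifold \<Rightarrow> ('m \<times> 'n, 'a \<times> 'b) manifold" where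
  "prod_manifold M N =
     \<lparr>mfd_top = prod_topology (mfd_top M) (mfd_top N),
      atlas = {(U \<times> V, map_prod \<phi> \<psi>) | U \<phi> V \<psi>. (U, \<phi>) \<in> atlas M \<and> (V, \<psi>) \<in> atlas N}\<rparr>"

definition smooth_map ::
    "('m, 'a::banach) manifold \<Rightarrow> ('n, 'b::banach) manifold \<Rightarrow> ('m \<Rightarrow> 'n) \<Rightarrow> bool" where
  "smooth_map M N f \<longleftrightarrow>
     continuous_map (mfd_top M) (mfd_top N) f \<and>
     (\<forall>(U, \<phi>)\<in>atlas M. \<forall>(V, \<psi>)\<in>atlas N.
        smooth_on (\<phi> ` (U \<inter> f -` V)) (\<psi> \<circ> f \<circ> inv_into U \<phi>))"

text \<open>
  A tangent vector at \<open>p\<close> is given by its coordinates in all charts around \<open>p\<close>, related by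
  the derivatives of the chart changes; at the other charts the value is \<open>0\<close> by convention.
  The vector space operations of \<open>T\<^sub>pM\<close> are the pointwise ones.
\<close>

definition tangent_space :: "('m, 'a::banach) manifold \<Rightarrow> 'm \<Rightarrow> (('m, 'a) chart \<Rightarrow> 'a) set" where
  "tangent_space M p =
     {v. (\<forall>c. c \<notin> atlas M \<or> p \<notin> fst c \<longrightarrow> v c = 0) \<and>
         (\<forall>(U, \<phi>)\<in>atlas M. \<forall>(V, \<psi>)\<in>atlas M. p \<in> U \<inter> V \<longrightarrow>
            v (V, \<psi>) = frechet_derivative (\<psi> \<circ> inv_into U \<phi>) (at (\<phi> p)) (v (U, \<phi>)))}"

definition tangent_add ::
    "(('m, 'a::banach) chart \<Rightarrow> 'a) \<Rightarrow> (('m, 'a) chart \<Rightarrow> 'a) \<Rightarrow> ('m, 'a) chart \<Rightarrow> 'a" where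
  "tangent_add v w = (\<lambda>c. v c + w c)"

definition tangent_scale ::
    "real \<Rightarrow> (('m, 'a::banach) chart \<Rightarrow> 'a) \<Rightarrow> ('m, 'a) chart \<Rightarrow> 'a" where
  "tangent_scale r v = (\<lambda>c. r *\<^sub>R v c)"

text \<open>
  On \<open>T\<^sub>pM\<close> the following is the tangent map \<open>T\<^sub>pf\<close>; there the choice of the chart around \<open>p\<close>
  does not matter.
\<close>

definition tangent_map ::
    "('m, 'a::banach) manifold \<Rightarrow> ('n, 'b::banach) manifold \<Rightarrow> ('m \<Rightarrow> 'n) \<Rightarrow> 'm \<Rightarrow>
     (('m, 'a) chart \<Rightarrow> 'a) \<Rightarrow> ('n, 'b) chart \<Rightarrow> 'b" where
  "tangent_map M N f p v =
     (\<lambda>(V, \<psi>). if (V, \<psi>) \<in> atlas N \<and> f p \<in> V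
        then (let (U, \<phi>) = (SOME c. c \<in> atlas M \<and> p \<in> fst c)
              in frechet_derivative (\<psi> \<circ> f \<circ> inv_into U \<phi>) (at (\<phi> p)) (v (U, \<phi>)))
        else 0)"

text \<open>
  Curves are defined on an interval \<open>I\<close> (here \<open>UNIV\<close> or \<open>{0..1}\<close>), with one-sided derivatives at
  its end points.
\<close>

definition C1_curve :: "('m, 'a::banach) manifold \<Rightarrow> real set \<Rightarrow> (real \<Rightarrow> 'm) \<Rightarrow> bool" where
  "C1_curve M I \<gamma> \<longleftrightarrow>
     continuous_map (top_of_set I) (mfd_top M) \<gamma> \<and>
     (\<forall>(U, \<phi>)\<in>atlas M. \<exists>D. continuous_on (I \<inter> \<gamma> -` U) D \<and>
        (\<forall>t\<in>I \<inter> \<gamma> -` U. ((\<phi> \<circ> \<gamma>) has_vector_derivative D t) (at t within I)))"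

definition velocity ::
    "('m, 'a::banach) manifold \<Rightarrow> real set \<Rightarrow> (real \<Rightarrow> 'm) \<Rightarrow> real \<Rightarrow> ('m, 'a) chart \<Rightarrow> 'a" where
  "velocity M I \<gamma> t =
     (\<lambda>(U, \<phi>). if (U, \<phi>) \<in> atlas M \<and> \<gamma> t \<in> U
        then vector_derivative (\<phi> \<circ> \<gamma>) (at t within I) else 0)"

lemma velocity_in_tangent_space:
  assumes M: "banach_manifold M" and \<gamma>: "C1_curve M I \<gamma>" and t: "t \<in> I"
    and ne: "at t within I \<noteq> bot"
  shows "velocity M I \<gamma> t \<in> tangent_space M (\<gamma> t)"
proof -
  have vel: "((\<phi> \<circ> \<gamma>) has_vector_derivative velocity M I \<gamma> t (U, \<phi>)) (at t within I)"
    if "(U, \<phi>) \<in> atlas M" "\<gamma> t \<in> U" for U \<phi>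
  proof -
    from \<gamma> that t obtain v where "((\<phi> \<circ> \<gamma>) has_vector_derivative v) (at t within I)"
      unfolding C1_curve_def by blast
    then show ?thesis
      using that vector_derivative_within[OF ne] by (auto simp: velocity_def)
  qed
  have "velocity M I \<gamma> t (V, \<psi>) =
      frechet_derivative (\<psi> \<circ> inv_into U \<phi>) (at (\<phi> (\<gamma> t))) (velocity M I \<gamma> t (U, \<phi>))"
    if c: "(U, \<phi>) \<in> atlas M" "(V, \<psi>) \<in> atlas M" and p: "\<gamma> t \<in> U" "\<gamma> t \<in> V" for U \<phi> V \<psi>
  proof -
    let ?L = "frechet_derivative (\<psi> \<circ> inv_into U \<phi>) (at (\<phi> (\<gamma> t)))"
    let ?v = "velocity M I \<gamma> t (U, \<phi>)"
    have "smooth_on (\<phi> ` (U \<inter> V)) (\<psi> \<circ> inv_into U \<phi>)"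
      using M c unfolding banach_manifold_def by blast
    then have L: "((\<psi> \<circ> inv_into U \<phi>) has_derivative ?L) (at (\<phi> (\<gamma> t)))"
      using p by (auto intro!: smooth_on_differentiable simp flip: frechet_derivative_works)
    have U: "openin (mfd_top M) U"
      and hom: "homeomorphic_map (subtopology (mfd_top M) U) (top_of_set (\<phi> ` U)) \<phi>"
      using M c unfolding banach_manifold_def by blast+
    have inj: "inj_on \<phi> U"
      using homeomorphic_imp_injective_map[OF hom] openin_subset[OF U]
      by (simp add: topspace_subtopology Int_absorb1)
    have "openin (top_of_set I) {s \<in> I. \<gamma> s \<in> U}"
      using \<gamma> U openin_continuous_map_preimage unfolding C1_curve_def by fastforce
    then obtain T where T: "open T" "{s \<in> I. \<gamma> s \<in> U} = I \<inter> T"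
      by (auto simp: openin_open)
    have ev: "\<forall>\<^sub>F s in at t within I. \<gamma> s \<in> U"
      using T t p unfolding eventually_at_topological by blast
    have "((\<phi> \<circ> \<gamma>) has_derivative (\<lambda>s. s *\<^sub>R ?v)) (at t within I)"
      using vel[OF c(1) p(1)] by (simp add: has_vector_derivative_def)
    then have "((\<lambda>s. (\<psi> \<circ> inv_into U \<phi>) ((\<phi> \<circ> \<gamma>) s)) has_derivative (\<lambda>s. ?L (s *\<^sub>R ?v)))
        (at t within I)"
      by (rule has_derivative_compose) (use L in \<open>simp add: o_def\<close>)
    moreover have "?L (s *\<^sub>R ?v) = s *\<^sub>R ?L ?v" for s
      using L by (simp add: has_derivative_linear linear_scale)
    ultimately have "((\<lambda>s. (\<psi> \<circ> inv_into U \<phi>) ((\<phi> \<circ> \<gamma>) s)) has_vector_derivative ?L ?v)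
        (at t within I)"
      by (simp add: has_vector_derivative_def)
    note chain = this
    have eq: "(\<psi> \<circ> inv_into U \<phi>) ((\<phi> \<circ> \<gamma>) s) = (\<psi> \<circ> \<gamma>) s" if "\<gamma> s \<in> U" for s
      using inv_into_f_f[OF inj that] by simp
    have "((\<psi> \<circ> \<gamma>) has_vector_derivative ?L ?v) (at t within I)"
      using has_derivative_transform_eventually[OF chain[unfolded has_vector_derivative_def]
          eventually_mono[OF ev eq] eq[OF p(1)] t]
      unfolding has_vector_derivative_def .
    then show ?thesis
      using vel[OF c(2) p(2)] vector_derivative_within[OF ne] by metis
  qed
  note coords = this
  have zero: "velocity M I \<gamma> t c = 0" if "c \<notin> atlas M \<or> \<gamma> t \<notin> fst c" for c
    using that by (cases c) (auto simp: velocity_def)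
  show ?thesis
    unfolding tangent_space_def
    by (intro CollectI conjI allI ballI case_prodI2 impI zero) (simp, rule coords, simp_all)
qed


section \<open>Banach--Lie groups and semidirect products\<close>

definition banach_lie_group ::
    "('g, 'c) monoid_scheme \<Rightarrow> ('g, 'a::banach) manifold \<Rightarrow> bool" where
  "banach_lie_group G M \<longleftrightarrow>
     group G \<and> banach_manifold M \<and> topspace (mfd_top M) = carrier G \<and>
     smooth_map (prod_manifold M M) M (\<lambda>(x, y). x \<otimes>\<^bsub>G\<^esub> y) \<and>
     smooth_map M M (\<lambda>x. inv\<^bsub>G\<^esub> x)"

definition lie_Aut ::
    "('g, 'c) monoid_scheme \<Rightarrow> ('g, 'a::banach) manifold \<Rightarrow> ('g \<Rightarrow> 'g) monoid" where
  "lie_Aut G M = AutoGroup G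
     \<lparr>carrier := {f \<in> auto G. smooth_map M M f \<and> smooth_map M M (inv_into (carrier G) f)}\<rparr>"

definition continuous_action ::
    "('g, 'a::banach) manifold \<Rightarrow> ('n, 'b::banach) manifold \<Rightarrow> ('g \<Rightarrow> 'n \<Rightarrow> 'n) \<Rightarrow> bool" where
  "continuous_action MG MN \<pi> \<longleftrightarrow>
     continuous_map (prod_topology (mfd_top MG) (mfd_top MN)) (mfd_top MN) (\<lambda>(g, n). \<pi> g n)"

definition semidirect_product ::
    "('n, 'c) monoid_scheme \<Rightarrow> ('g, 'd) monoid_scheme \<Rightarrow> ('g \<Rightarrow> 'n \<Rightarrow> 'n) \<Rightarrow> ('n \<times> 'g) monoid" where
  "semidirect_product N G \<pi> =
     \<lparr>carrier = carrier N \<times> carrier G,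
      mult = (\<lambda>(n\<^sub>1, g\<^sub>1) (n\<^sub>2, g\<^sub>2). (n\<^sub>1 \<otimes>\<^bsub>N\<^esub> \<pi> g\<^sub>1 n\<^sub>2, g\<^sub>1 \<otimes>\<^bsub>G\<^esub> g\<^sub>2)),
      one = (\<one>\<^bsub>N\<^esub>, \<one>\<^bsub>G\<^esub>)\<rparr>"


section \<open>Exponential function and Trotter property\<close>

text \<open>\<open>left_translate H M h x\<close> is \<open>h.x = T\<^sub>1(\<lambda>\<^sub>h) x\<close> for \<open>x \<in> T\<^sub>1H\<close>.\<close>

definition left_translate ::
    "('h, 'c) monoid_scheme \<Rightarrow> ('h, 'a::banach) manifold \<Rightarrow> 'h \<Rightarrow>
     (('h, 'a) chart \<Rightarrow> 'a) \<Rightarrow> ('h, 'a) chart \<Rightarrow> 'a" where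
  "left_translate H M h x = tangent_map M M (\<lambda>y. h \<otimes>\<^bsub>H\<^esub> y) \<one>\<^bsub>H\<^esub> x"

definition exp_solution ::
    "('h, 'c) monoid_scheme \<Rightarrow> ('h, 'a::banach) manifold \<Rightarrow>
     (('h, 'a) chart \<Rightarrow> 'a) \<Rightarrow> (real \<Rightarrow> 'h) \<Rightarrow> bool" where
  "exp_solution H M x \<eta> \<longleftrightarrow>
     C1_curve M {0..1} \<eta> \<and> \<eta> 0 = \<one>\<^bsub>H\<^esub> \<and>
     (\<forall>t\<in>{0..1}. velocity M {0..1} \<eta> t = left_translate H M (\<eta> t) x)"

definition lie_exp ::
    "('h, 'c) monoid_scheme \<Rightarrow> ('h, 'a::banach) manifold \<Rightarrow> (('h, 'a) chart \<Rightarrow> 'a) \<Rightarrow> 'h" where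
  "lie_exp H M x = (THE h. \<exists>\<eta>. exp_solution H M x \<eta> \<and> h = \<eta> 1)"

definition C1_one_parameter_group ::
    "('h, 'c) monoid_scheme \<Rightarrow> ('h, 'a::banach) manifold \<Rightarrow> (real \<Rightarrow> 'h) \<Rightarrow> bool" where
  "C1_one_parameter_group H M \<gamma> \<longleftrightarrow>
     C1_curve M UNIV \<gamma> \<and> (\<forall>s. \<gamma> s \<in> carrier H) \<and> (\<forall>s t. \<gamma> (s + t) = \<gamma> s \<otimes>\<^bsub>H\<^esub> \<gamma> t)"

definition group_uniform_limit_on ::
    "('h, 'c) monoid_scheme \<Rightarrow> 'h topology \<Rightarrow> real set \<Rightarrow>
     (nat \<Rightarrow> real \<Rightarrow> 'h) \<Rightarrow> (real \<Rightarrow> 'h) \<Rightarrow> bool" where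
  "group_uniform_limit_on H T K f l \<longleftrightarrow>
     (\<forall>U. openin T U \<and> \<one>\<^bsub>H\<^esub> \<in> U \<longrightarrow>
        (\<forall>\<^sub>F n in sequentially. \<forall>t\<in>K. inv\<^bsub>H\<^esub> (l t) \<otimes>\<^bsub>H\<^esub> f n t \<in> U))"

definition trotter_property ::
    "('h, 'c) monoid_scheme \<Rightarrow> ('h, 'a::banach) manifold \<Rightarrow> bool" where
  "trotter_property H M \<longleftrightarrow>
     (\<forall>\<gamma>\<^sub>1 \<gamma>\<^sub>2. C1_one_parameter_group H M \<gamma>\<^sub>1 \<and> C1_one_parameter_group H M \<gamma>\<^sub>2 \<longrightarrow>
        (\<forall>K. compact K \<longrightarrow>
           group_uniform_limit_on H (mfd_top M) K
             (\<lambda>n t. (\<gamma>\<^sub>1 (t / real n) \<otimes>\<^bsub>H\<^esub> \<gamma>\<^sub>2 (t / real n)) [^]\<^bsub>H\<^esub> n)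
             (\<lambda>t. lie_exp H M
                (tangent_scale t (tangent_add (velocity M UNIV \<gamma>\<^sub>1 0) (velocity M UNIV \<gamma>\<^sub>2 0))))))"

end

theory Submission
  imports Defs
begin

text \<open>
  In a chart around the identity the multiplication of a Banach--Lie group is addition up to an error
  \<open>O(\<bar>x\<bar>\<bar>y\<bar>)\<close>.  Hence two products \<open>P\<^sub>k = u\<^sub>0 \<cdots> u\<^sub>k\<^sub>-\<^sub>1\<close> and \<open>Q\<^sub>k = v\<^sub>0 \<cdots> v\<^sub>k\<^sub>-\<^sub>1\<close> with \<open>k \<le> n\<close>,
  \<open>v\<^sub>i = O(1/n)\<close> and \<open>v\<^sub>i\<^sup>-\<^sup>1u\<^sub>i = o(1/n)\<close> satisfy \<open>Q\<^sub>k\<^sup>-\<^sup>1P\<^sub>k = o(1)\<close>.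

  In \<open>H\<close> itself this is not available, since right multiplications are only continuous, but it can be
  applied to \<open>G\<close> and then to \<open>N\<close>: if \<open>\<gamma>\<^sub>1(s)\<gamma>\<^sub>2(s) = (b(s), c(s))\<close>, the \<open>N\<close>-component of its \<open>n\<close>-th power is
  the product of the \<open>\<pi>(c(s)\<^sup>k) b(s)\<close>, while a one-parameter group \<open>(\<beta>, \<alpha>)\<close> of \<open>H\<close> has
  \<open>\<beta>(ks)\<^sup>-\<^sup>1\<beta>((k + 1)s) = \<pi>(\<alpha>(ks)) \<beta>(s)\<close>.  The factors are compared by means of two properties of the
  action.  As there are no small subgroups, \<open>\<bar>\<pi>(g) x\<bar> \<le> K \<bar>x\<bar>\<close> locally uniformly in \<open>g\<close>; consequently
  \<open>\<pi>(g) x\<close> agrees with its linearization at the identity up to \<open>O(\<bar>x\<bar>\<^sup>2)\<close>, again uniformly in \<open>g\<close>, and this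
  linearization is strongly continuous in \<open>g\<close>.

  The one-parameter group with a given velocity is obtained by solving the equation for the logarithmic
  derivative locally, first in \<open>G\<close> and then in \<open>N\<close>, by Picard iteration in the chart.  Uniqueness of such
  solutions makes the local solution a local homomorphism, which extends to \<open>\<real>\<close>, and identifies it with
  the solution that defines the exponential function.
\<close>

section \<open>Preliminaries on the real line and differential equations\<close>

text \<open>The obstacle is that \<open>h \<mapsto> h.x\<close> is in general only a continuous
  vector field on \<open>H\<close>, so neither Picard iteration nor a Gronwall estimate applies to
  it directly. Curves are therefore described by their left quotients
  \<open>inv (\<eta> t) \<otimes> \<eta> (t + s)\<close>, which split into a \<open>G\<close>-part
  and an \<open>N\<close>-part twisted by \<open>\<pi>\<close>. Once the \<open>G\<close>-part
  \<open>\<alpha>\<close> is known, the \<open>N\<close>-part is a problem inside the Lie group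
  \<open>N\<close>: its logarithmic derivative is the known curve \<open>A (\<alpha> t) w\<close>,
  and continuity of this curve is all that is required. This is why strong continuity of
  \<open>A\<close> is enough; continuity in operator norm may fail. In the Trotter product the
  argument of \<open>\<pi>\<close> changes with \<open>k\<close>. Strong continuity is used there
  only at the identity of \<open>G\<close>, for the small quotient of \<open>c(s)\<^sup>k\<close>
  and \<open>\<alpha>(ks)\<close>; the resulting error is transported by
  \<open>\<pi> (\<alpha> (ks))\<close>, for which a Lipschitz bound holds uniformly on bounded time
  intervals. Hence the comparison in \<open>G\<close> has to cover all \<open>k \<le> n\<close>, not
  only the final power.\<close>

text \<open>Look at the infimum \<open>m\<close> of the failures: \<open>base\<close> or
  \<open>lim\<close> gives \<open>P m\<close>, and \<open>step\<close> then keeps failures away from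
  \<open>m\<close> on the right, so \<open>m\<close> is not their infimum.\<close>

lemma real_interval_induct:
  fixes a b :: real
  assumes base: "P a"
    and step: "\<And>t. a \<le> t \<Longrightarrow> t < b \<Longrightarrow> P t \<Longrightarrow> \<forall>\<^sub>F s in at_right t. P s"
    and lim: "\<And>t. a < t \<Longrightarrow> t \<le> b \<Longrightarrow> (\<And>s. a \<le> s \<Longrightarrow> s < t \<Longrightarrow> P s) \<Longrightarrow> P t"
    and t: "t \<in> {a..b}"
  shows "P t"
proof (rule ccontr)
  assume nt: "\<not> P t"
  define S where "S = {s \<in> {a..b}. \<not> P s}"
  define m where "m = Inf S"
  have tS: "t \<in> S" and bdd: "bdd_below S" using t nt by (auto simp: S_def)
  have mt: "m \<le> t" unfolding m_def using cInf_lower[OF tS bdd] .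
  have am: "a \<le> m" unfolding m_def by (rule cInf_greatest) (use tS in \<open>auto simp: S_def\<close>)
  have below: "P s" if "a \<le> s" "s < m" for s
  proof (rule ccontr)
    assume "\<not> P s"
    then have "s \<in> S" using that mt t by (auto simp: S_def)
    then show False using cInf_lower[OF _ bdd, of s] that by (simp add: m_def)
  qed
  have Pm: "P m"
  proof (cases "m = a")
    case False
    then show ?thesis using lim[of m] below am mt t by auto
  qed (simp add: base)
  then have "m < b" using mt t nt by (cases "m = b") auto
  from step[OF am this Pm] obtain c where c: "c > m" "\<And>s. m < s \<Longrightarrow> s < c \<Longrightarrow> P s"
    by (auto simp: eventually_at_right_field)
  obtain s where s: "s \<in> S" "s < c"
    using cInf_lessD[of S c] c(1) tS unfolding m_def by auto
  have "m \<le> s" unfolding m_def using cInf_lower[OF s(1) bdd] .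
  then have "P s" using Pm c(2)[of s] s(2) by (cases "m = s") auto
  then show False using s(1) by (simp add: S_def)
qed

text \<open>The function \<open>e * exp ((\<kappa> + 1) * (t - a))\<close> is a barrier: it is at
  least \<open>e\<close>, so the extra \<open>1\<close> in the exponent absorbs the error
  \<open>e\<close> of the one-sided estimate. Then \<open>e\<close> tends to \<open>0\<close>. No
  derivative of \<open>\<rho>\<close> is involved, since \<open>\<rho>\<close> will be the norm of a
  curve.\<close>

lemma dini_gronwall:
  fixes \<rho> :: "real \<Rightarrow> real"
  assumes cont: "continuous_on {a..b} \<rho>" and a: "\<rho> a \<le> 0" and \<kappa>: "\<kappa> \<ge> 0"
    and dini: "\<And>t e. a \<le> t \<Longrightarrow> t < b \<Longrightarrow> e > 0 \<Longrightarrow>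
      \<forall>\<^sub>F s in at_right t. \<rho> s \<le> \<rho> t + (s - t) * (\<kappa> * \<rho> t + e)"
    and t: "t \<in> {a..b}"
  shows "\<rho> t \<le> 0"
proof -
  have main: "\<rho> t \<le> e * exp ((\<kappa> + 1) * (t - a))" if e: "e > 0" for e
  proof (rule real_interval_induct[where P = "\<lambda>t. \<rho> t \<le> e * exp ((\<kappa> + 1) * (t - a))", OF _ _ _ t])
    show "\<rho> a \<le> e * exp ((\<kappa> + 1) * (a - a))" using a e by simp
  next
    fix t assume t: "a \<le> t" "t < b" and IH: "\<rho> t \<le> e * exp ((\<kappa> + 1) * (t - a))"
    define y where "y = e * exp ((\<kappa> + 1) * (t - a))"
    have ey: "e \<le> y" using e t \<kappa> by (simp add: y_def)
    have "\<forall>\<^sub>F s in at_right t. s > t" by (simp add: eventually_at_right_less)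
    with dini[OF t e] show "\<forall>\<^sub>F s in at_right t. \<rho> s \<le> e * exp ((\<kappa> + 1) * (s - a))"
    proof eventually_elim
      case (elim s)
      have "\<rho> t + (s - t) * (\<kappa> * \<rho> t + e) \<le> y + (s - t) * (\<kappa> * y + y)"
        using elim IH ey \<kappa> unfolding y_def[symmetric]
        by (intro add_mono mult_left_mono) auto
      also have "\<dots> = y * (1 + (\<kappa> + 1) * (s - t))" by (simp add: algebra_simps)
      also have "\<dots> \<le> y * exp ((\<kappa> + 1) * (s - t))"
        using ey e by (intro mult_left_mono exp_ge_add_one_self) auto
      also have "\<dots> = e * exp ((\<kappa> + 1) * (s - a))"
        by (simp add: y_def algebra_simps flip: exp_add)
      finally show ?case using elim by linarith
    qed
  next
    fix t assume t: "a < t" "t \<le> b" and IH: "\<And>s. a \<le> s \<Longrightarrow> s < t \<Longrightarrow> \<rho> s \<le> e * exp ((\<kappa> + 1) * (s - a))"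
    have "continuous_on {a..t} \<rho>" by (rule continuous_on_subset[OF cont]) (use t in auto)
    then have "(\<rho> \<longlongrightarrow> \<rho> t) (at_left t)"
      using t by (auto simp: continuous_on_Icc_at_leftD)
    moreover have "((\<lambda>s. e * exp ((\<kappa> + 1) * (s - a))) \<longlongrightarrow> e * exp ((\<kappa> + 1) * (t - a))) (at_left t)"
      by (intro tendsto_intros)
    moreover have "\<forall>\<^sub>F s in at_left t. \<rho> s \<le> e * exp ((\<kappa> + 1) * (s - a))"
      using IH t unfolding eventually_at_left_field by (intro exI[of _ a]) auto
    ultimately show "\<rho> t \<le> e * exp ((\<kappa> + 1) * (t - a))"
      by (intro tendsto_le[of "at_left t"]) auto
  qed
  show ?thesis
  proof (rule field_le_epsilon)
    fix e :: real assume "e > 0"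
    then show "\<rho> t \<le> 0 + e" using main[of "e / exp ((\<kappa> + 1) * (t - a))"] by simp
  qed
qed

lemma has_vector_derivative_bound:
  fixes f :: "real \<Rightarrow> 'a::real_normed_vector"
  assumes "\<And>t. t \<in> {a..b} \<Longrightarrow> (f has_vector_derivative f' t) (at t within {a..b})"
    and "\<And>t. t \<in> {a..b} \<Longrightarrow> norm (f' t) \<le> B" and "s \<in> {a..b}" "t \<in> {a..b}"
  shows "norm (f t - f s) \<le> B * \<bar>t - s\<bar>"
proof -
  have "norm (f t - f s) \<le> B * norm (t - s)"
  proof (rule differentiable_bound[of "{a..b}"])
    fix x assume x: "x \<in> {a..b}"
    then show "(f has_derivative (\<lambda>h. h *\<^sub>R f' x)) (at x within {a..b})"
      using assms(1) by (simp add: has_vector_derivative_def)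
    show "onorm (\<lambda>h. h *\<^sub>R f' x) \<le> B"
    proof (rule onorm_le)
      fix h :: real
      show "norm (h *\<^sub>R f' x) \<le> B * norm h"
        using mult_right_mono[OF assms(2)[OF x], of "\<bar>h\<bar>"] by (simp add: mult.commute)
    qed
  qed (use assms in auto)
  then show ?thesis by simp
qed

text \<open>Banach's fixed point theorem on the bounded continuous functions from the whole real
  line into the \<open>r\<close>-ball. The integral operator is replaced by the choice of an
  antiderivative that vanishes at \<open>0\<close>.\<close>

lemma picard_local:
  fixes F :: "real \<Rightarrow> 'a::banach \<Rightarrow> 'a"
  assumes r: "r > 0"
    and cont: "\<And>\<xi>. continuous_on {-1..1} \<xi> \<Longrightarrow> (\<And>t. norm (\<xi> t) \<le> r) \<Longrightarrow> continuous_on {-1..1} (\<lambda>t. F t (\<xi> t))"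
    and bd: "\<And>t p. \<bar>t\<bar> \<le> 1 \<Longrightarrow> norm p \<le> r \<Longrightarrow> norm (F t p) \<le> K"
    and lip: "\<And>t p q. \<bar>t\<bar> \<le> 1 \<Longrightarrow> norm p \<le> r \<Longrightarrow> norm q \<le> r \<Longrightarrow> norm (F t p - F t q) \<le> \<Lambda> * norm (p - q)"
    and K: "K \<ge> 0" and \<Lambda>: "\<Lambda> \<ge> 0"
  shows "\<exists>\<tau>>0. \<exists>\<xi>. \<tau> \<le> 1 \<and> \<xi> 0 = 0 \<and> (\<forall>t. norm (\<xi> t) \<le> r) \<and>
     (\<forall>t\<in>{-\<tau>..\<tau>}. (\<xi> has_vector_derivative F t (\<xi> t)) (at t within {-\<tau>..\<tau>}))"
proof -
  \<comment> \<open>The second entry gives \<open>K * \<tau> \<le> r\<close>, so that the ball is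
    mapped to itself; the third gives \<open>\<Lambda> * \<tau> \<le> 1/2\<close>, the
    contraction.\<close>
  define \<tau> where "\<tau> = Min {1, r / (K + 1), 1 / (2 * (\<Lambda> + 1))}"
  have \<tau>: "\<tau> > 0" "\<tau> \<le> 1" "\<tau> \<le> r / (K + 1)" "\<tau> \<le> 1 / (2 * (\<Lambda> + 1))"
    using r K \<Lambda> by (auto simp: \<tau>_def)
  have K\<tau>: "K * \<tau> \<le> r" using \<tau>(1,3) K r by (simp add: field_simps)
  have \<Lambda>\<tau>: "\<Lambda> * \<tau> \<le> 1/2" using \<tau>(1,4) \<Lambda> by (simp add: field_simps)
  \<comment> \<open>Elements of the function space live on all of \<open>\<real>\<close>; composing
    with \<open>cl\<close> freezes them outside \<open>{-\<tau>..\<tau>}\<close>, which keeps them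
    continuous and bounded.\<close>
  define cl where "cl t = max (-\<tau>) (min \<tau> t)" for t :: real
  have cl: "cl t \<in> {-\<tau>..\<tau>}" for t using \<tau> by (auto simp: cl_def)
  have clid: "cl t = t" if "t \<in> {-\<tau>..\<tau>}" for t using that by (auto simp: cl_def)
  have clc: "continuous_on UNIV cl" unfolding cl_def by (intro continuous_intros)
  define S where "S = {\<xi> :: real \<Rightarrow>\<^sub>C 'a. \<forall>t. norm (\<xi> t) \<le> r}"
  have ex: "\<exists>\<zeta>\<in>S. \<zeta> 0 = 0 \<and> (\<forall>t. \<zeta> t = \<zeta> (cl t)) \<and>
      (\<forall>t\<in>{-\<tau>..\<tau>}. (\<zeta> has_vector_derivative F t (\<xi> t)) (at t within {-\<tau>..\<tau>}))" if \<xi>: "\<xi> \<in> S" for \<xi>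
  proof -
    have "continuous_on {-1..1} (\<lambda>t. F t (\<xi> t))"
      by (rule cont) (use \<xi> in \<open>auto simp: S_def intro!: continuous_intros\<close>)
    then have "continuous_on {-\<tau>..\<tau>} (\<lambda>t. F t (\<xi> t))"
      by (rule continuous_on_subset) (use \<tau> in auto)
    then obtain g where g: "\<And>t. t \<in> {-\<tau>..\<tau>} \<Longrightarrow> (g has_vector_derivative F t (\<xi> t)) (at t within {-\<tau>..\<tau>})"
      using antiderivative_continuous by metis
    define h where "h t = g (cl t) - g 0" for t
    have h0: "h 0 = 0" using clid[of 0] \<tau> by (simp add: h_def)
    have hd: "(h has_vector_derivative F t (\<xi> t)) (at t within {-\<tau>..\<tau>})" if t: "t \<in> {-\<tau>..\<tau>}" for t
    proof -
      have *: "((\<lambda>t. g t - g 0) has_vector_derivative F t (\<xi> t)) (at t within {-\<tau>..\<tau>})"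
        using has_vector_derivative_diff[OF g[OF t] has_vector_derivative_const[of "g 0"]] by simp
      show ?thesis
        by (rule has_vector_derivative_transform[OF t _ *]) (simp add: h_def clid)
    qed
    have hb: "norm (h t) \<le> r" for t
    proof -
      have "norm (h (cl t) - h 0) \<le> K * \<bar>cl t - 0\<bar>"
        by (rule has_vector_derivative_bound[OF hd]) (use \<xi> bd \<tau> cl in \<open>auto simp: S_def\<close>)
      also have "\<dots> \<le> K * \<tau>" using cl[of t] K by (intro mult_left_mono) auto
      finally show ?thesis using h0 K\<tau> clid[OF cl] by (simp add: h_def)
    qed
    have "continuous_on {-\<tau>..\<tau>} h"
      by (rule continuous_on_vector_derivative) (use hd in auto)
    then have "continuous_on UNIV (h \<circ> cl)"
      by (rule continuous_on_compose[OF clc continuous_on_subset]) (use cl in auto)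
    moreover have "h \<circ> cl = h" using clid[OF cl] by (auto simp: h_def fun_eq_iff)
    ultimately have "h \<in> bcontfun"
      using hb by (auto simp: bcontfun_def bounded_iff)
    then have app: "apply_bcontfun (Bcontfun h) = h" by (simp add: Bcontfun_inverse)
    show ?thesis
      by (rule bexI[of _ "Bcontfun h"]) (use h0 hd hb clid[OF cl] in \<open>auto simp: app S_def h_def\<close>)
  qed
  then obtain \<Phi> where \<Phi>: "\<And>\<xi>. \<xi> \<in> S \<Longrightarrow> \<Phi> \<xi> \<in> S \<and> \<Phi> \<xi> 0 = 0 \<and> (\<forall>t. \<Phi> \<xi> t = \<Phi> \<xi> (cl t)) \<and>
      (\<forall>t\<in>{-\<tau>..\<tau>}. (\<Phi> \<xi> has_vector_derivative F t (\<xi> t)) (at t within {-\<tau>..\<tau>}))"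
    by metis
  have \<Phi>S: "\<Phi> \<xi> \<in> S" and \<Phi>0: "\<Phi> \<xi> 0 = 0" and \<Phi>cl: "\<Phi> \<xi> t = \<Phi> \<xi> (cl t)"
    and \<Phi>d: "t \<in> {-\<tau>..\<tau>} \<Longrightarrow> (\<Phi> \<xi> has_vector_derivative F t (\<xi> t)) (at t within {-\<tau>..\<tau>})"
    if "\<xi> \<in> S" for \<xi> t
    using \<Phi>[OF that] by blast+
  have "closed S"
  proof -
    have "S = (\<Inter>t. {\<xi> :: real \<Rightarrow>\<^sub>C 'a. norm (\<xi> t) \<le> r})" by (auto simp: S_def)
    moreover have "continuous_on UNIV (\<lambda>\<xi>::real \<Rightarrow>\<^sub>C 'a. \<xi> t)" for t
      by (rule lipschitz_on_continuous_on[of 1]) (auto simp: lipschitz_on_def dist_bounded)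
    then have "closed {\<xi> :: real \<Rightarrow>\<^sub>C 'a. norm (\<xi> t) \<le> r}" for t
      by (intro closed_Collect_le continuous_on_norm continuous_on_const)
    ultimately show ?thesis by (simp add: closed_INT)
  qed
  then have compl: "complete S" by (simp add: complete_eq_closed)
  have "0 \<in> S" using r by (auto simp: S_def)
  then have ne: "S \<noteq> {}" by auto
  have "\<exists>!\<xi>\<in>S. \<Phi> \<xi> = \<xi>"
  proof (rule Banach_fix[OF compl ne, of "1/2"])
    show "\<Phi> ` S \<subseteq> S" using \<Phi>S by auto
    show "dist (\<Phi> \<xi>) (\<Phi> \<zeta>) \<le> 1/2 * dist \<xi> \<zeta>" if "\<xi> \<in> S" "\<zeta> \<in> S" for \<xi> \<zeta>
    proof (rule dist_bound)
      fix t
      have d: "((\<lambda>t. \<Phi> \<xi> t - \<Phi> \<zeta> t) has_vector_derivative (F t (\<xi> t) - F t (\<zeta> t))) (at t within {-\<tau>..\<tau>})"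
        if "t \<in> {-\<tau>..\<tau>}" for t
        by (intro has_vector_derivative_diff) (rule \<Phi>d, fact, fact)+
      have "norm (F t (\<xi> t) - F t (\<zeta> t)) \<le> \<Lambda> * dist \<xi> \<zeta>" if "t \<in> {-\<tau>..\<tau>}" for t
      proof -
        have "norm (F t (\<xi> t) - F t (\<zeta> t)) \<le> \<Lambda> * norm (\<xi> t - \<zeta> t)"
          by (rule lip) (use \<open>\<xi> \<in> S\<close> \<open>\<zeta> \<in> S\<close> that \<tau> in \<open>auto simp: S_def\<close>)
        also have "\<dots> \<le> \<Lambda> * dist \<xi> \<zeta>"
          using dist_bounded[of \<xi> t \<zeta>] \<Lambda> by (intro mult_left_mono) (auto simp: dist_norm)
        finally show ?thesis .
      qed
      from has_vector_derivative_bound[OF d this, of 0 "cl t"]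
      have "norm (\<Phi> \<xi> (cl t) - \<Phi> \<zeta> (cl t)) \<le> \<Lambda> * dist \<xi> \<zeta> * \<bar>cl t\<bar>"
        using cl[of t] \<tau> \<Phi>0[OF \<open>\<xi> \<in> S\<close>] \<Phi>0[OF \<open>\<zeta> \<in> S\<close>] by simp
      also have "\<dots> \<le> \<Lambda> * dist \<xi> \<zeta> * \<tau>"
        using cl[of t] \<Lambda> by (intro mult_left_mono) auto
      also have "\<dots> = (\<Lambda> * \<tau>) * dist \<xi> \<zeta>" by simp
      also have "\<dots> \<le> 1/2 * dist \<xi> \<zeta>" using \<Lambda>\<tau> by (intro mult_right_mono) auto
      finally show "dist (\<Phi> \<xi> t) (\<Phi> \<zeta> t) \<le> 1/2 * dist \<xi> \<zeta>"
        unfolding dist_norm \<Phi>cl[OF \<open>\<xi> \<in> S\<close>, of t] \<Phi>cl[OF \<open>\<zeta> \<in> S\<close>, of t] .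
    qed
  qed auto
  then obtain \<xi> where \<xi>: "\<xi> \<in> S" "\<Phi> \<xi> = \<xi>" by blast
  show ?thesis
    by (rule exI[of _ \<tau>], intro conjI \<tau>, rule exI[of _ "apply_bcontfun \<xi>"])
      (use \<Phi>0[OF \<xi>(1)] \<Phi>d[OF \<xi>(1)] \<xi> \<tau> in \<open>auto simp: S_def\<close>)
qed

lemma eventually_abs_less: "F \<le> at (0::real) \<Longrightarrow> d > 0 \<Longrightarrow> \<forall>\<^sub>F s in F. \<bar>s\<bar> < d"
  by (rule filter_leD[of F "at 0"]) (auto simp: eventually_at intro!: exI[of _ d])

lemma limitin_within: "limitin T f l (at t) \<Longrightarrow> limitin T f l (at t within S)"
  unfolding limitin_def using filter_leD[OF at_le[OF subset_UNIV]] by blast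

text \<open>This is the source of all uniformity in \<open>t\<close>: an estimate near
  \<open>s = 0\<close> becomes one for \<open>s = t / n\<close>, simultaneously for
  \<open>\<bar>t\<bar> \<le> T\<close>. The filter \<open>at 0\<close> omits the point
  \<open>0\<close>, which occurs for \<open>t = 0\<close>; hence \<open>P0\<close>.\<close>

lemma eventually_div_small:
  assumes ev: "\<forall>\<^sub>F s in at (0::real). P s" and P0: "P 0"
  shows "\<forall>\<^sub>F n in sequentially. \<forall>t. \<bar>t\<bar> \<le> T \<longrightarrow> P (t / real n)"
proof -
  obtain \<sigma> where \<sigma>: "\<sigma> > 0" "\<And>s. s \<noteq> 0 \<Longrightarrow> \<bar>s\<bar> < \<sigma> \<Longrightarrow> P s"
    using ev unfolding eventually_at by auto
  have "\<forall>\<^sub>F n in sequentially. real n > max 0 (T / \<sigma>)"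
    using filterlim_real_sequentially unfolding filterlim_at_top_dense by blast
  then show ?thesis
  proof eventually_elim
    case (elim n)
    have "P (t / real n)" if t: "\<bar>t\<bar> \<le> T" for t
    proof (cases "t / real n = 0")
      case False
      have "T < real n * \<sigma>" using elim \<sigma> by (simp add: field_simps)
      then have "\<bar>t / real n\<bar> < \<sigma>" using elim t by (simp add: field_simps)
      with False show ?thesis by (rule \<sigma>(2))
    next
      case True
      show ?thesis unfolding True by (rule P0)
    qed
    then show ?case by blast
  qed
qed

section \<open>Local coordinates of a Banach--Lie group\<close>

text \<open>
  \<open>L\<close> is a chart around the identity, shifted so that \<open>L \<one> = 0\<close>.  Two facts about the multiplication
  suffice below: it is addition up to a bilinear error, and \<open>M p\<close>, the derivative at \<open>0\<close> of
  \<open>v \<mapsto> L (x \<otimes> L\<^sup>-\<^sup>1 v)\<close> for \<open>L x = p\<close>, is Lipschitz in \<open>p\<close>.  The radius \<open>r\<close> is so small that quotients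
  and conjugates of elements of the \<open>r\<close>-ball stay in the \<open>R\<close>-ball.
\<close>

locale local_group = group N for N :: "('n, 'c) monoid_scheme" (structure) +
  fixes T :: "'n topology" and U :: "'n set" and L :: "'n \<Rightarrow> 'e::banach"
    and R r C :: real and M :: "'e \<Rightarrow> 'e \<Rightarrow> 'e"
  assumes topsp: "topspace T = carrier N"
    and cmult: "continuous_map (prod_topology T T) T (\<lambda>(x, y). x \<otimes> y)"
    and cinv: "continuous_map T T (\<lambda>x. inv x)"
    and closed_one: "closedin T {\<one>}"
    and openU: "openin T U" and oneU: "\<one> \<in> U"
    and L_one: "L \<one> = 0" and inj_L: "inj_on L U"
    and cont_L: "continuous_map (subtopology T U) euclidean L"
    and nhd: "openin T W \<Longrightarrow> \<one> \<in> W \<Longrightarrow> \<exists>d>0. \<forall>x\<in>U. norm (L x) < d \<longrightarrow> x \<in> W"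
    and radii: "0 < r" "r \<le> R" "0 \<le> C" "C * R \<le> 1/4"
    and surj_L: "norm v < R \<Longrightarrow> v \<in> L ` U"
    and mult_est: "x \<in> U \<Longrightarrow> y \<in> U \<Longrightarrow> norm (L x) < R \<Longrightarrow> norm (L y) < R \<Longrightarrow>
      x \<otimes> y \<in> U \<and> norm (L (x \<otimes> y) - L x - L y) \<le> C * norm (L x) * norm (L y)"
    and div_R: "x \<in> U \<Longrightarrow> y \<in> U \<Longrightarrow> norm (L x) < r \<Longrightarrow> norm (L y) < r \<Longrightarrow>
      inv x \<otimes> y \<in> U \<and> norm (L (inv x \<otimes> y)) < R"
    and conj_R: "x \<in> U \<Longrightarrow> y \<in> U \<Longrightarrow> norm (L x) < r \<Longrightarrow> norm (L y) < r \<Longrightarrow>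
      inv x \<otimes> y \<otimes> x \<in> U \<and> norm (L (inv x \<otimes> y \<otimes> x)) < R"
    and M_linear: "norm p < R \<Longrightarrow> bounded_linear (M p)"
    and M_lipschitz: "norm p < R \<Longrightarrow> norm q < R \<Longrightarrow> norm (M p v - M q v) \<le> C * norm (p - q) * norm v"
    and M_zero: "M 0 v = v"
    and M_deriv: "x \<in> U \<Longrightarrow> norm (L x) < R \<Longrightarrow>
      ((\<lambda>v. L (x \<otimes> inv_into U L v)) has_derivative M (L x)) (at 0)"
begin

definition nb :: "real \<Rightarrow> 'n set" where "nb d = {x \<in> U. norm (L x) < d}"

text \<open>
  \<open>tang F b w\<close>: the curve \<open>b\<close> starts at the identity with velocity \<open>w\<close> along the filter \<open>F\<close>.
  A curve \<open>\<beta>\<close> has logarithmic derivative \<open>w\<close> at \<open>t\<close> iff \<open>tang (at 0) (\<lambda>s. inv (\<beta> t) \<otimes> \<beta> (t + s)) w\<close>.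
\<close>

definition tang :: "real filter \<Rightarrow> (real \<Rightarrow> 'n) \<Rightarrow> 'e \<Rightarrow> bool" where
  "tang F b w \<longleftrightarrow> (\<forall>e>0. \<forall>\<^sub>F s in F. b s \<in> U \<and> norm (L (b s) - s *\<^sub>R w) \<le> e * \<bar>s\<bar>)"

lemma U_carrier: "x \<in> U \<Longrightarrow> x \<in> carrier N"
  using openin_subset[OF openU] topsp by auto

lemma nb_U: "x \<in> nb d \<Longrightarrow> x \<in> U" and nb_norm: "x \<in> nb d \<Longrightarrow> norm (L x) < d"
  and nbI: "x \<in> U \<Longrightarrow> norm (L x) < d \<Longrightarrow> x \<in> nb d"
  by (auto simp: nb_def)

lemma nb_carrier: "x \<in> nb d \<Longrightarrow> x \<in> carrier N"
  by (simp add: nb_U U_carrier)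

lemma nb_mono: "x \<in> nb d \<Longrightarrow> d \<le> d' \<Longrightarrow> x \<in> nb d'"
  by (auto simp: nb_def)

lemma one_nb: "d > 0 \<Longrightarrow> \<one> \<in> nb d"
  by (simp add: nb_def oneU L_one)

lemma nhd_nb: "openin T W \<Longrightarrow> \<one> \<in> W \<Longrightarrow> \<exists>d>0. nb d \<subseteq> W"
  using nhd[of W] by (force simp: nb_def)

lemma openin_L: "open S \<Longrightarrow> openin T {x \<in> U. L x \<in> S}"
proof -
  assume "open S"
  then have "openin (subtopology T U) {x \<in> topspace (subtopology T U). L x \<in> S}"
    using openin_continuous_map_preimage[OF cont_L, of S] open_openin by blast
  moreover have "topspace (subtopology T U) = U"
    using openin_subset[OF openU] by (simp add: topspace_subtopology Int_absorb1)
  ultimately have "openin (subtopology T U) {x \<in> U. L x \<in> S}" by (simp only:)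
  then show ?thesis using openin_trans_full[OF _ openU] by blast
qed

lemma openin_nb: "openin T (nb d)"
  using openin_L[OF open_ball[of 0 d]] by (simp add: nb_def)

lemma E_U: "norm v < R \<Longrightarrow> inv_into U L v \<in> U" and L_E: "norm v < R \<Longrightarrow> L (inv_into U L v) = v"
  and E_L: "x \<in> U \<Longrightarrow> inv_into U L (L x) = x"
  using surj_L[of v] by (simp_all add: inv_into_into f_inv_into_f inj_L)

lemma R_pos: "R > 0" using radii by linarith

lemma C_small: "d \<le> R \<Longrightarrow> C * d \<le> 1/4"
  using radii mult_left_mono[of d R C] by linarith

section \<open>Products, quotients and conjugates in the chart\<close>

text \<open>Because of \<open>C * R \<le> 1/4\<close> the bilinear error is at most a quarter of
  \<open>norm (L y)\<close>, which yields the two linear bounds.\<close>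

lemma nb_mult_est:
  assumes "x \<in> nb R" "y \<in> nb R"
  shows "x \<otimes> y \<in> U" "norm (L (x \<otimes> y) - L x - L y) \<le> C * norm (L x) * norm (L y)"
    "norm (L (x \<otimes> y) - L x) \<le> 2 * norm (L y)" "norm (L (x \<otimes> y)) \<le> norm (L x) + 2 * norm (L y)"
proof -
  show 1: "x \<otimes> y \<in> U" and 2: "norm (L (x \<otimes> y) - L x - L y) \<le> C * norm (L x) * norm (L y)"
    using mult_est[of x y] assms by (auto simp: nb_def)
  have "C * norm (L x) * norm (L y) \<le> 1/4 * norm (L y)"
    using C_small[of "norm (L x)"] nb_norm[OF assms(1)] by (intro mult_right_mono) auto
  with 2 have "norm (L (x \<otimes> y) - L x - L y) \<le> norm (L y)"
    using norm_ge_zero[of "L y"] by linarith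
  then show 3: "norm (L (x \<otimes> y) - L x) \<le> 2 * norm (L y)"
    using norm_triangle_ineq2[of "L (x \<otimes> y) - L x" "L y"] by linarith
  then show "norm (L (x \<otimes> y)) \<le> norm (L x) + 2 * norm (L y)"
    using norm_triangle_ineq2[of "L (x \<otimes> y)" "L x"] by linarith
qed

text \<open>Apply the product estimate to \<open>v \<otimes> q = u\<close> with
  \<open>q = inv v \<otimes> u\<close> and absorb the error \<open>1/4 * norm (L q)\<close> on the
  left. For this, \<open>q\<close> must be known in advance to lie in the \<open>R\<close>-ball,
  which is what \<open>div_R\<close> provides.\<close>

lemma nb_div_est:
  assumes v: "v \<in> nb r" and u: "u \<in> nb r"
  shows "inv v \<otimes> u \<in> nb R" "norm (L (inv v \<otimes> u)) \<le> 2 * norm (L u - L v)"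
proof -
  let ?q = "inv v \<otimes> u"
  show q: "?q \<in> nb R" using div_R[of v u] assms by (auto simp: nb_def)
  have eq: "v \<otimes> ?q = u" using assms nb_carrier by (simp flip: m_assoc)
  have vR: "v \<in> nb R" using v radii by (rule_tac nb_mono)
  have "norm (L u - L v - L ?q) \<le> C * norm (L v) * norm (L ?q)"
    using nb_mult_est(2)[OF vR q] eq by simp
  also have "\<dots> \<le> 1/4 * norm (L ?q)"
    using C_small[of "norm (L v)"] nb_norm[OF vR] by (intro mult_right_mono) auto
  finally show "norm (L ?q) \<le> 2 * norm (L u - L v)"
    using norm_triangle_ineq2[of "L ?q" "L u - L v"] norm_ge_zero[of "L ?q"] norm_minus_commute[of "L ?q" "L u - L v"]
    by linarith
qed

text \<open>With \<open>w\<close> the conjugate, both sides of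
  \<open>v \<otimes> w = x \<otimes> v\<close> are expanded by the product estimate. For
  \<open>c = C * norm (L v) \<le> 1/4\<close> this gives
  \<open>(1 - c) * norm (L w) \<le> (1 + c) * norm (L x)\<close>, and
  \<open>(1 + c) / (1 - c) \<le> 1 + 4 * c\<close>. A factor that tends to \<open>1\<close> with
  \<open>v\<close> is essential: it is iterated \<open>n\<close> times with
  \<open>v = O(1/n)\<close>.\<close>

lemma nb_conj_est:
  assumes v: "v \<in> nb r" and x: "x \<in> nb r"
  shows "inv v \<otimes> x \<otimes> v \<in> nb R" "norm (L (inv v \<otimes> x \<otimes> v)) \<le> (1 + 4 * C * norm (L v)) * norm (L x)"
proof -
  let ?w = "inv v \<otimes> x \<otimes> v"
  show w: "?w \<in> nb R" using conj_R[of v x] assms by (auto simp: nb_def)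
  have eq: "v \<otimes> ?w = x \<otimes> v" using nb_carrier[OF v] nb_carrier[OF x] by (simp flip: m_assoc)
  have vR: "v \<in> nb R" and xR: "x \<in> nb R" using v x radii nb_mono by blast+
  define c where "c = C * norm (L v)"
  have c: "0 \<le> c" "c \<le> 1/4" using C_small[of "norm (L v)"] nb_norm[OF vR] radii by (auto simp: c_def)
  have "norm (L (v \<otimes> ?w) - L v - L ?w) \<le> c * norm (L ?w)"
    unfolding c_def by (rule nb_mult_est(2)[OF vR w])
  moreover have "norm (L (x \<otimes> v) - L x - L v) \<le> c * norm (L x)"
    unfolding c_def using nb_mult_est(2)[OF xR vR] by (simp add: mult_ac)
  ultimately have "norm (L ?w - L x) \<le> c * norm (L ?w) + c * norm (L x)"
    unfolding eq
    using norm_triangle_ineq4[of "L (x \<otimes> v) - L x - L v" "L (x \<otimes> v) - L v - L ?w"]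
    by (simp add: algebra_simps)
  then have 1: "(1 - c) * norm (L ?w) \<le> (1 + c) * norm (L x)"
    using norm_triangle_ineq2[of "L ?w" "L x"] by (simp add: algebra_simps)
  have "c * (c * 2) \<le> c * 1" using c by (intro mult_left_mono) auto
  then have "1 + c \<le> (1 - c) * (1 + 4 * c)" using c by (simp add: algebra_simps)
  then have "(1 + c) * norm (L x) \<le> (1 - c) * ((1 + 4 * c) * norm (L x))"
    using mult_right_mono[OF _ norm_ge_zero] by (metis mult.assoc)
  with 1 have "(1 - c) * norm (L ?w) \<le> (1 - c) * ((1 + 4 * c) * norm (L x))" by linarith
  then show "norm (L ?w) \<le> (1 + 4 * C * norm (L v)) * norm (L x)"
    using c by (simp add: c_def mult_ac)
qed

section \<open>Limits and velocities of curves through the identity\<close>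

lemma limitin_mult:
  assumes "limitin T f x F" "limitin T g y F"
  shows "limitin T (\<lambda>s. f s \<otimes> g s) (x \<otimes> y) F"
proof -
  have "limitin (prod_topology T T) (\<lambda>s. (f s, g s)) (x, y) F"
    using assms by (simp add: limitin_pairwise o_def)
  from continuous_map_limit[OF cmult this] show ?thesis by (simp add: o_def)
qed

lemma limitin_inv: "limitin T f x F \<Longrightarrow> limitin T (\<lambda>s. inv (f s)) (inv x) F"
  using continuous_map_limit[OF cinv, of f x F] by (simp add: o_def)

lemma limitin_L:
  assumes "limitin T f x F" "x \<in> U"
  shows "((\<lambda>s. L (f s)) \<longlongrightarrow> L x) F"
proof (rule topological_tendstoI)
  fix S :: "'e set" assume "open S" "L x \<in> S"
  then show "\<forall>\<^sub>F s in F. L (f s) \<in> S"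
    using limitinD[OF assms(1) openin_L[of S]] assms(2) by (auto elim: eventually_mono)
qed

lemma limitin_one_nb: "limitin T f \<one> F \<Longrightarrow> d > 0 \<Longrightarrow> \<forall>\<^sub>F s in F. f s \<in> nb d"
  by (rule limitinD[OF _ openin_nb one_nb])

lemma limitin_oneI:
  assumes "\<And>d. d > 0 \<Longrightarrow> \<forall>\<^sub>F s in F. f s \<in> nb d"
  shows "limitin T f \<one> F"
  unfolding limitin_def
proof (intro conjI allI impI)
  show "\<one> \<in> topspace T" by (simp add: topsp)
  fix W assume "openin T W \<and> \<one> \<in> W"
  then obtain d where "d > 0" "nb d \<subseteq> W" using nhd_nb by blast
  with assms[of d] show "\<forall>\<^sub>F s in F. f s \<in> W" by (auto elim: eventually_mono)
qed

lemma tang_mono: "tang F b w \<Longrightarrow> F' \<le> F \<Longrightarrow> tang F' b w"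
  unfolding tang_def using filter_leD by blast

lemma tangD: "tang F b w \<Longrightarrow> e > 0 \<Longrightarrow> \<forall>\<^sub>F s in F. b s \<in> U \<and> norm (L (b s) - s *\<^sub>R w) \<le> e * \<bar>s\<bar>"
  unfolding tang_def by blast

lemma tang_cong: "tang F b w \<Longrightarrow> (\<forall>\<^sub>F s in F. b s = b' s) \<Longrightarrow> tang F b' w"
  unfolding tang_def by (auto elim: eventually_elim2)

lemma tang_bound:
  assumes "tang F b w" "F \<le> at 0"
  shows "\<forall>\<^sub>F s in F. b s \<in> U \<and> norm (L (b s)) \<le> (norm w + 1) * \<bar>s\<bar>"
  using tangD[OF assms(1) zero_less_one]
proof eventually_elim
  case (elim s)
  then show ?case
    using norm_triangle_ineq2[of "L (b s)" "s *\<^sub>R w"] by (simp add: algebra_simps)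
qed

lemma tang_nb:
  assumes "tang F b w" "F \<le> at 0" "d > 0"
  shows "\<forall>\<^sub>F s in F. b s \<in> nb d"
proof -
  have "d / (norm w + 1) > 0" using assms(3) by (intro divide_pos_pos) (auto intro: add_nonneg_pos)
  from eventually_abs_less[OF assms(2) this] tang_bound[OF assms(1,2)] show ?thesis
  proof eventually_elim
    case (elim s)
    have "\<bar>s\<bar> * (norm w + 1) < d"
      using elim(1) by (subst (asm) pos_less_divide_eq) (auto intro: add_nonneg_pos)
    then show ?case using elim(2) by (simp add: nb_def mult.commute)
  qed
qed

lemma tang_limitin: "tang F b w \<Longrightarrow> F \<le> at 0 \<Longrightarrow> limitin T b \<one> F"
  by (rule limitin_oneI) (rule tang_nb)

text \<open>The bilinear error of the product is \<open>O(s\<^sup>2)\<close>, hence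
  \<open>o(s)\<close>. This is where the sum of the two velocities in the Trotter formula comes
  from.\<close>

lemma tang_mult:
  assumes b: "tang F b w" and c: "tang F c w'" and F: "F \<le> at 0"
  shows "tang F (\<lambda>s. b s \<otimes> c s) (w + w')"
  unfolding tang_def
proof (intro allI impI)
  fix e :: real assume e: "e > 0"
  define K where "K = C * (norm w + 1) * (norm w' + 1)"
  have K: "K \<ge> 0" using radii by (auto simp: K_def)
  have e4: "e / 4 > 0" and d: "e / (4 * (K + 1)) > 0" using e K by auto
  show "\<forall>\<^sub>F s in F. b s \<otimes> c s \<in> U \<and> norm (L (b s \<otimes> c s) - s *\<^sub>R (w + w')) \<le> e * \<bar>s\<bar>"
    using tangD[OF b e4] tangD[OF c e4] tang_bound[OF b F] tang_bound[OF c F]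
      tang_nb[OF b F R_pos] tang_nb[OF c F R_pos] eventually_abs_less[OF F d]
  proof eventually_elim
    case (elim s)
    note m = nb_mult_est[OF elim(5,6)]
    have "C * norm (L (b s)) * norm (L (c s)) \<le> C * ((norm w + 1) * \<bar>s\<bar>) * ((norm w' + 1) * \<bar>s\<bar>)"
      using elim radii by (intro mult_mono) auto
    also have "\<dots> = K * \<bar>s\<bar> * \<bar>s\<bar>" by (simp add: K_def mult_ac)
    also have "\<dots> \<le> (e / 4) * \<bar>s\<bar>"
    proof (intro mult_right_mono)
      have "K * \<bar>s\<bar> \<le> (K + 1) * (e / (4 * (K + 1)))" using elim(7) K by (intro mult_mono) auto
      also have "\<dots> = e / 4" using K by (simp add: field_simps)
      finally show "K * \<bar>s\<bar> \<le> e / 4" .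
    qed auto
    finally have "norm (L (b s \<otimes> c s) - L (b s) - L (c s)) \<le> e / 4 * \<bar>s\<bar>" using m(2) by linarith
    then have "norm ((L (b s \<otimes> c s) - L (b s) - L (c s)) + (L (b s) - s *\<^sub>R w) + (L (c s) - s *\<^sub>R w'))
        \<le> e / 4 * \<bar>s\<bar> + e / 4 * \<bar>s\<bar> + e / 4 * \<bar>s\<bar>"
      using elim by (intro norm_triangle_le add_mono) auto
    also have "\<dots> \<le> e * \<bar>s\<bar>" using e by (simp add: field_simps)
    finally show ?case using m(1) by (simp add: algebra_simps)
  qed
qed

text \<open>Equal velocities make the coordinates differ by \<open>o(s)\<close>, and the quotient
  estimate carries this over to the quotient. It is the form in which a common velocity enters the
  comparison of products.\<close>

lemma tang_div_small:
  assumes b: "tang F b w" and c: "tang F c w" and F: "F \<le> at 0" and e: "e > 0"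
  shows "\<forall>\<^sub>F s in F. inv (b s) \<otimes> c s \<in> nb r \<and> norm (L (inv (b s) \<otimes> c s)) \<le> e * \<bar>s\<bar>"
proof -
  have e4: "e / 4 > 0" and d: "r / e > 0" using e radii by auto
  show ?thesis
    using tangD[OF b e4] tangD[OF c e4] tang_nb[OF b F radii(1)] tang_nb[OF c F radii(1)]
      eventually_abs_less[OF F d]
  proof eventually_elim
    case (elim s)
    have "norm (L (c s) - L (b s)) \<le> e / 4 * \<bar>s\<bar> + e / 4 * \<bar>s\<bar>"
      using elim norm_triangle_ineq4[of "L (c s) - s *\<^sub>R w" "L (b s) - s *\<^sub>R w"] by simp
    with nb_div_est[OF elim(3,4)] have *: "norm (L (inv (b s) \<otimes> c s)) \<le> e * \<bar>s\<bar>"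
      by (simp add: field_simps)
    moreover have "e * \<bar>s\<bar> < r" using elim(5) e by (simp add: field_simps)
    ultimately show ?case using nb_div_est(1)[OF elim(3,4)] by (simp add: nb_def)
  qed
qed

lemma tang_unique:
  assumes b: "tang F b w" "tang F b w'" and F: "F \<le> at 0" "F \<noteq> bot"
  shows "w = w'"
proof -
  have "norm (w - w') \<le> 0 + e" if e: "e > 0" for e
  proof -
    have e2: "e / 2 > 0" using e by simp
    have nz: "\<forall>\<^sub>F s in F. s \<noteq> 0" by (rule filter_leD[OF F(1)]) (simp add: eventually_at_filter)
    have "\<forall>\<^sub>F s in F. norm (w - w') \<le> e"
      using tangD[OF b(1) e2] tangD[OF b(2) e2] nz
    proof eventually_elim
      case (elim s)
      have "norm (s *\<^sub>R (w - w')) \<le> e / 2 * \<bar>s\<bar> + e / 2 * \<bar>s\<bar>"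
        using elim norm_triangle_ineq4[of "L (b s) - s *\<^sub>R w'" "L (b s) - s *\<^sub>R w"]
        by (simp add: algebra_simps)
      then have "\<bar>s\<bar> * norm (w - w') \<le> \<bar>s\<bar> * e" by (simp add: mult.commute)
      then show ?case using elim(3) by simp
    qed
    then show ?thesis using F(2) eventually_happens' by force
  qed
  then show ?thesis using field_le_epsilon[of "norm (w - w')" 0] by fastforce
qed

lemma tang_reflect:
  assumes "tang F b w" shows "tang (filtermap uminus F) (\<lambda>s. b (- s)) (- w)"
  unfolding tang_def eventually_filtermap
  using assms by (auto simp: tang_def)

section \<open>Curves with prescribed logarithmic derivative, and their discrete analogue\<close>

text \<open>
  With \<open>v = inv (\<beta>' t) \<otimes> \<beta>' (t + s)\<close> and \<open>u = inv (\<beta> t) \<otimes> \<beta> (t + s)\<close>, the quotient \<open>D t = inv (\<beta>' t) \<otimes> \<beta> t\<close>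
  satisfies \<open>D (t + s) = (inv v \<otimes> D t \<otimes> v) \<otimes> (inv v \<otimes> u)\<close>, where the last factor is \<open>o(s)\<close>; so \<open>\<bar>D\<bar>\<close>
  obeys a differential inequality of Gronwall type.
\<close>

lemma log_derivative_unique:
  fixes \<beta> \<beta>' :: "real \<Rightarrow> 'n"
  assumes lim: "\<And>t. t \<in> {0..b} \<Longrightarrow> limitin T \<beta> (\<beta> t) (at t within {0..b})"
    and lim': "\<And>t. t \<in> {0..b} \<Longrightarrow> limitin T \<beta>' (\<beta>' t) (at t within {0..b})"
    and init: "\<beta> 0 = \<beta>' 0"
    and tan: "\<And>t. 0 \<le> t \<Longrightarrow> t < b \<Longrightarrow> tang (at_right 0) (\<lambda>s. inv (\<beta> t) \<otimes> \<beta> (t + s)) (X t)"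
    and tan': "\<And>t. 0 \<le> t \<Longrightarrow> t < b \<Longrightarrow> tang (at_right 0) (\<lambda>s. inv (\<beta>' t) \<otimes> \<beta>' (t + s)) (X t)"
    and X: "\<And>t. 0 \<le> t \<Longrightarrow> t < b \<Longrightarrow> norm (X t) \<le> K"
    and t: "t \<in> {0..b}"
  shows "\<beta> t = \<beta>' t"
proof -
  have car: "\<beta> t \<in> carrier N" "\<beta>' t \<in> carrier N" if "t \<in> {0..b}" for t
    using limitin_topspace[OF lim[OF that]] limitin_topspace[OF lim'[OF that]] by (auto simp: topsp)
  define D where "D t = inv (\<beta>' t) \<otimes> \<beta> t" for t
  have limD: "limitin T D (D t) (at t within {0..b})" if "t \<in> {0..b}" for t
    unfolding D_def by (intro limitin_mult limitin_inv lim lim' that)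
  have D0: "D 0 = \<one>" using t car[of 0] init by (simp add: D_def)
  \<comment> \<open>The chart controls \<open>D\<close> only while it is close to the identity.
    Interval induction removes this restriction: closedness of \<open>{\<one>}\<close> handles
    limits from the left, and the differential inequality is solved on a short interval to the right
    of a point where \<open>D\<close> is the identity.\<close>
  have "D t = \<one>"
  proof (rule real_interval_induct[where P = "\<lambda>t. D t = \<one>", OF D0 _ _ t])
    fix t assume t: "0 < t" "t \<le> b" and one: "\<And>s. 0 \<le> s \<Longrightarrow> s < t \<Longrightarrow> D s = \<one>"
    have "at_left t \<le> at t within {0..b}"
      unfolding le_filter_def
    proof (intro allI impI)
      fix P assume "\<forall>\<^sub>F s in at t within {0..b}. P s"
      then obtain d where d: "d > 0" "\<And>x. x \<in> {0..b} \<Longrightarrow> x \<noteq> t \<Longrightarrow> dist x t < d \<Longrightarrow> P x"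
        unfolding eventually_at by blast
      then show "eventually P (at_left t)"
        unfolding eventually_at_left_field
        using t by (intro exI[of _ "max 0 (t - d)"]) (auto simp: dist_real_def)
    qed
    then have "limitin T D (D t) (at_left t)"
      using limD[of t] t unfolding limitin_def by (auto dest: filter_leD)
    moreover have "\<forall>\<^sub>F s in at_left t. D s \<in> {\<one>}"
      using one t unfolding eventually_at_left_field by (intro exI[of _ 0]) auto
    ultimately have "D t \<in> {\<one>}"
      by (rule limitin_closedin[OF _ closed_one]) simp
    then show "D t = \<one>" by simp
  next
    fix t0 assume t0: "0 \<le> t0" "t0 < b" "D t0 = \<one>"
    have "\<forall>\<^sub>F s in at t0 within {0..b}. D s \<in> nb r"
      by (rule limitin_one_nb) (use limD[of t0] t0 radii in auto)
    then obtain d where d: "d > 0" "\<And>s. s \<in> {0..b} \<Longrightarrow> s \<noteq> t0 \<Longrightarrow> dist s t0 < d \<Longrightarrow> D s \<in> nb r"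
      unfolding eventually_at by blast
    \<comment> \<open>Up to \<open>t2\<close> the quotient stays in the \<open>r\<close>-ball, so
      that its coordinate norm \<open>\<rho>\<close> is defined and the conjugation estimate
      applies.\<close>
    define t2 where "t2 = min b (t0 + d / 2)"
    have t2: "t0 < t2" "t2 \<le> b" using t0 d by (auto simp: t2_def)
    have Dnb: "D s \<in> nb r" if "s \<in> {t0..t2}" for s
      using d(2)[of s] that t0 one_nb[OF radii(1)] d(1) by (cases "s = t0") (auto simp: t2_def dist_real_def)
    have K: "K \<ge> 0" using X[OF t0(1,2)] norm_ge_zero[of "X t0"] by linarith
    define \<rho> where "\<rho> s = norm (L (D s))" for s
    have zero: "\<rho> s \<le> 0" if s: "s \<in> {t0..t2}" for s
    proof (rule dini_gronwall[OF _ _ _ _ s])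
      show "continuous_on {t0..t2} \<rho>"
        unfolding continuous_on_def
      proof
        fix s assume s: "s \<in> {t0..t2}"
        have "limitin T D (D s) (at s within {t0..t2})"
          using limD[of s] s t0 t2 at_le[of "{t0..t2}" "{0..b}" s] unfolding limitin_def
          by (auto dest: filter_leD)
        from limitin_L[OF this nb_U[OF Dnb[OF s]]]
        show "(\<rho> \<longlongrightarrow> \<rho> s) (at s within {t0..t2})" unfolding \<rho>_def by (rule tendsto_norm)
      qed
      show "\<rho> t0 \<le> 0" by (simp add: \<rho>_def t0 L_one)
      \<comment> \<open>The growth rate: conjugation by \<open>v\<close> costs a factor
        \<open>1 + 4 * C * norm (L v)\<close>, where
        \<open>norm (L v) \<le> (K + 1) * s\<close>.\<close>
      show "0 \<le> 4 * C * (K + 1)" using K radii by simp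
      fix t e assume t: "t0 \<le> t" "t < t2" and e: "(e::real) > 0"
      have tb: "0 \<le> t" "t < b" using t t0 t2 by auto
      have F: "at_right 0 \<le> at (0::real)" by (rule at_le) simp
      note tan = tan[OF tb] and tan' = tan'[OF tb]
      have e2: "e / 2 > 0" using e by simp
      have s2: "\<forall>\<^sub>F s in at_right 0. s < t2 - t \<and> s > 0"
        unfolding eventually_at_right_field using t by (intro exI[of _ "t2 - t"]) auto
      have "\<forall>\<^sub>F s in at_right 0. \<rho> (t + s) \<le> \<rho> t + s * (4 * C * (K + 1) * \<rho> t + e)"
        using tang_div_small[OF tan' tan F e2] tang_bound[OF tan' F]
          tang_nb[OF tan' F radii(1)] s2
      proof eventually_elim
        case (elim s)
        let ?v = "inv (\<beta>' t) \<otimes> \<beta>' (t + s)" and ?u = "inv (\<beta> t) \<otimes> \<beta> (t + s)"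
        have ts: "t \<in> {0..b}" "t + s \<in> {0..b}" using tb elim t2 by auto
        note c = car[OF ts(1)] car[OF ts(2)]
        have "D (t + s) = (inv ?v \<otimes> D t \<otimes> ?v) \<otimes> (inv ?v \<otimes> ?u)"
          using c by (simp add: D_def inv_mult_group m_assoc inv_solve_left l_inv flip: m_assoc)
             (simp add: m_assoc inv_solve_left)
        moreover have Dt: "D t \<in> nb r" using Dnb t by auto
        ultimately have "\<rho> (t + s) \<le> (1 + 4 * C * norm (L ?v)) * \<rho> t + 2 * norm (L (inv ?v \<otimes> ?u))"
          using nb_mult_est(4)[OF nb_conj_est(1)[OF elim(3) Dt] nb_mono[OF conjunct1[OF elim(1)] radii(2)]]
            nb_conj_est(2)[OF elim(3) Dt]
          by (simp add: \<rho>_def)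
        also have "\<dots> \<le> (1 + 4 * C * ((K + 1) * s)) * \<rho> t + 2 * (e / 2 * s)"
        proof (intro add_mono mult_right_mono mult_left_mono order_refl)
          have "norm (L ?v) \<le> (norm (X t) + 1) * s" using elim by simp
          also have "\<dots> \<le> (K + 1) * s" using X[OF tb] elim by (intro mult_right_mono) auto
          finally show "norm (L ?v) \<le> (K + 1) * s" .
        qed (use elim radii in \<open>auto simp: \<rho>_def\<close>)
        finally show ?case by (simp add: algebra_simps)
      qed
      then show "\<forall>\<^sub>F s in at_right t. \<rho> s \<le> \<rho> t + (s - t) * (4 * C * (K + 1) * \<rho> t + e)"
        by (subst eventually_at_right_to_0) (simp add: add.commute)
    qed
    have "D s = \<one>" if "s \<in> {t0..t2}" for s
      using zero[OF that] inj_onD[OF inj_L, of "D s" \<one>] nb_U[OF Dnb[OF that]] oneU L_one by (simp add: \<rho>_def)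
    then show "\<forall>\<^sub>F s in at_right t0. D s = \<one>"
      unfolding eventually_at_right_field using t2 by (intro exI[of _ t2]) auto
  qed
  then show ?thesis
    using car[OF t] by (metis D_def inv_closed inv_inv inv_equality)
qed

text \<open>Translates the equation \<open>\<xi>' = M \<xi> x\<close> of the chart into a statement
  on left quotients. Since \<open>M p\<close> is the derivative of the left translation by the point
  with coordinate \<open>p\<close>, the increment of \<open>\<xi>\<close> is \<open>M p\<close>
  applied to the coordinate of the quotient, up to \<open>o(s)\<close>; it remains to cancel
  \<open>M p\<close>.\<close>

lemma curve_div_tang:
  assumes p: "norm p \<le> r / 2" and \<xi>: "\<xi> 0 = p"
    and F: "F \<le> at 0"
    and d: "\<And>e. e > 0 \<Longrightarrow> \<forall>\<^sub>F s in F. norm (\<xi> s - p - s *\<^sub>R M p x) \<le> e * \<bar>s\<bar>"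
  shows "tang F (\<lambda>s. inv (inv_into U L p) \<otimes> inv_into U L (\<xi> s)) x"
  unfolding tang_def
proof (intro allI impI)
  fix e :: real assume e: "e > 0"
  let ?E = "inv_into U L"
  have rR: "norm p < r" "norm p < R" using p radii by auto
  have pr: "?E p \<in> nb r" using E_U L_E rR by (auto simp: nb_def)
  define K where "K = norm (M p x) + 1"
  have K: "K > 0" by (auto simp: K_def intro: add_nonneg_pos)
  define e' where "e' = e / (4 * (K + 1))"
  have e': "e' > 0" using e K by (simp add: e'_def)
  have "((\<lambda>v. L (?E p \<otimes> ?E v)) has_derivative M p) (at 0)"
    using M_deriv[OF E_U, of p] L_E rR by simp
  then obtain d0 where d0: "d0 > 0" and
    D: "\<And>v. norm v < d0 \<Longrightarrow> norm (L (?E p \<otimes> ?E v) - L (?E p \<otimes> ?E 0) - M p v) \<le> e' * norm v"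
    unfolding has_derivative_at_alt using e' by fastforce
  have E0: "?E 0 = \<one>" using E_L[OF oneU] L_one by simp
  \<comment> \<open>\<open>M p\<close> differs from \<open>M 0\<close>, the identity, by at most
    \<open>1/4\<close> in operator norm; so it is bounded below, which is all that the cancellation
    uses.\<close>
  have Mlow: "norm v \<le> 2 * norm (M p v)" for v
  proof -
    have "norm (M p v - M 0 v) \<le> C * norm p * norm v"
      using M_lipschitz[of p 0 v] rR R_pos by simp
    also have "\<dots> \<le> 1/4 * norm v" using C_small[of "norm p"] rR by (intro mult_right_mono) auto
    finally have "norm (M p v - v) \<le> 1/4 * norm v" by (simp add: M_zero)
    then show ?thesis
      using norm_triangle_ineq2[of v "M p v"] norm_minus_commute[of v "M p v"] norm_ge_zero[of v]
      by linarith
  qed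
  have lin: "linear (M p)" using M_linear[OF rR(2)] by (rule bounded_linear.linear)
  have d1: "r / (2 * K) > 0" and d2: "d0 / (2 * K) > 0" using radii K d0 by auto
  show "\<forall>\<^sub>F s in F. inv (?E p) \<otimes> ?E (\<xi> s) \<in> U \<and> norm (L (inv (?E p) \<otimes> ?E (\<xi> s)) - s *\<^sub>R x) \<le> e * \<bar>s\<bar>"
    using d[OF e'] d[OF zero_less_one] eventually_abs_less[OF F d1] eventually_abs_less[OF F d2]
  proof eventually_elim
    case (elim s)
    have inc: "norm (\<xi> s - p) \<le> K * \<bar>s\<bar>"
      using elim(2) norm_triangle_ineq2[of "\<xi> s - p" "s *\<^sub>R M p x"] by (simp add: K_def algebra_simps)
    have "K * \<bar>s\<bar> < r / 2" using elim(3) K by (simp add: field_simps)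
    then have \<xi>r: "norm (\<xi> s) < r" using inc p norm_triangle_ineq2[of "\<xi> s" p] by linarith
    then have \<xi>R: "norm (\<xi> s) < R" using radii by simp
    have Er: "?E (\<xi> s) \<in> nb r" using E_U[OF \<xi>R] L_E[OF \<xi>R] \<xi>r by (auto simp: nb_def)
    let ?q = "inv (?E p) \<otimes> ?E (\<xi> s)"
    note q = nb_div_est[OF pr Er]
    have qn: "norm (L ?q) \<le> 2 * (K * \<bar>s\<bar>)" using q(2) inc L_E[OF \<xi>R] L_E[OF rR(2)] by simp
    have "2 * (K * \<bar>s\<bar>) < d0" using elim(4) K by (simp add: field_simps)
    with qn have "norm (L ?q) < d0" by linarith
    from D[OF this] have "norm (L (?E p \<otimes> ?q) - L (?E p) - M p (L ?q)) \<le> e' * norm (L ?q)"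
      using E_L[OF nb_U[OF q(1)]] E0 nb_carrier[OF pr] by simp
    also have "?E p \<otimes> ?q = ?E (\<xi> s)" using nb_carrier[OF pr] nb_carrier[OF Er] by (simp flip: m_assoc)
    finally have "norm (\<xi> s - p - M p (L ?q)) \<le> e' * norm (L ?q)"
      using L_E[OF \<xi>R] L_E[OF rR(2)] by simp
    also have "\<dots> \<le> e' * (2 * (K * \<bar>s\<bar>))" using qn e' by (intro mult_left_mono) auto
    finally have "norm (M p (L ?q) - s *\<^sub>R M p x) \<le> e' * (2 * (K * \<bar>s\<bar>)) + e' * \<bar>s\<bar>"
      using elim(1) norm_triangle_ineq4[of "\<xi> s - p - s *\<^sub>R M p x" "\<xi> s - p - M p (L ?q)"] by simp
    also have "M p (L ?q) - s *\<^sub>R M p x = M p (L ?q - s *\<^sub>R x)"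
      using lin by (simp add: linear_diff linear_scale)
    finally have "norm (L ?q - s *\<^sub>R x) \<le> 2 * (e' * (2 * (K * \<bar>s\<bar>)) + e' * \<bar>s\<bar>)"
      by (intro order_trans[OF Mlow[of "L ?q - s *\<^sub>R x"]] mult_left_mono) auto
    also have "\<dots> = (e' * (4 * K + 2)) * \<bar>s\<bar>" by (simp add: algebra_simps)
    also have "\<dots> \<le> e * \<bar>s\<bar>"
      using e K by (intro mult_right_mono) (auto simp: e'_def field_simps)
    finally show ?case using nb_U[OF q(1)] by simp
  qed
qed

text \<open>In the chart the problem reads \<open>\<xi>' = M \<xi> (X t)\<close>. Time dependence is
  merely continuous, but \<open>M\<close> is Lipschitz in the point, so Picard iteration applies. It
  runs in the ball of radius \<open>r / 2\<close>, as \<open>curve_div_tang\<close>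
  requires.\<close>

lemma log_derivative_exists:
  assumes X: "continuous_on {-1..1} X"
  shows "\<exists>\<tau>>0. \<exists>\<beta>. \<beta> 0 = \<one> \<and> (\<forall>t. \<beta> t \<in> U) \<and>
    (\<forall>t. \<bar>t\<bar> < \<tau> \<longrightarrow> tang (at 0) (\<lambda>s. inv (\<beta> t) \<otimes> \<beta> (t + s)) (X t))"
proof -
  define \<rho> where "\<rho> = r / 2"
  have \<rho>: "\<rho> > 0" "\<rho> \<le> r / 2" "\<rho> < R" using radii by (auto simp: \<rho>_def)
  define X' where "X' t = X (max (-1) (min 1 t))" for t
  have "compact (X ` {-1..1})" using X by (intro compact_continuous_image) auto
  then obtain K where K: "\<And>t. t \<in> {-1..1} \<Longrightarrow> norm (X t) \<le> K"
    by (meson bounded_iff compact_imp_bounded imageI)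
  have K0: "K \<ge> 0" using K[of 0] norm_ge_zero[of "X 0"] by (simp del: norm_ge_zero)
  have Mb: "norm (M p v) \<le> 2 * norm v" if "norm p \<le> \<rho>" for p v
  proof -
    have "norm (M p v - M 0 v) \<le> C * norm p * norm v"
      using M_lipschitz[of p 0 v] that \<rho> R_pos by simp
    also have "\<dots> \<le> 1/4 * norm v" using C_small[of "norm p"] that \<rho> by (intro mult_right_mono) auto
    finally have "norm (M p v - v) \<le> 1/4 * norm v" by (simp add: M_zero)
    then show ?thesis
      using norm_triangle_ineq2[of "M p v" v] norm_ge_zero[of v] by linarith
  qed
  have "\<exists>\<tau>>0. \<exists>\<xi>. \<tau> \<le> 1 \<and> \<xi> 0 = 0 \<and> (\<forall>t. norm (\<xi> t) \<le> \<rho>) \<and>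
     (\<forall>t\<in>{-\<tau>..\<tau>}. (\<xi> has_vector_derivative M (\<xi> t) (X t)) (at t within {-\<tau>..\<tau>}))"
  proof (rule picard_local[OF \<rho>(1)])
    fix \<xi> :: "real \<Rightarrow> 'e" assume \<xi>: "continuous_on {-1..1} \<xi>" "\<And>t. norm (\<xi> t) \<le> \<rho>"
    show "continuous_on {-1..1} (\<lambda>t. M (\<xi> t) (X t))"
      unfolding continuous_on_def
    proof
      fix t :: real assume t: "t \<in> {-1..1}"
      have \<xi>t: "(\<xi> \<longlongrightarrow> \<xi> t) (at t within {-1..1})" and Xt: "(X \<longlongrightarrow> X t) (at t within {-1..1})"
        using \<xi>(1) X t by (auto simp: continuous_on_def)
      have R: "norm (\<xi> s) < R" for s using \<xi>(2)[of s] \<rho> by linarith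
      have "((\<lambda>s. M (\<xi> s) (X s) - M (\<xi> t) (X t)) \<longlongrightarrow> 0) (at t within {-1..1})"
      proof (rule Lim_null_comparison)
        show "\<forall>\<^sub>F s in at t within {-1..1}. norm (M (\<xi> s) (X s) - M (\<xi> t) (X t)) \<le>
            2 * norm (X s - X t) + C * norm (\<xi> s - \<xi> t) * norm (X t)"
        proof (rule always_eventually, rule allI)
          fix s
          have "M (\<xi> s) (X s) - M (\<xi> t) (X t) = M (\<xi> s) (X s - X t) + (M (\<xi> s) (X t) - M (\<xi> t) (X t))"
            using M_linear[OF R] by (simp add: linear_diff bounded_linear.linear)
          then show "norm (M (\<xi> s) (X s) - M (\<xi> t) (X t)) \<le>
            2 * norm (X s - X t) + C * norm (\<xi> s - \<xi> t) * norm (X t)"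
            using Mb[OF \<xi>(2)] M_lipschitz[OF R R] by (metis norm_triangle_mono)
        qed
        have "((\<lambda>s. 2 * norm (X s - X t) + C * norm (\<xi> s - \<xi> t) * norm (X t)) \<longlongrightarrow>
            2 * norm (X t - X t) + C * norm (\<xi> t - \<xi> t) * norm (X t)) (at t within {-1..1})"
          by (intro tendsto_intros \<xi>t Xt)
        then show "((\<lambda>s. 2 * norm (X s - X t) + C * norm (\<xi> s - \<xi> t) * norm (X t)) \<longlongrightarrow> 0) (at t within {-1..1})"
          by simp
      qed
      then show "((\<lambda>t. M (\<xi> t) (X t)) \<longlongrightarrow> M (\<xi> t) (X t)) (at t within {-1..1})"
        by (rule LIM_zero_cancel)
    qed
  next
    fix t :: real and p :: 'e assume "\<bar>t\<bar> \<le> 1" "norm p \<le> \<rho>"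
    then have "norm (M p (X t)) \<le> 2 * norm (X t)" "norm (X t) \<le> K"
      using Mb[of p "X t"] K[of t] by (auto simp: abs_le_iff)
    then show "norm (M p (X t)) \<le> 2 * K" by linarith
  next
    fix t :: real and p q :: 'e assume *: "\<bar>t\<bar> \<le> 1" "norm p \<le> \<rho>" "norm q \<le> \<rho>"
    have "norm (M p (X t) - M q (X t)) \<le> C * norm (p - q) * norm (X t)"
      using * \<rho> by (intro M_lipschitz) auto
    also have "\<dots> \<le> C * norm (p - q) * K" using K[of t] * radii by (intro mult_left_mono) (auto simp: abs_le_iff)
    finally show "norm (M p (X t) - M q (X t)) \<le> C * K * norm (p - q)" by (simp add: mult_ac)
  qed (use K0 radii in auto)
  then obtain \<tau> \<xi> where \<tau>: "\<tau> > 0" and \<xi>0: "\<xi> 0 = 0" and \<xi>: "\<And>t. norm (\<xi> t) \<le> \<rho>"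
    and d: "\<And>t. t \<in> {-\<tau>..\<tau>} \<Longrightarrow> (\<xi> has_vector_derivative M (\<xi> t) (X t)) (at t within {-\<tau>..\<tau>})"
    by blast
  have \<xi>R: "norm (\<xi> t) < R" for t using \<xi>[of t] \<rho> by linarith
  show ?thesis
  proof (intro exI[of _ \<tau>] exI[of _ "\<lambda>t. inv_into U L (\<xi> t)"] conjI allI impI \<tau>)
    show "inv_into U L (\<xi> 0) = \<one>" using E_L[OF oneU] L_one \<xi>0 by simp
    show "inv_into U L (\<xi> t) \<in> U" for t by (rule E_U[OF \<xi>R])
    fix t assume t: "\<bar>t\<bar> < \<tau>"
    show "tang (at 0) (\<lambda>s. inv (inv_into U L (\<xi> t)) \<otimes> inv_into U L (\<xi> (t + s))) (X t)"
    proof (rule curve_div_tang)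
      show "norm (\<xi> t) \<le> r / 2" using \<xi>[of t] \<rho> by linarith
      fix e :: real assume e: "e > 0"
      have "at t within {-\<tau>..\<tau>} = at t" using t by (intro at_within_interior) auto
      then have "(\<xi> has_derivative (\<lambda>h. h *\<^sub>R M (\<xi> t) (X t))) (at t)"
        using d[of t] t by (auto simp: has_vector_derivative_def abs_less_iff)
      then obtain \<delta> where \<delta>: "\<delta> > 0"
        "\<And>y. norm (y - t) < \<delta> \<Longrightarrow> norm (\<xi> y - \<xi> t - (y - t) *\<^sub>R M (\<xi> t) (X t)) \<le> e * norm (y - t)"
        unfolding has_derivative_at_alt using e by blast
      show "\<forall>\<^sub>F s in at 0. norm (\<xi> (t + s) - \<xi> t - s *\<^sub>R M (\<xi> t) (X t)) \<le> e * \<bar>s\<bar>"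
        using eventually_abs_less[OF order_refl \<delta>(1)]
        by eventually_elim (use \<delta>(2)[of "t + s" for s] in force)
    qed simp_all
  qed
qed

text \<open>
  The discrete counterpart, again by
  \<open>inv (Q (k + 1)) \<otimes> P (k + 1) = (inv (v k) \<otimes> (inv (Q k) \<otimes> P k) \<otimes> v k) \<otimes> (inv (v k) \<otimes> u k)\<close>.
\<close>

lemma product_comparison:
  assumes P: "P 0 = \<one>" "\<And>k. k < n \<Longrightarrow> P (Suc k) = P k \<otimes> u k"
    and Q: "Q 0 = \<one>" "\<And>k. k < n \<Longrightarrow> Q (Suc k) = Q k \<otimes> v k"
    and u: "\<And>k. k < n \<Longrightarrow> u k \<in> carrier N"
    and v: "\<And>k. k < n \<Longrightarrow> v k \<in> nb r" "\<And>k. k < n \<Longrightarrow> norm (L (v k)) \<le> \<kappa> / real n"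
    and e: "\<And>k. k < n \<Longrightarrow> inv (v k) \<otimes> u k \<in> nb r"
      "\<And>k. k < n \<Longrightarrow> norm (L (inv (v k) \<otimes> u k)) \<le> e / real n"
    and small: "2 * e * exp (4 * C * \<kappa>) < d" "d \<le> r" and pos: "\<kappa> \<ge> 0" "e \<ge> 0"
    and k: "k \<le> n"
  shows "inv (Q k) \<otimes> P k \<in> nb d"
proof -
  \<comment> \<open>\<open>q\<close> bounds the cost of conjugating by one factor
    \<open>v k\<close>, whose norm is at most \<open>\<kappa> / n\<close>.\<close>
  define q where "q = 1 + 4 * C * \<kappa> / real n"
  have q: "q \<ge> 1" using radii pos by (auto simp: q_def)
  \<comment> \<open>The bound carried through the induction on \<open>k\<close>: each of the
    \<open>k\<close> new errors is at most \<open>2 * e / n\<close> and is amplified by no more than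
    \<open>q ^ k \<le> q ^ n \<le> exp (4 * C * \<kappa>)\<close>. That it never exceeds
    \<open>d \<le> r\<close> keeps the quotients inside the range of the estimates, so the induction
    does not break down before \<open>n\<close>.\<close>
  have fin: "2 * e / real n * real k * q ^ k \<le> 2 * e * exp (4 * C * \<kappa>)" if "k \<le> n" for k
  proof (cases "n = 0")
    case False
    have "q ^ k \<le> q ^ n" using that q by (intro power_increasing) auto
    also have "\<dots> \<le> exp (4 * C * \<kappa>)"
      unfolding q_def using False radii pos
      by (intro exp_ge_one_plus_x_over_n_power_n) (auto intro: order_trans[of _ 0])
    finally have 1: "q ^ k \<le> exp (4 * C * \<kappa>)" .
    have "2 * e / real n * real k \<le> 2 * e / real n * real n"
      using that pos by (intro mult_left_mono) auto
    then have "2 * e / real n * real k \<le> 2 * e" using False by simp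
    from mult_mono[OF this 1] show ?thesis using pos q by auto
  qed (use pos that in auto)
  have "k \<le> n \<Longrightarrow> P k \<in> carrier N \<and> Q k \<in> carrier N \<and> inv (Q k) \<otimes> P k \<in> U \<and>
      norm (L (inv (Q k) \<otimes> P k)) \<le> 2 * e / real n * real k * q ^ k" for k
  proof (induction k)
    case 0
    then show ?case by (simp add: P Q oneU L_one)
  next
    case (Suc k)
    then have k: "k < n" by simp
    define D where "D = inv (Q k) \<otimes> P k"
    have IH: "P k \<in> carrier N" "Q k \<in> carrier N" "D \<in> U" "norm (L D) \<le> 2 * e / real n * real k * q ^ k"
      using Suc by (auto simp: D_def)
    have D: "D \<in> nb r" using IH fin[of k] k small by (intro nbI) auto
    have vc: "v k \<in> carrier N" using v(1)[OF k] nb_carrier by blast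
    have "inv (Q (Suc k)) \<otimes> P (Suc k) = (inv (v k) \<otimes> D \<otimes> v k) \<otimes> (inv (v k) \<otimes> u k)"
      using IH vc u[OF k] by (simp add: P(2)[OF k] Q(2)[OF k] D_def inv_mult_group m_assoc)
        (simp add: inv_solve_left flip: m_assoc)
    moreover note c = nb_conj_est[OF v(1)[OF k] D]
    moreover note m = nb_mult_est[OF c(1) nb_mono[OF e(1)[OF k] radii(2)]]
    ultimately have DU: "inv (Q (Suc k)) \<otimes> P (Suc k) \<in> U"
      and "norm (L (inv (Q (Suc k)) \<otimes> P (Suc k))) \<le> (1 + 4 * C * norm (L (v k))) * norm (L D) + 2 * (e / real n)"
      using e(2)[OF k] by auto
    note this(2)
    also have "\<dots> \<le> q * (2 * e / real n * real k * q ^ k) + 2 * (e / real n) * q ^ Suc k"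
    proof (rule add_mono[OF mult_mono])
      show "1 + 4 * C * norm (L (v k)) \<le> q"
        using mult_left_mono[OF v(2)[OF k], of "4 * C"] radii by (simp add: q_def)
      have "2 * (e / real n) * 1 \<le> 2 * (e / real n) * q ^ Suc k"
        using pos by (intro mult_left_mono one_le_power[OF q]) auto
      then show "2 * (e / real n) \<le> 2 * (e / real n) * q ^ Suc k" by simp
    qed (use IH q in auto)
    also have "\<dots> = 2 * e / real n * real (Suc k) * q ^ Suc k" by (simp add: algebra_simps add_divide_distrib)
    finally show ?case using DU IH vc u[OF k] P(2)[OF k] Q(2)[OF k] by simp
  qed
  with fin[OF k] small k show ?thesis by (force intro: nbI)
qed

section \<open>Growth of powers of small elements\<close>

text \<open>As long as the powers stay in the \<open>R\<close>-ball, every further factor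
  contributes \<open>L y\<close> up to a quarter of its norm. So \<open>norm (L y)\<close> is at
  most of order \<open>1 / m\<close> if the first \<open>m\<close> powers stay small; this is the
  quantitative absence of small subgroups.\<close>

lemma power_est_small:
  assumes y: "y \<in> carrier N" and small: "\<And>k. k \<le> m \<Longrightarrow> y [^] k \<in> nb R"
  shows "norm (L (y [^] m) - real m *\<^sub>R L y) \<le> real m * (1/4 * norm (L y))"
  using small
proof (induction m)
  case 0
  then show ?case by (simp add: L_one)
next
  case (Suc m)
  have y1: "y \<in> nb R" using Suc.prems[of 1] y by simp
  have "norm (L (y [^] m \<otimes> y) - L (y [^] m) - L y) \<le> C * norm (L (y [^] m)) * norm (L y)"
    by (rule nb_mult_est(2)) (use Suc.prems[of m] y1 in auto)
  also have "\<dots> \<le> 1/4 * norm (L y)"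
    using C_small[of "norm (L (y [^] m))"] nb_norm[OF Suc.prems[of m]] by (intro mult_right_mono) auto
  finally have "norm ((L (y [^] m \<otimes> y) - L (y [^] m) - L y) + (L (y [^] m) - real m *\<^sub>R L y))
      \<le> 1/4 * norm (L y) + real m * (1/4 * norm (L y))"
    using Suc by (intro norm_triangle_mono) auto
  then show ?case by (simp add: algebra_simps)
qed

text \<open>The converse control: each factor adds at most \<open>2 * norm (L x)\<close>, so about
  \<open>R / (2 * norm (L x))\<close> powers remain in the ball. Membership in the ball and the norm
  bound must be proved together, since each step of one uses the other.\<close>

lemma power_est_growth:
  assumes x: "x \<in> U" and m: "2 * real m * norm (L x) < R"
  shows "k \<le> m \<Longrightarrow> x [^] k \<in> nb R \<and> norm (L (x [^] k)) \<le> 2 * real k * norm (L x)"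
proof (induction k)
  case 0
  then show ?case using one_nb[OF R_pos] by (simp add: L_one)
next
  case (Suc k)
  then have k: "k \<le> m" "m \<ge> 1" by auto
  have "1 * norm (L x) \<le> 2 * real m * norm (L x)" using k by (intro mult_right_mono) auto
  then have xR: "x \<in> nb R" using x m by (auto simp: nb_def)
  have IH: "x [^] k \<in> nb R" "norm (L (x [^] k)) \<le> 2 * real k * norm (L x)" using Suc k by auto
  note e = nb_mult_est[OF IH(1) xR]
  have n: "norm (L (x [^] Suc k)) \<le> 2 * real (Suc k) * norm (L x)"
    using e(4) IH(2) by (simp add: algebra_simps)
  also have "\<dots> \<le> 2 * real m * norm (L x)" using Suc.prems by (intro mult_right_mono) auto
  finally have "norm (L (x [^] Suc k)) < R" using m by linarith
  with n e(1) show ?case by (auto simp: nb_def)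
qed

lemma tang_line: "tang (at 0) (\<lambda>s. inv_into U L (s *\<^sub>R w)) w"
  unfolding tang_def
proof (intro allI impI)
  fix e :: real assume e: "e > 0"
  have "R / (norm w + 1) > 0" using R_pos by (intro divide_pos_pos) (auto intro: add_nonneg_pos)
  from eventually_abs_less[OF order_refl this]
  show "\<forall>\<^sub>F s in at 0. inv_into U L (s *\<^sub>R w) \<in> U \<and>
      norm (L (inv_into U L (s *\<^sub>R w)) - s *\<^sub>R w) \<le> e * \<bar>s\<bar>"
  proof eventually_elim
    case (elim s)
    have "\<bar>s\<bar> * (norm w + 1) < R"
      using elim by (subst (asm) pos_less_divide_eq) (auto intro: add_nonneg_pos)
    then have "norm (s *\<^sub>R w) < R" by (simp add: algebra_simps)
    then show ?case using E_U L_E e by simp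
  qed
qed

lemma tang_limitin_shift:
  assumes tan: "tang (at 0) (\<lambda>s. inv (\<beta> t) \<otimes> \<beta> (t + s)) w" and car: "\<And>t. \<beta> t \<in> carrier N"
  shows "limitin T \<beta> (\<beta> t) (at t)"
proof -
  have "limitin T (\<lambda>s. \<beta> t \<otimes> (inv (\<beta> t) \<otimes> \<beta> (t + s))) (\<beta> t \<otimes> \<one>) (at 0)"
    by (intro limitin_mult tang_limitin[OF tan]) (simp_all add: topsp car)
  moreover have "\<beta> t \<otimes> (inv (\<beta> t) \<otimes> \<beta> (t + s)) = \<beta> (s + t)" for s
    using car by (simp add: add.commute flip: m_assoc)
  ultimately have "limitin T (\<lambda>s. \<beta> (s + t)) (\<beta> t) (at 0)" using car by simp
  then show ?thesis unfolding at_to_0[of t] limitin_def eventually_filtermap .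
qed

text \<open>Negative times are reduced to positive ones by reversing the curves, which turns the
  logarithmic derivative into \<open>- X (- s)\<close>.\<close>

lemma log_derivative_unique_sym:
  fixes \<beta> \<beta>' :: "real \<Rightarrow> 'n"
  assumes car: "\<And>t. \<beta> t \<in> carrier N" "\<And>t. \<beta>' t \<in> carrier N"
    and init: "\<beta> 0 = \<beta>' 0"
    and tan: "\<And>t. \<bar>t\<bar> < \<tau> \<Longrightarrow> tang (at 0) (\<lambda>s. inv (\<beta> t) \<otimes> \<beta> (t + s)) (X t)"
    and tan': "\<And>t. \<bar>t\<bar> < \<tau> \<Longrightarrow> tang (at 0) (\<lambda>s. inv (\<beta>' t) \<otimes> \<beta>' (t + s)) (X t)"
    and X: "\<And>t. \<bar>t\<bar> < \<tau> \<Longrightarrow> norm (X t) \<le> K"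
    and t: "\<bar>t\<bar> < \<tau>"
  shows "\<beta> t = \<beta>' t"
proof -
  have F: "at_right 0 \<le> at (0::real)" by (rule at_le) simp
  show ?thesis
  proof (cases "t \<ge> 0")
    case True
    show ?thesis
    proof (rule log_derivative_unique[where b = t and X = X and K = K])
      fix s assume s: "s \<in> {0..t}"
      then have "\<bar>s\<bar> < \<tau>" using t by auto
      then show "limitin T \<beta> (\<beta> s) (at s within {0..t})" "limitin T \<beta>' (\<beta>' s) (at s within {0..t})"
        by (rule limitin_within[OF tang_limitin_shift[OF tan car(1)]],
            rule limitin_within[OF tang_limitin_shift[OF tan' car(2)]])
    next
      fix s assume s: "0 \<le> s" "s < t"
      then have "\<bar>s\<bar> < \<tau>" using t by auto
      then show "tang (at_right 0) (\<lambda>h. inv (\<beta> s) \<otimes> \<beta> (s + h)) (X s)"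
        "tang (at_right 0) (\<lambda>h. inv (\<beta>' s) \<otimes> \<beta>' (s + h)) (X s)" "norm (X s) \<le> K"
        by (rule tang_mono[OF tan F], rule tang_mono[OF tan' F], rule X)
    qed (use True init in auto)
  next
    case False
    have refl: "tang (at 0) (\<lambda>h. inv (b (- s)) \<otimes> b (- (s + h))) (- X (- s))"
      if "tang (at 0) (\<lambda>h. inv (b (- s)) \<otimes> b (- s + h)) (X (- s))" for b s
      using tang_reflect[OF that] by (simp add: filtermap_at_minus)
    define \<gamma> \<gamma>' where "\<gamma> = (\<lambda>s. \<beta> (- s))" and "\<gamma>' = (\<lambda>s. \<beta>' (- s))"
    have g: "tang (at 0) (\<lambda>h. inv (\<gamma> s) \<otimes> \<gamma> (s + h)) (- X (- s))"
      "tang (at 0) (\<lambda>h. inv (\<gamma>' s) \<otimes> \<gamma>' (s + h)) (- X (- s))" if "\<bar>s\<bar> < \<tau>" for s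
      unfolding \<gamma>_def \<gamma>'_def using that by (intro refl tan tan'; simp)+
    have gc: "\<gamma> s \<in> carrier N" "\<gamma>' s \<in> carrier N" for s using car by (auto simp: \<gamma>_def \<gamma>'_def)
    have "\<gamma> (- t) = \<gamma>' (- t)"
    proof (rule log_derivative_unique[where b = "- t" and X = "\<lambda>s. - X (- s)" and K = K])
      fix s assume s: "s \<in> {0..- t}"
      then have "\<bar>s\<bar> < \<tau>" using t by auto
      then show "limitin T \<gamma> (\<gamma> s) (at s within {0..- t})" "limitin T \<gamma>' (\<gamma>' s) (at s within {0..- t})"
        by (rule limitin_within[OF tang_limitin_shift[OF g(1) gc(1)]],
            rule limitin_within[OF tang_limitin_shift[OF g(2) gc(2)]])
    next
      fix s assume s: "0 \<le> s" "s < - t"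
      then have s': "\<bar>s\<bar> < \<tau>" using t by auto
      then show "tang (at_right 0) (\<lambda>h. inv (\<gamma> s) \<otimes> \<gamma> (s + h)) (- X (- s))"
        "tang (at_right 0) (\<lambda>h. inv (\<gamma>' s) \<otimes> \<gamma>' (s + h)) (- X (- s))"
        by (rule tang_mono[OF g(1) F], rule tang_mono[OF g(2) F])
      show "norm (- X (- s)) \<le> K" using X[of "- s"] s' by simp
    qed (use False init in \<open>auto simp: \<gamma>_def \<gamma>'_def\<close>)
    then show ?thesis by (simp add: \<gamma>_def \<gamma>'_def)
  qed
qed

text \<open>The link to ordinary derivatives. Since \<open>L (b 0) = 0\<close>, the difference
  quotient at \<open>0\<close> is that of \<open>L (b s)\<close> itself; membership in the chart
  domain has to be stated separately.\<close>

lemma tang_iff_derivative: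
  assumes b0: "b 0 = \<one>"
  shows "tang (at 0 within S) b w \<longleftrightarrow>
    (\<forall>\<^sub>F s in at 0 within S. b s \<in> U) \<and> ((\<lambda>s. L (b s)) has_vector_derivative w) (at 0 within S)"
proof -
  have "((\<lambda>s. L (b s)) has_vector_derivative w) (at 0 within S) \<longleftrightarrow>
      (\<forall>e>0. \<forall>\<^sub>F s in at 0 within S. norm (L (b s) - s *\<^sub>R w) \<le> e * \<bar>s\<bar>)"
    unfolding has_vector_derivative_def has_derivative_within_alt2
    by (simp add: b0 L_one bounded_linear_scaleR_left)
  then show ?thesis
    unfolding tang_def eventually_conj_iff using zero_less_one by blast
qed

end

text \<open>The extension is \<open>f (t / m) [^] m\<close> for \<open>m\<close> large enough that
  \<open>t / m\<close> lies in the domain. Two admissible exponents are compared through their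
  common refinement, and the extension is a homomorphism because the values of \<open>f\<close> at
  small arguments commute.\<close>

lemma (in group) local_hom_extends:
  fixes f :: "real \<Rightarrow> 'a"
  assumes \<tau>: "\<tau> > 0" and car: "\<And>s. \<bar>s\<bar> \<le> \<tau> \<Longrightarrow> f s \<in> carrier G"
    and hom: "\<And>s t. \<bar>s\<bar> \<le> \<tau> \<Longrightarrow> \<bar>t\<bar> \<le> \<tau> \<Longrightarrow> \<bar>s + t\<bar> \<le> \<tau> \<Longrightarrow> f (s + t) = f s \<otimes> f t"
  shows "\<exists>F. (\<forall>t. F t \<in> carrier G) \<and> (\<forall>s t. F (s + t) = F s \<otimes> F t) \<and> (\<forall>t. \<bar>t\<bar> \<le> \<tau> \<longrightarrow> F t = f t)"
proof -
  have f0: "f 0 = \<one>"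
    using hom[of 0 0] car[of 0] \<tau> by (simp add: r_cancel_one')
  have pow: "f (real i * u) = f u [^] i" if "\<bar>real i * u\<bar> \<le> \<tau>" for i u
    using that
  proof (induction i)
    case 0
    then show ?case by (simp add: f0)
  next
    case (Suc i)
    have "\<bar>real i * u\<bar> \<le> \<bar>real (Suc i) * u\<bar>" "\<bar>u\<bar> \<le> \<bar>real (Suc i) * u\<bar>"
      by (simp_all add: abs_mult mult_right_mono) (simp add: algebra_simps)
    with Suc have 1: "\<bar>real i * u\<bar> \<le> \<tau>" "\<bar>u\<bar> \<le> \<tau>" "\<bar>real i * u + u\<bar> \<le> \<tau>" by (auto simp: algebra_simps)
    have "f (real (Suc i) * u) = f (real i * u + u)" by (simp add: algebra_simps)
    also have "\<dots> = f u [^] Suc i" using hom[OF 1] Suc.IH 1 by simp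
    finally show ?case .
  qed
  define m where "m t = Suc (nat \<lceil>\<bar>t\<bar> / \<tau>\<rceil>)" for t
  have mp: "m t > 0" for t by (simp add: m_def)
  have m: "\<bar>t\<bar> \<le> real (m t) * \<tau>" for t
  proof -
    have "\<bar>t\<bar> / \<tau> \<le> real (m t)" unfolding m_def by linarith
    then show ?thesis using \<tau> by (simp add: field_simps)
  qed
  define F where "F t = f (t / real (m t)) [^] m t" for t
  \<comment> \<open>Freedom in the exponent: later \<open>F s\<close>, \<open>F t\<close> and
    \<open>F (s + t)\<close> are all written with the same \<open>k\<close>.\<close>
  have F: "F t = f (t / real k) [^] k" if k: "k > 0" "\<bar>t\<bar> \<le> real k * \<tau>" for t k
  proof -
    have sm: "\<bar>t / real k\<bar> \<le> \<tau>" "\<bar>t / real (m t)\<bar> \<le> \<tau>"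
      using k m[of t] by (auto simp: field_simps m_def)
    let ?u = "t / (real k * real (m t))"
    have "\<bar>?u\<bar> = \<bar>t / real k\<bar> / real (m t)" by simp
    also have "\<dots> \<le> \<bar>t / real k\<bar> / 1" by (rule divide_left_mono) (auto simp: m_def)
    finally have "\<bar>?u\<bar> \<le> \<bar>t / real k\<bar>" by simp
    with sm have u: "f ?u \<in> carrier G" by (intro car) linarith
    have "f (t / real k) = f ?u [^] m t"
      using pow[of "m t" ?u] sm k mp[of t] by simp
    moreover have "f (t / real (m t)) = f ?u [^] k"
      using pow[of k ?u] sm k mp[of t] by simp
    ultimately show ?thesis unfolding F_def using u by (simp add: nat_pow_pow mult.commute)
  qed
  show ?thesis
  proof (intro exI[of _ F] conjI allI impI)
    fix t
    have "\<bar>t / real (m t)\<bar> \<le> \<tau>" using m[of t] by (auto simp: field_simps m_def)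
    then show "F t \<in> carrier G" unfolding F_def by (intro nat_pow_closed car)
    show "F t = f t" if "\<bar>t\<bar> \<le> \<tau>" using F[of 1 t] that car[OF that] by simp
  next
    fix s t
    define k where "k = m s + m t"
    have k: "k > 0" "\<bar>s\<bar> \<le> real k * \<tau>" "\<bar>t\<bar> \<le> real k * \<tau>" "\<bar>s + t\<bar> \<le> real k * \<tau>"
      using m[of s] m[of t] \<tau> mult_nonneg_nonneg[of "real (m s)" \<tau>] mult_nonneg_nonneg[of "real (m t)" \<tau>] mp[of s]
      by (auto simp: k_def distrib_right)
    have sm: "\<bar>s / real k\<bar> \<le> \<tau>" "\<bar>t / real k\<bar> \<le> \<tau>" "\<bar>s / real k + t / real k\<bar> \<le> \<tau>"
      "\<bar>t / real k + s / real k\<bar> \<le> \<tau>"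
      using k by (auto simp: field_simps simp flip: add_divide_distrib)
    \<comment> \<open>Both sides equal the value of \<open>f\<close> at the sum of the arguments;
      commuting is what distributes the \<open>k\<close>-th power over the product.\<close>
    have "f (s / real k) \<otimes> f (t / real k) = f (t / real k) \<otimes> f (s / real k)"
      using hom[OF sm(1,2,3)] hom[OF sm(2,1,4)] by (simp add: add.commute)
    then have "(f (s / real k) \<otimes> f (t / real k)) [^] k = f (s / real k) [^] k \<otimes> f (t / real k) [^] k"
      by (intro pow_mult_distrib car sm)
    then show "F (s + t) = F s \<otimes> F t"
      using F[OF k(1,2)] F[OF k(1,3)] F[OF k(1,4)] hom[OF sm(1,2,3)] by (simp add: add_divide_distrib)
  qed
qed

section \<open>Continuous actions by automorphisms\<close>

text \<open>\<open>A g\<close> is the derivative of \<open>\<pi> g\<close> at the identity, in the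
  chart. Nothing is assumed about its dependence on \<open>g\<close>: local boundedness and strong
  continuity are derived from joint continuity of the action.\<close>

locale local_action =
  N: local_group N TN ON LN RN rN CN DN + G: local_group G TG OG LG RG rG CG DG
  for N :: "('n, 'c) monoid_scheme" and TN :: "'n topology" and ON :: "'n set"
    and LN :: "'n \<Rightarrow> 'e::banach" and RN rN CN :: real and DN :: "'e \<Rightarrow> 'e \<Rightarrow> 'e"
    and G :: "('g, 'd) monoid_scheme" and TG :: "'g topology" and OG :: "'g set"
    and LG :: "'g \<Rightarrow> 'f::banach" and RG rG CG :: real and DG :: "'f \<Rightarrow> 'f \<Rightarrow> 'f" +
  fixes \<pi> :: "'g \<Rightarrow> 'n \<Rightarrow> 'n" and A :: "'g \<Rightarrow> 'e \<Rightarrow> 'e"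
  assumes pi_hom: "g \<in> carrier G \<Longrightarrow> \<pi> g \<in> hom N N"
    and pi_mult: "g \<in> carrier G \<Longrightarrow> h \<in> carrier G \<Longrightarrow> x \<in> carrier N \<Longrightarrow> \<pi> (g \<otimes>\<^bsub>G\<^esub> h) x = \<pi> g (\<pi> h x)"
    and pi_one: "x \<in> carrier N \<Longrightarrow> \<pi> \<one>\<^bsub>G\<^esub> x = x"
    and pi_cont: "continuous_map (prod_topology TG TN) TN (\<lambda>(g, x). \<pi> g x)"
    and A_deriv: "g \<in> carrier G \<Longrightarrow> ((\<lambda>v. LN (\<pi> g (inv_into ON LN v))) has_derivative A g) (at 0)"
begin

lemma pi_closed: "g \<in> carrier G \<Longrightarrow> x \<in> carrier N \<Longrightarrow> \<pi> g x \<in> carrier N"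
  using pi_hom by (auto simp: hom_def)

lemma pi_group_hom: "g \<in> carrier G \<Longrightarrow> group_hom N N (\<pi> g)"
  by (intro group_hom.intro group_hom_axioms.intro N.is_group pi_hom)

lemma pi_mult_N: "g \<in> carrier G \<Longrightarrow> x \<in> carrier N \<Longrightarrow> y \<in> carrier N \<Longrightarrow>
    \<pi> g (x \<otimes>\<^bsub>N\<^esub> y) = \<pi> g x \<otimes>\<^bsub>N\<^esub> \<pi> g y"
  using pi_hom by (auto simp: hom_def)

lemma pi_one_N: "g \<in> carrier G \<Longrightarrow> \<pi> g \<one>\<^bsub>N\<^esub> = \<one>\<^bsub>N\<^esub>"
  by (rule group_hom.hom_one[OF pi_group_hom])

lemma pi_inv_N: "g \<in> carrier G \<Longrightarrow> x \<in> carrier N \<Longrightarrow> \<pi> g (inv\<^bsub>N\<^esub> x) = inv\<^bsub>N\<^esub> (\<pi> g x)"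
  by (rule group_hom.hom_inv[OF pi_group_hom])

lemma pi_pow_N: "g \<in> carrier G \<Longrightarrow> x \<in> carrier N \<Longrightarrow> \<pi> g (x [^]\<^bsub>N\<^esub> (k::nat)) = \<pi> g x [^]\<^bsub>N\<^esub> k"
  by (rule group_hom.hom_nat_pow[OF pi_group_hom])

lemma pi_nhd:
  assumes "openin TN W" "g \<in> carrier G" "x \<in> carrier N" "\<pi> g x \<in> W"
  shows "\<exists>V V'. openin TG V \<and> g \<in> V \<and> openin TN V' \<and> x \<in> V' \<and> (\<forall>h\<in>V. \<forall>y\<in>V'. \<pi> h y \<in> W)"
proof -
  define S where "S = {p \<in> topspace (prod_topology TG TN). (\<lambda>(g, x). \<pi> g x) p \<in> W}"
  have op: "openin (prod_topology TG TN) S"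
    unfolding S_def by (rule openin_continuous_map_preimage[OF pi_cont assms(1)])
  have "(g, x) \<in> S" using assms by (simp add: S_def N.topsp G.topsp)
  from op[unfolded openin_prod_topology_alt, rule_format, OF this]
  obtain V V' where V: "openin TG V" "openin TN V'" "g \<in> V" "x \<in> V'" and sub: "V \<times> V' \<subseteq> S"
    by blast
  have "\<pi> h y \<in> W" if "h \<in> V" "y \<in> V'" for h y
    using subsetD[OF sub, of "(h, y)"] that by (simp add: S_def)
  with V show ?thesis by blast
qed

lemma limitin_pi:
  assumes "limitin TG g h F" "limitin TN f x F"
  shows "limitin TN (\<lambda>s. \<pi> (g s) (f s)) (\<pi> h x) F"
proof -
  have "limitin (prod_topology TG TN) (\<lambda>s. (g s, f s)) (h, x) F"
    using assms by (simp add: limitin_pairwise o_def)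
  from continuous_map_limit[OF pi_cont this] show ?thesis by (simp add: o_def)
qed

lemma openin_carrier_G: "openin TG V \<Longrightarrow> g \<in> V \<Longrightarrow> g \<in> carrier G"
  using openin_subset G.topsp by blast

text \<open>
  There are no small subgroups: as the powers of \<open>x\<close> up to an order proportional to \<open>1 / \<bar>x\<bar>\<close> stay
  small, so do those of \<open>\<pi> g x\<close>, which bounds \<open>\<pi> g x\<close> linearly.
\<close>

lemma action_bound:
  assumes g0: "g0 \<in> carrier G"
  shows "\<exists>V K \<delta>. openin TG V \<and> g0 \<in> V \<and> K > 0 \<and> \<delta> > 0 \<and> \<delta> \<le> rN \<and>
    (\<forall>g\<in>V. \<forall>x\<in>N.nb \<delta>. \<pi> g x \<in> N.nb rN \<and> norm (LN (\<pi> g x)) \<le> K * norm (LN x))"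
proof -
  have r: "rN > 0" "rN \<le> RN" using N.radii by auto
  obtain V W where V: "openin TG V" "g0 \<in> V" and W: "openin TN W" "\<one>\<^bsub>N\<^esub> \<in> W"
    and VW: "\<And>g x. g \<in> V \<Longrightarrow> x \<in> W \<Longrightarrow> \<pi> g x \<in> N.nb rN"
    using pi_nhd[OF N.openin_nb g0 N.one_closed, of rN] pi_one_N[OF g0] N.one_nb[OF r(1)] by auto
  obtain d where d: "d > 0" "N.nb d \<subseteq> W" using N.nhd_nb[OF W] by blast
  define \<delta> where "\<delta> = min d rN"
  have \<delta>: "\<delta> > 0" "\<delta> \<le> d" "\<delta> \<le> rN" using d r by (auto simp: \<delta>_def)
  have est: "\<pi> g x \<in> N.nb rN \<and> norm (LN (\<pi> g x)) \<le> (16 * rN / \<delta>) * norm (LN x)"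
    if g: "g \<in> V" and x: "x \<in> N.nb (\<delta> / 4)" for g x
  proof -
    have gc: "g \<in> carrier G" using openin_carrier_G[OF V(1) g] .
    have xc: "x \<in> carrier N" using N.nb_carrier[OF x] .
    have "\<delta> / 4 \<le> d" using \<delta> by simp
    then have y: "\<pi> g x \<in> N.nb rN" using VW[OF g] d(2) N.nb_mono[OF x] by blast
    show ?thesis
    proof (cases "LN x = 0")
      case True
      then have "x = \<one>\<^bsub>N\<^esub>" using inj_onD[OF N.inj_L _ N.nb_U[OF x] N.oneU] N.L_one by simp
      then show ?thesis using y True pi_one_N[OF gc] N.L_one by simp
    next
      case False
      define n where "n = norm (LN x)"
      have n: "n > 0" "n < \<delta> / 4" using False N.nb_norm[OF x] by (auto simp: n_def)
      \<comment> \<open>The number of usable powers: for \<open>m \<le> q\<close> one has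
        \<open>2 * m * n \<le> \<delta> / 2\<close>, so that \<open>x [^] k\<close> stays in the
        ball on which \<open>\<pi> g\<close> is controlled for \<open>k \<le> m\<close>. As
        \<open>q > 1\<close>, the integer part \<open>m\<close> is at least \<open>q / 2\<close>;
        from \<open>m * norm (LN (\<pi> g x)) \<le> 2 * rN\<close> this gives the constant
        \<open>16 * rN / \<delta>\<close>.\<close>
      define q where "q = \<delta> / (4 * n)"
      have q: "q > 1" using n by (simp add: q_def)
      define m where "m = nat \<lfloor>q\<rfloor>"
      have m: "real m \<le> q" "q < real m + 1" "m \<ge> 1" using q unfolding m_def by linarith+
      have "2 * (real m * n) \<le> 2 * (q * n)" using m n by (intro mult_left_mono mult_right_mono) auto
      also have "\<dots> = \<delta> / 2" using n by (simp add: q_def)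
      finally have mn: "2 * real m * n \<le> \<delta> / 2" by simp
      have xk: "x [^]\<^bsub>N\<^esub> k \<in> N.nb d" if k: "k \<le> m" for k
      proof -
        have "2 * real m * norm (LN x) < RN" using mn \<delta> r by (simp add: n_def)
        from N.power_est_growth[OF N.nb_U[OF x] this k]
        have "x [^]\<^bsub>N\<^esub> k \<in> N.nb RN" "norm (LN (x [^]\<^bsub>N\<^esub> k)) \<le> 2 * real k * n" by (auto simp: n_def)
        moreover have "2 * real k * n \<le> 2 * real m * n" using k n by (intro mult_right_mono) auto
        ultimately show ?thesis using mn \<delta> N.nb_U by (intro N.nbI) auto
      qed
      have yk: "\<pi> g x [^]\<^bsub>N\<^esub> k \<in> N.nb rN" if "k \<le> m" for k
        using VW[OF g, of "x [^]\<^bsub>N\<^esub> k"] xk[OF that] d(2) pi_pow_N[OF gc xc] by auto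
      have "norm (LN (\<pi> g x [^]\<^bsub>N\<^esub> m) - real m *\<^sub>R LN (\<pi> g x)) \<le> real m * (1/4 * norm (LN (\<pi> g x)))"
        by (rule N.power_est_small) (use pi_closed[OF gc xc] yk N.nb_mono r in auto)
      then have "real m * norm (LN (\<pi> g x)) \<le> real m * (1/4 * norm (LN (\<pi> g x))) + norm (LN (\<pi> g x [^]\<^bsub>N\<^esub> m))"
        using norm_triangle_ineq2[of "real m *\<^sub>R LN (\<pi> g x)" "LN (\<pi> g x [^]\<^bsub>N\<^esub> m)"]
        by (simp add: norm_minus_commute)
      then have my: "real m * norm (LN (\<pi> g x)) \<le> 2 * rN"
        using N.nb_norm[OF yk[of m]] r by simp
      have "q / 2 * norm (LN (\<pi> g x)) \<le> real m * norm (LN (\<pi> g x))"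
        using m by (intro mult_right_mono) auto
      with my have "q * norm (LN (\<pi> g x)) \<le> 4 * rN" by simp
      then have "norm (LN (\<pi> g x)) \<le> (16 * rN / \<delta>) * n"
        using n \<delta> by (simp add: q_def field_simps)
      with y show ?thesis by (simp add: n_def)
    qed
  qed
  show ?thesis
    by (rule exI[of _ V], rule exI[of _ "16 * rN / \<delta>"], rule exI[of _ "\<delta> / 4"])
      (use V \<delta> r est in auto)
qed

lemma A_linear: "g \<in> carrier G \<Longrightarrow> bounded_linear (A g)"
  using has_derivative_bounded_linear[OF A_deriv] .

text \<open>
  Comparing \<open>\<pi> g (x \<otimes> x)\<close> with \<open>\<pi> g x \<otimes> \<pi> g x\<close> shows that \<open>v \<mapsto> 2\<^sup>k \<cdot> L (\<pi> g (E (v / 2\<^sup>k)))\<close> changes by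
  \<open>O(\<bar>v\<bar>\<^sup>2 / 2\<^sup>k)\<close> per step; its limit is \<open>A g v\<close>.
\<close>

lemma action_linearization:
  assumes g0: "g0 \<in> carrier G"
  shows "\<exists>V K \<delta>. openin TG V \<and> g0 \<in> V \<and> K > 0 \<and> \<delta> > 0 \<and> \<delta> \<le> rN \<and>
    (\<forall>g\<in>V. (\<forall>x\<in>N.nb \<delta>. \<pi> g x \<in> N.nb rN \<and> norm (LN (\<pi> g x)) \<le> K * norm (LN x) \<and>
        norm (LN (\<pi> g x) - A g (LN x)) \<le> K * (norm (LN x))\<^sup>2) \<and>
      (\<forall>v. norm (A g v) \<le> K * norm v))"
proof -
  have r: "rN > 0" "rN \<le> RN" and C: "CN \<ge> 0" using N.radii by auto
  obtain V K \<delta>0 where V: "openin TG V" "g0 \<in> V" and K: "K > 0" and \<delta>0: "\<delta>0 > 0" "\<delta>0 \<le> rN"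
    and bd: "\<And>g x. g \<in> V \<Longrightarrow> x \<in> N.nb \<delta>0 \<Longrightarrow> \<pi> g x \<in> N.nb rN \<and> norm (LN (\<pi> g x)) \<le> K * norm (LN x)"
    using action_bound[OF g0] by metis
  \<comment> \<open>A square \<open>x \<otimes> x\<close> has norm at most
    \<open>3 * norm (LN x)\<close>. The bound \<open>rN / 3\<close> keeps squares of
    \<open>x\<close> in the \<open>rN\<close>-ball, and \<open>RN / (3 * K)\<close> keeps squares of
    \<open>\<pi> g x\<close> in the \<open>RN\<close>-ball.\<close>
  define \<delta> where "\<delta> = Min {\<delta>0, rN / 3, RN / (3 * K)}"
  have \<delta>: "\<delta> > 0" "\<delta> \<le> \<delta>0" "\<delta> \<le> rN / 3" "\<delta> \<le> RN / (3 * K)"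
    using r K \<delta>0 by (auto simp: \<delta>_def)
  define K' where "K' = CN * K\<^sup>2 + 4 * CN * K"
  have K': "K' \<ge> 0" using C K by (auto simp: K'_def)
  let ?E = "inv_into ON LN"
  have E: "?E v \<in> ON" "LN (?E v) = v" if "norm v < RN" for v using N.E_U N.L_E that by auto
  have main: "norm (LN (\<pi> g (?E v)) - A g v) \<le> K' * (norm v)\<^sup>2" if g: "g \<in> V" and v: "norm v < \<delta>" for g v
  proof -
    have gc: "g \<in> carrier G" using openin_carrier_G[OF V(1) g] .
    define f where "f u = LN (\<pi> g (?E u))" for u
    \<comment> \<open>The element \<open>z\<close> with coordinate \<open>2 *\<^sub>R u\<close>
      equals \<open>(x \<otimes> x) \<otimes> q\<close> with \<open>q\<close> quadratically small,
      hence \<open>\<pi> g z = (y \<otimes> y) \<otimes> w\<close> with \<open>y = \<pi> g x\<close>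
      and \<open>w = \<pi> g q\<close>. In \<open>K'\<close> the summand \<open>4 * CN * K\<close>
      stems from \<open>w\<close>, the summand \<open>CN * K\<^sup>2\<close> from the bilinear error
      of \<open>y \<otimes> y\<close>.\<close>
    have dbl: "norm (f (2 *\<^sub>R u) - 2 *\<^sub>R f u) \<le> K' * (norm u)\<^sup>2" if u2: "norm (2 *\<^sub>R u) < \<delta>" for u
    proof -
      have u: "norm u < \<delta>" "2 * norm u < \<delta>0" "norm u < \<delta>0" "norm u < rN" "norm (2 *\<^sub>R u) < rN"
        using u2 \<delta> r norm_ge_zero[of u] unfolding norm_scaleR by linarith+
      have uR: "norm u < RN" "norm (2 *\<^sub>R u) < RN" using u r by linarith+
      define x where "x = ?E u"
      have x: "x \<in> ON" "LN x = u" using E[OF uR(1)] by (auto simp: x_def)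
      have xd: "x \<in> N.nb \<delta>0" "x \<in> N.nb RN" using x u uR by (auto simp: N.nb_def)
      have xc: "x \<in> carrier N" using N.nb_carrier[OF xd(1)] .
      define x2 where "x2 = x \<otimes>\<^bsub>N\<^esub> x"
      note m = N.nb_mult_est[OF xd(2) xd(2), folded x2_def]
      have "norm (LN x2) \<le> 3 * norm u" using m(4) x by simp
      also have "\<dots> < rN" using u \<delta> by linarith
      finally have x2: "x2 \<in> N.nb rN" using m(1) by (rule_tac N.nbI)
      define z where "z = ?E (2 *\<^sub>R u)"
      have z: "z \<in> N.nb rN" "LN z = 2 *\<^sub>R u" using E[OF uR(2)] u by (auto simp: z_def N.nb_def)
      define q where "q = inv\<^bsub>N\<^esub> x2 \<otimes>\<^bsub>N\<^esub> z"
      note dq = N.nb_div_est[OF x2 z(1), folded q_def]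
      have "norm (LN z - LN x2) \<le> CN * norm u * norm u"
        using m(2) x z by (simp add: norm_minus_commute scaleR_2 algebra_simps)
      then have qn: "norm (LN q) \<le> 2 * CN * (norm u)\<^sup>2" using dq(2) by (simp add: power2_eq_square)
      have "CN * norm u \<le> 1/4" using N.C_small[of "norm u"] uR by simp
      then have "2 * (CN * norm u) * norm u \<le> 2 * (1/4) * norm u" using C by (intro mult_mono) auto
      then have "2 * CN * (norm u)\<^sup>2 \<le> norm u / 2" by (simp add: power2_eq_square mult_ac)
      with qn u norm_ge_zero[of u] have "norm (LN q) < \<delta>0" by linarith
      then have qd: "q \<in> N.nb \<delta>0" using N.nb_U[OF dq(1)] by (rule_tac N.nbI)
      have qc: "q \<in> carrier N" using N.nb_carrier[OF qd] .
      define y where "y = \<pi> g x"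
      have y: "y \<in> N.nb rN" "norm (LN y) \<le> K * norm u" using bd[OF g xd(1)] x by (auto simp: y_def)
      have yR: "y \<in> N.nb RN" using N.nb_mono[OF y(1) r(2)] .
      note my = N.nb_mult_est[OF yR yR]
      have "K * norm u < RN / 3"
      proof -
        have "K * norm u < K * (RN / (3 * K))" using u \<delta> K by (intro mult_strict_left_mono) auto
        then show ?thesis using K by simp
      qed
      then have y2: "y \<otimes>\<^bsub>N\<^esub> y \<in> N.nb RN" using my y(2) by (intro N.nbI) auto
      define w where "w = \<pi> g q"
      have w: "w \<in> N.nb rN" "norm (LN w) \<le> K * (2 * CN * (norm u)\<^sup>2)"
        using bd[OF g qd] order_trans[OF _ mult_left_mono[OF qn, of K]] K by (auto simp: w_def)
      note mw = N.nb_mult_est[OF y2 N.nb_mono[OF w(1) r(2)]]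
      have "z = x2 \<otimes>\<^bsub>N\<^esub> q" using N.nb_carrier[OF z(1)] N.nb_carrier[OF x2] by (simp add: q_def flip: N.m_assoc)
      then have "\<pi> g z = (y \<otimes>\<^bsub>N\<^esub> y) \<otimes>\<^bsub>N\<^esub> w"
        using gc xc qc by (simp add: pi_mult_N x2_def y_def w_def)
      then have "norm (f (2 *\<^sub>R u) - LN (y \<otimes>\<^bsub>N\<^esub> y)) \<le> 2 * (K * (2 * CN * (norm u)\<^sup>2))"
        using mw(3) w(2) by (simp add: f_def z_def)
      moreover have "norm (LN (y \<otimes>\<^bsub>N\<^esub> y) - 2 *\<^sub>R f u) \<le> CN * (K * norm u) * (K * norm u)"
      proof -
        have "norm (LN (y \<otimes>\<^bsub>N\<^esub> y) - LN y - LN y) \<le> CN * norm (LN y) * norm (LN y)" by (rule my(2))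
        also have "\<dots> \<le> CN * (K * norm u) * (K * norm u)"
          using y(2) C K by (intro mult_mono) auto
        finally show ?thesis by (simp add: f_def y_def x_def scaleR_2 algebra_simps)
      qed
      ultimately have "norm (f (2 *\<^sub>R u) - 2 *\<^sub>R f u) \<le> 2 * (K * (2 * CN * (norm u)\<^sup>2)) + CN * (K * norm u) * (K * norm u)"
        using norm_triangle_ineq[of "f (2 *\<^sub>R u) - LN (y \<otimes>\<^bsub>N\<^esub> y)" "LN (y \<otimes>\<^bsub>N\<^esub> y) - 2 *\<^sub>R f u"] by simp
      then show ?thesis by (simp add: K'_def power2_eq_square algebra_simps)
    qed
    \<comment> \<open>Telescoping: the step from \<open>n\<close> to \<open>Suc n\<close> costs at
      most \<open>K' * (norm v)\<^sup>2 / 2 ^ Suc n\<close>, and these costs form a geometric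
      series.\<close>
    have tel: "norm (2 ^ n *\<^sub>R f ((1 / 2 ^ n) *\<^sub>R v) - f v) \<le> K' * (norm v)\<^sup>2 * (1 - 1 / 2 ^ n)" for n :: nat
    proof (induction n)
      case 0
      then show ?case by simp
    next
      case (Suc n)
      define u where "u = (1 / 2 ^ Suc n) *\<^sub>R v"
      have u2: "2 *\<^sub>R u = (1 / 2 ^ n) *\<^sub>R v" by (simp add: u_def)
      have "norm (2 *\<^sub>R u) \<le> norm v" unfolding u2 by (simp add: divide_le_eq mult_le_cancel_left1)
      then have "norm (f (2 *\<^sub>R u) - 2 *\<^sub>R f u) \<le> K' * (norm u)\<^sup>2" using v by (intro dbl) linarith
      then have "norm (2 ^ n *\<^sub>R (2 *\<^sub>R f u - f (2 *\<^sub>R u))) \<le> 2 ^ n * (K' * (norm u)\<^sup>2)"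
        by (simp add: norm_minus_commute)
      also have "\<dots> = K' * (norm v)\<^sup>2 * (1 / (2 ^ Suc n * 2))"
        by (simp add: u_def power2_eq_square field_simps)
      also have "\<dots> \<le> K' * (norm v)\<^sup>2 * (1 / 2 ^ Suc n)"
        using K' by (intro mult_left_mono) (auto simp: field_simps)
      finally have "norm (2 ^ n *\<^sub>R (2 *\<^sub>R f u - f (2 *\<^sub>R u)) + (2 ^ n *\<^sub>R f (2 *\<^sub>R u) - f v)) \<le>
          K' * (norm v)\<^sup>2 * (1 / 2 ^ Suc n) + K' * (norm v)\<^sup>2 * (1 - 1 / 2 ^ n)"
        using Suc u2 by (intro norm_triangle_mono) auto
      also have "2 ^ n *\<^sub>R (2 *\<^sub>R f u - f (2 *\<^sub>R u)) + (2 ^ n *\<^sub>R f (2 *\<^sub>R u) - f v) = 2 ^ Suc n *\<^sub>R f u - f v"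
        by (simp add: algebra_simps)
      also have "K' * (norm v)\<^sup>2 * (1 / 2 ^ Suc n) + K' * (norm v)\<^sup>2 * (1 - 1 / 2 ^ n) =
          K' * (norm v)\<^sup>2 * (1 - 1 / 2 ^ Suc n)"
        by (simp add: field_simps)
      finally show ?case by (simp add: u_def)
    qed
    have E0: "?E 0 = \<one>\<^bsub>N\<^esub>" using N.E_L[OF N.oneU] N.L_one by simp
    have f0: "f 0 = 0" by (simp add: f_def E0 pi_one_N[OF gc] N.L_one)
    note linA = bounded_linear.linear[OF A_linear[OF gc]]
    \<comment> \<open>Differentiability of \<open>f\<close> at \<open>0\<close> identifies the limit
      of the rescaled values. The \<open>n\<close> that has to be chosen depends on
      \<open>g\<close>, but it drops out of the bound, which is why the final estimate is uniform in
      \<open>g\<close>.\<close>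
    have app: "norm (f v - A g v) \<le> K' * (norm v)\<^sup>2 + e * norm v" if e: "e > 0" for e
    proof -
      obtain d where d: "d > 0" "\<And>u. norm u < d \<Longrightarrow> norm (f u - A g u) \<le> e * norm u"
        using A_deriv[OF gc] e f0 unfolding has_derivative_at_alt f_def by fastforce
      have "d / (norm v + 1) > 0" using d(1) by (intro divide_pos_pos add_nonneg_pos) auto
      then obtain n :: nat where n: "(1/2) ^ n < d / (norm v + 1)"
        using real_arch_pow_inv[of "d / (norm v + 1)" "1/2"] by auto
      define u where "u = (1 / 2 ^ n) *\<^sub>R v"
      have "norm u \<le> (1/2) ^ n * (norm v + 1)" by (simp add: u_def power_one_over field_simps)
      also have "\<dots> < d" using n by (subst (asm) pos_less_divide_eq) (auto intro: add_nonneg_pos)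
      finally have "norm (f u - A g u) \<le> e * norm u" by (rule d(2))
      then have "norm (2 ^ n *\<^sub>R (f u - A g u)) \<le> 2 ^ n * (e * norm u)" by simp
      also have "2 ^ n *\<^sub>R (f u - A g u) = 2 ^ n *\<^sub>R f u - A g v"
        by (simp add: u_def linear_scale[OF linA] scaleR_diff_right)
      also have "2 ^ n * (e * norm u) = e * norm v" by (simp add: u_def)
      finally have 1: "norm (2 ^ n *\<^sub>R f u - A g v) \<le> e * norm v" .
      have "K' * (norm v)\<^sup>2 * (1 - 1 / 2 ^ n) \<le> K' * (norm v)\<^sup>2 * 1"
        using K' by (intro mult_left_mono) auto
      then have "norm (2 ^ n *\<^sub>R f u - f v) \<le> K' * (norm v)\<^sup>2" using tel[of n] by (simp add: u_def)
      with 1 show ?thesis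
        using norm_triangle_ineq4[of "2 ^ n *\<^sub>R f u - A g v" "2 ^ n *\<^sub>R f u - f v"] by simp
    qed
    show ?thesis
    proof (rule field_le_epsilon)
      fix e :: real assume e: "e > 0"
      have "norm (f v - A g v) \<le> K' * (norm v)\<^sup>2 + e / (norm v + 1) * norm v"
        using e by (intro app divide_pos_pos) (auto intro: add_nonneg_pos)
      also have "e / (norm v + 1) * norm v \<le> e"
        using e by (simp add: pos_divide_le_eq add_pos_nonneg algebra_simps)
      finally show "norm (LN (\<pi> g (?E v)) - A g v) \<le> K' * (norm v)\<^sup>2 + e" by (simp add: f_def)
    qed
  qed
  \<comment> \<open>By linearity it is enough to treat a multiple of \<open>v\<close> of norm
    \<open>\<delta> / 2\<close>, where \<open>A g\<close> is compared with
    \<open>\<pi> g\<close>.\<close>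
  have Ab: "norm (A g v) \<le> (K + K' * \<delta>) * norm v" if g: "g \<in> V" for g v
  proof (cases "v = 0")
    case False
    have gc: "g \<in> carrier G" using openin_carrier_G[OF V(1) g] .
    note linA = bounded_linear.linear[OF A_linear[OF gc]]
    define t where "t = \<delta> / (2 * norm v)"
    have t: "t > 0" using \<delta> False by (simp add: t_def)
    define u where "u = t *\<^sub>R v"
    have u: "norm u < \<delta>" using False \<delta> t by (simp add: u_def t_def)
    have uR: "norm u < RN" using u \<delta> r by linarith
    have "norm (LN (\<pi> g (?E u))) \<le> K * norm (LN (?E u))"
      using bd[OF g, of "?E u"] E[OF uR] u \<delta> by (auto simp: N.nb_def)
    then have "norm (LN (\<pi> g (?E u))) \<le> K * norm u" using E[OF uR] by simp
    moreover have "K' * (norm u)\<^sup>2 \<le> K' * (\<delta> * norm u)"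
      using K' u by (intro mult_left_mono) (auto simp: power2_eq_square mult_right_mono)
    ultimately have "norm (A g u) \<le> (K + K' * \<delta>) * norm u"
      using main[OF g u] norm_triangle_ineq2[of "A g u" "LN (\<pi> g (?E u))"]
      by (simp add: norm_minus_commute algebra_simps)
    then have "t * norm (A g v) \<le> t * ((K + K' * \<delta>) * norm v)"
      using t by (simp add: u_def linear_scale[OF linA] mult_ac)
    then show ?thesis using t by simp
  next
    case True
    then show ?thesis using linear_0[OF bounded_linear.linear[OF A_linear[OF openin_carrier_G[OF V(1) g]]]] by simp
  qed
  define Kf where "Kf = K + K' + K' * \<delta>"
  have Kf: "K \<le> Kf" "K' \<le> Kf" "K + K' * \<delta> \<le> Kf" using K K' \<delta> by (auto simp: Kf_def)
  show ?thesis
  proof (rule exI[of _ V], rule exI[of _ Kf], rule exI[of _ \<delta>], intro conjI ballI allI V)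
    show "Kf > 0" "\<delta> > 0" "\<delta> \<le> rN" using Kf K \<delta> r by linarith+
    fix g assume g: "g \<in> V"
    show "norm (A g v) \<le> Kf * norm v" for v
      using Ab[OF g, of v] mult_right_mono[OF Kf(3), of "norm v"] by simp
    fix x assume x: "x \<in> N.nb \<delta>"
    have xd: "x \<in> N.nb \<delta>0" using N.nb_mono[OF x \<delta>(2)] .
    show "\<pi> g x \<in> N.nb rN" using bd[OF g xd] by simp
    show "norm (LN (\<pi> g x)) \<le> Kf * norm (LN x)"
      using bd[OF g xd] mult_right_mono[OF Kf(1), of "norm (LN x)"] by simp
    show "norm (LN (\<pi> g x) - A g (LN x)) \<le> Kf * (norm (LN x))\<^sup>2"
      using main[OF g, of "LN x"] N.nb_norm[OF x] N.E_L[OF N.nb_U[OF x]] mult_right_mono[OF Kf(2), of "(norm (LN x))\<^sup>2"]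
      by simp
  qed
qed

text \<open>For fixed small \<open>\<tau>\<close>, the vector \<open>A g w\<close> is approximated
  by \<open>LN (\<pi> g x) / \<tau>\<close>, where \<open>x\<close> has coordinate
  \<open>\<tau> *\<^sub>R w\<close>, with an error \<open>O(\<tau>)\<close> uniform in
  \<open>g\<close>; this approximation is continuous in \<open>g\<close>. Two linearization errors
  \<open>e / 4\<close> and one continuity error \<open>e / 2\<close> add up to
  \<open>e\<close>.\<close>

lemma A_strongly_continuous:
  assumes g0: "g0 \<in> carrier G" and e: "e > 0"
  shows "\<exists>V. openin TG V \<and> g0 \<in> V \<and> (\<forall>g\<in>V. norm (A g w - A g0 w) < e)"
proof -
  obtain V K \<delta> where V: "openin TG V" "g0 \<in> V" and K: "K > 0" and \<delta>: "\<delta> > 0" "\<delta> \<le> rN"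
    and bd: "\<And>g x. g \<in> V \<Longrightarrow> x \<in> N.nb \<delta> \<Longrightarrow> \<pi> g x \<in> N.nb rN \<and>
        norm (LN (\<pi> g x) - A g (LN x)) \<le> K * (norm (LN x))\<^sup>2"
    using action_linearization[OF g0] by metis
  define c where "c = K * (norm w)\<^sup>2 + 1"
  have c: "c > 0" using K by (auto simp: c_def intro: add_nonneg_pos)
  have nw: "norm w + 1 > 0" by (auto intro: add_nonneg_pos)
  define \<tau> where "\<tau> = min (\<delta> / (norm w + 1)) (e / (4 * c))"
  have \<tau>: "\<tau> > 0" "\<tau> \<le> \<delta> / (norm w + 1)" "\<tau> \<le> e / (4 * c)"
    using \<delta> e c nw by (auto simp: \<tau>_def)
  define x where "x = inv_into ON LN (\<tau> *\<^sub>R w)"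
  have "\<tau> * (norm w + 1) \<le> \<delta>" using \<tau>(2) nw by (simp add: field_simps)
  then have nx: "norm (\<tau> *\<^sub>R w) < \<delta>" using \<tau>(1) by (simp add: algebra_simps)
  then have "norm (\<tau> *\<^sub>R w) < RN" using \<delta> N.radii by linarith
  then have x: "x \<in> ON" "LN x = \<tau> *\<^sub>R w" using N.E_U N.L_E by (auto simp: x_def)
  then have x\<delta>: "x \<in> N.nb \<delta>" using nx by (simp add: N.nb_def)
  define W where "W = {y \<in> ON. LN y \<in> ball (LN (\<pi> g0 x)) (\<tau> * e / 2)}"
  have W: "openin TN W" unfolding W_def by (rule N.openin_L) simp
  have "\<pi> g0 x \<in> W" using bd[OF V(2) x\<delta>] N.nb_U \<tau> e by (auto simp: W_def)
  from pi_nhd[OF W g0 N.nb_carrier[OF x\<delta>] this]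
  obtain V1 where V1: "openin TG V1" "g0 \<in> V1" "\<And>h. h \<in> V1 \<Longrightarrow> \<pi> h x \<in> W" by blast
  show ?thesis
  proof (intro exI[of _ "V \<inter> V1"] conjI ballI)
    show "openin TG (V \<inter> V1)" "g0 \<in> V \<inter> V1" using V V1 by auto
    fix g assume g: "g \<in> V \<inter> V1"
    have gc: "g \<in> carrier G" using g openin_carrier_G[OF V(1)] by blast
    have q: "K * (norm (LN x))\<^sup>2 \<le> \<tau> * (e / 4)"
    proof -
      have "\<tau> * c \<le> e / 4" using \<tau>(3) c by (simp add: field_simps)
      then have "\<tau> * (K * (norm w)\<^sup>2) \<le> e / 4" using \<tau> by (simp add: c_def distrib_left)
      then have "\<tau> * (\<tau> * (K * (norm w)\<^sup>2)) \<le> \<tau> * (e / 4)" using \<tau> by (intro mult_left_mono) auto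
      then show ?thesis by (simp add: x power2_eq_square mult_ac)
    qed
    have 1: "norm (LN (\<pi> g x) - A g (LN x)) \<le> \<tau> * (e / 4)" using bd[of g x] g x\<delta> q by force
    have 2: "norm (LN (\<pi> g0 x) - A g0 (LN x)) \<le> \<tau> * (e / 4)" using bd[OF V(2) x\<delta>] q by force
    have 3: "norm (LN (\<pi> g0 x) - LN (\<pi> g x)) < \<tau> * e / 2"
      using V1(3)[of g] g by (auto simp: W_def dist_norm)
    have "A g (LN x) - A g0 (LN x) =
        - (LN (\<pi> g x) - A g (LN x)) + (LN (\<pi> g0 x) - A g0 (LN x)) - (LN (\<pi> g0 x) - LN (\<pi> g x))" by simp
    also have "norm \<dots> < \<tau> * e"
      using 1 2 3 norm_triangle_ineq4[of "- (LN (\<pi> g x) - A g (LN x)) + (LN (\<pi> g0 x) - A g0 (LN x))" "LN (\<pi> g0 x) - LN (\<pi> g x)"]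
        norm_triangle_ineq[of "- (LN (\<pi> g x) - A g (LN x))" "LN (\<pi> g0 x) - A g0 (LN x)"]
      unfolding norm_minus_cancel by linarith
    finally have "norm (\<tau> *\<^sub>R (A g w - A g0 w)) < \<tau> * e"
      by (simp add: x linear_scale bounded_linear.linear A_linear gc g0 scaleR_diff_right)
    then show "norm (A g w - A g0 w) < e" using \<tau> by simp
  qed
qed

lemma A_tendsto:
  assumes "limitin TG g g0 F"
  shows "((\<lambda>s. A (g s) w) \<longlongrightarrow> A g0 w) F"
proof (rule tendstoI)
  fix e :: real assume "e > 0"
  have "g0 \<in> carrier G" using limitin_topspace[OF assms] by (simp add: G.topsp)
  from A_strongly_continuous[OF this \<open>e > 0\<close>]
  obtain V where V: "openin TG V" "g0 \<in> V" and *: "\<forall>g\<in>V. norm (A g w - A g0 w) < e" by auto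
  show "\<forall>\<^sub>F s in F. dist (A (g s) w) (A g0 w) < e"
    using limitinD[OF assms V] by eventually_elim (simp add: dist_norm *)
qed

text \<open>Three errors are of size \<open>o(s)\<close> or small times \<open>s\<close>: the
  quadratic linearization error, \<open>A g\<close> applied to the tangency error of
  \<open>b\<close>, and \<open>s\<close> times \<open>A g w - A g0 w\<close>. The neighbourhood
  \<open>V\<close> does not depend on \<open>s\<close>, so \<open>g\<close> may afterwards vary with
  \<open>s\<close> and even with a further index.\<close>

lemma action_tang_uniform:
  assumes b: "N.tang F b w" and F: "F \<le> at 0" and g0: "g0 \<in> carrier G" and e: "e > 0"
  shows "\<exists>V. openin TG V \<and> g0 \<in> V \<and> (\<forall>\<^sub>F s in F. \<forall>g\<in>V. \<pi> g (b s) \<in> N.nb rN \<and>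
    norm (LN (\<pi> g (b s)) - s *\<^sub>R A g0 w) \<le> e * \<bar>s\<bar>)"
proof -
  obtain V K \<delta> where V: "openin TG V" "g0 \<in> V" and K: "K > 0" and \<delta>: "\<delta> > 0" "\<delta> \<le> rN"
    and bd: "\<And>g x. g \<in> V \<Longrightarrow> x \<in> N.nb \<delta> \<Longrightarrow> \<pi> g x \<in> N.nb rN \<and>
        norm (LN (\<pi> g x) - A g (LN x)) \<le> K * (norm (LN x))\<^sup>2"
    and Ab: "\<And>g v. g \<in> V \<Longrightarrow> norm (A g v) \<le> K * norm v"
    using action_linearization[OF g0] by metis
  have e3: "e / 3 > 0" using e by simp
  from A_strongly_continuous[OF g0 e3]
  obtain V1 where V1: "openin TG V1" "g0 \<in> V1" "\<forall>g\<in>V1. norm (A g w - A g0 w) < e / 3" by auto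
  have eK: "e / (3 * K) > 0" using e K by simp
  define c where "c = K * (norm w + 1)\<^sup>2"
  have c: "c > 0" using K by (auto simp: c_def intro!: mult_pos_pos zero_less_power add_nonneg_pos)
  have ec: "e / (3 * c) > 0" using e c by simp
  have "\<forall>\<^sub>F s in F. \<forall>g\<in>V \<inter> V1. \<pi> g (b s) \<in> N.nb rN \<and> norm (LN (\<pi> g (b s)) - s *\<^sub>R A g0 w) \<le> e * \<bar>s\<bar>"
    using N.tangD[OF b eK] N.tang_bound[OF b F] N.tang_nb[OF b F \<delta>(1)] eventually_abs_less[OF F ec]
  proof eventually_elim
    case (elim s)
    show ?case
    proof
      fix g assume g: "g \<in> V \<inter> V1"
      have gc: "g \<in> carrier G" using g openin_carrier_G[OF V(1)] by blast
      note B = bd[of g "b s"]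
      have "norm (LN (\<pi> g (b s)) - A g (LN (b s))) \<le> K * (norm (LN (b s)))\<^sup>2" using B g elim by blast
      also have "\<dots> \<le> K * ((norm w + 1) * \<bar>s\<bar>)\<^sup>2" using elim K by (intro mult_left_mono power_mono) auto
      also have "\<dots> = (c * \<bar>s\<bar>) * \<bar>s\<bar>" by (simp add: c_def power2_eq_square mult_ac)
      also have "\<dots> \<le> e / 3 * \<bar>s\<bar>" using elim(4) c by (intro mult_right_mono) (auto simp: field_simps)
      finally have 1: "norm (LN (\<pi> g (b s)) - A g (LN (b s))) \<le> e / 3 * \<bar>s\<bar>" .
      have "norm (A g (LN (b s) - s *\<^sub>R w)) \<le> K * norm (LN (b s) - s *\<^sub>R w)" using Ab g by blast
      also have "\<dots> \<le> K * (e / (3 * K) * \<bar>s\<bar>)" using elim K by (intro mult_left_mono) auto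
      finally have 2: "norm (A g (LN (b s)) - s *\<^sub>R A g w) \<le> e / 3 * \<bar>s\<bar>"
        using K by (simp add: linear_diff linear_scale bounded_linear.linear A_linear gc)
      have 3: "norm (s *\<^sub>R (A g w - A g0 w)) \<le> e / 3 * \<bar>s\<bar>"
        using bspec[OF V1(3), of g] g mult_left_mono[of "norm (A g w - A g0 w)" "e / 3" "\<bar>s\<bar>"] by (simp add: mult.commute)
      have "norm ((LN (\<pi> g (b s)) - A g (LN (b s))) + (A g (LN (b s)) - s *\<^sub>R A g w) + s *\<^sub>R (A g w - A g0 w))
          \<le> e / 3 * \<bar>s\<bar> + e / 3 * \<bar>s\<bar> + e / 3 * \<bar>s\<bar>"
        by (intro norm_triangle_mono 1 2 3)
      then show "\<pi> g (b s) \<in> N.nb rN \<and> norm (LN (\<pi> g (b s)) - s *\<^sub>R A g0 w) \<le> e * \<bar>s\<bar>"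
        using B g elim by (simp add: scaleR_diff_right algebra_simps)
    qed
  qed
  with V V1 show ?thesis by (intro exI[of _ "V \<inter> V1"]) auto
qed

lemma action_tang:
  assumes b: "N.tang F b w" and F: "F \<le> at 0" and g: "limitin TG g g0 F"
  shows "N.tang F (\<lambda>s. \<pi> (g s) (b s)) (A g0 w)"
  unfolding N.tang_def
proof (intro allI impI)
  fix e :: real assume e: "e > 0"
  have g0: "g0 \<in> carrier G" using limitin_topspace[OF g] by (simp add: G.topsp)
  from action_tang_uniform[OF b F g0 e] obtain V where V: "openin TG V" "g0 \<in> V"
    and ev: "\<forall>\<^sub>F s in F. \<forall>g\<in>V. \<pi> g (b s) \<in> N.nb rN \<and> norm (LN (\<pi> g (b s)) - s *\<^sub>R A g0 w) \<le> e * \<bar>s\<bar>" by blast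
  from ev limitinD[OF g V] show "\<forall>\<^sub>F s in F. \<pi> (g s) (b s) \<in> ON \<and>
      norm (LN (\<pi> (g s) (b s)) - s *\<^sub>R A g0 w) \<le> e * \<bar>s\<bar>"
    by eventually_elim (auto dest: N.nb_U)
qed

lemma action_tang_const:
  assumes "N.tang F b w" "F \<le> at 0" "g \<in> carrier G"
  shows "N.tang F (\<lambda>s. \<pi> g (b s)) (A g w)"
  using action_tang[OF assms(1,2), of "\<lambda>_. g" g] assms(3) by (simp add: G.topsp)

lemma line_carrier: "\<forall>\<^sub>F s in at 0. inv_into ON LN (s *\<^sub>R w) \<in> carrier N"
  using N.tangD[OF N.tang_line[of w] zero_less_one] by eventually_elim (simp add: N.U_carrier)

lemma A_one: "A \<one>\<^bsub>G\<^esub> w = w"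
proof (rule N.tang_unique[OF _ _ order_refl trivial_limit_at])
  show "N.tang (at 0) (\<lambda>s. \<pi> \<one>\<^bsub>G\<^esub> (inv_into ON LN (s *\<^sub>R w))) (A \<one>\<^bsub>G\<^esub> w)"
    by (rule action_tang_const[OF N.tang_line order_refl G.one_closed])
  have "\<forall>\<^sub>F s in at 0. inv_into ON LN (s *\<^sub>R w) = \<pi> \<one>\<^bsub>G\<^esub> (inv_into ON LN (s *\<^sub>R w))"
    using line_carrier[of w] by eventually_elim (simp add: pi_one)
  from N.tang_cong[OF N.tang_line this]
  show "N.tang (at 0) (\<lambda>s. \<pi> \<one>\<^bsub>G\<^esub> (inv_into ON LN (s *\<^sub>R w))) w" .
qed

text \<open>Both sides are velocities of the same curve, the image of a straight line in the chart,
  and velocities are unique.\<close>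

lemma A_mult:
  assumes g: "g \<in> carrier G" "h \<in> carrier G"
  shows "A (g \<otimes>\<^bsub>G\<^esub> h) w = A g (A h w)"
proof (rule N.tang_unique[OF _ _ order_refl trivial_limit_at])
  show "N.tang (at 0) (\<lambda>s. \<pi> (g \<otimes>\<^bsub>G\<^esub> h) (inv_into ON LN (s *\<^sub>R w))) (A (g \<otimes>\<^bsub>G\<^esub> h) w)"
    by (rule action_tang_const[OF N.tang_line order_refl G.m_closed[OF g]])
  have 1: "N.tang (at 0) (\<lambda>s. \<pi> g (\<pi> h (inv_into ON LN (s *\<^sub>R w)))) (A g (A h w))"
    by (rule action_tang_const[OF action_tang_const[OF N.tang_line order_refl g(2)] order_refl g(1)])
  have "\<forall>\<^sub>F s in at 0. \<pi> g (\<pi> h (inv_into ON LN (s *\<^sub>R w))) = \<pi> (g \<otimes>\<^bsub>G\<^esub> h) (inv_into ON LN (s *\<^sub>R w))"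
    using line_carrier[of w] by eventually_elim (simp add: pi_mult g)
  from N.tang_cong[OF 1 this]
  show "N.tang (at 0) (\<lambda>s. \<pi> (g \<otimes>\<^bsub>G\<^esub> h) (inv_into ON LN (s *\<^sub>R w))) (A g (A h w))" .
qed

subsection \<open>One-parameter groups of the semidirect product\<close>

abbreviation H where "H \<equiv> semidirect_product N G \<pi>"

lemma H_simps: "carrier H = carrier N \<times> carrier G" "\<one>\<^bsub>H\<^esub> = (\<one>\<^bsub>N\<^esub>, \<one>\<^bsub>G\<^esub>)"
  "(n, g) \<otimes>\<^bsub>H\<^esub> (n', g') = (n \<otimes>\<^bsub>N\<^esub> \<pi> g n', g \<otimes>\<^bsub>G\<^esub> g')"
  by (simp_all add: semidirect_product_def)

lemma H_group: "group H"
proof (rule groupI)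
  fix x assume x: "x \<in> carrier H"
  obtain n g where ng: "x = (n, g)" "n \<in> carrier N" "g \<in> carrier G" using x by (auto simp: H_simps)
  have "(\<pi> (inv\<^bsub>G\<^esub> g) (inv\<^bsub>N\<^esub> n), inv\<^bsub>G\<^esub> g) \<otimes>\<^bsub>H\<^esub> x = \<one>\<^bsub>H\<^esub>"
    using ng by (simp add: H_simps pi_one_N flip: pi_mult_N)
  then show "\<exists>y\<in>carrier H. y \<otimes>\<^bsub>H\<^esub> x = \<one>\<^bsub>H\<^esub>"
    using ng by (intro bexI[of _ "(\<pi> (inv\<^bsub>G\<^esub> g) (inv\<^bsub>N\<^esub> n), inv\<^bsub>G\<^esub> g)"]) (auto simp: H_simps pi_closed)
qed (auto simp: H_simps pi_closed pi_one pi_mult pi_mult_N N.m_assoc G.m_assoc)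

lemma H_inv:
  assumes "n \<in> carrier N" "g \<in> carrier G"
  shows "inv\<^bsub>H\<^esub> (n, g) = (\<pi> (inv\<^bsub>G\<^esub> g) (inv\<^bsub>N\<^esub> n), inv\<^bsub>G\<^esub> g)"
  by (rule group.inv_equality[OF H_group])
    (use assms in \<open>auto simp: H_simps pi_closed pi_one_N simp flip: pi_mult_N\<close>)

lemma H_div:
  assumes "n \<in> carrier N" "g \<in> carrier G" "n' \<in> carrier N" "g' \<in> carrier G"
  shows "inv\<^bsub>H\<^esub> (n, g) \<otimes>\<^bsub>H\<^esub> (n', g') = (\<pi> (inv\<^bsub>G\<^esub> g) (inv\<^bsub>N\<^esub> n \<otimes>\<^bsub>N\<^esub> n'), inv\<^bsub>G\<^esub> g \<otimes>\<^bsub>G\<^esub> g')"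
  using assms by (simp add: H_inv H_simps pi_mult_N)

text \<open>The homomorphism property in \<open>H\<close> by components: \<open>\<beta>\<close> is a
  cocycle over \<open>\<alpha>\<close>. Of the regularity only the velocity \<open>(w, a)\<close> at
  time \<open>0\<close> is recorded; that the curve is \<open>C\<^sup>1\<close> follows from the
  group law.\<close>

definition one_par :: "(real \<Rightarrow> 'n) \<Rightarrow> (real \<Rightarrow> 'g) \<Rightarrow> 'e \<Rightarrow> 'f \<Rightarrow> bool" where
  "one_par \<beta> \<alpha> w a \<longleftrightarrow> (\<forall>t. \<beta> t \<in> carrier N \<and> \<alpha> t \<in> carrier G) \<and>
    (\<forall>s t. \<alpha> (s + t) = \<alpha> s \<otimes>\<^bsub>G\<^esub> \<alpha> t) \<and> (\<forall>s t. \<beta> (s + t) = \<beta> s \<otimes>\<^bsub>N\<^esub> \<pi> (\<alpha> s) (\<beta> t)) \<and>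
    N.tang (at 0) \<beta> w \<and> G.tang (at 0) \<alpha> a"

text \<open>\<open>\<alpha>\<close> is the local solution with constant logarithmic derivative
  \<open>a\<close>, and \<open>\<beta>\<close> the one with logarithmic derivative
  \<open>A (\<alpha> t) w\<close>. Uniqueness gives the homomorphism and cocycle identities for
  small times, so the pair is a local homomorphism into \<open>H\<close> and extends.\<close>

lemma one_par_exists: "\<exists>\<beta> \<alpha>. one_par \<beta> \<alpha> w a"
proof -
  obtain \<tau>1 \<alpha> where \<tau>1: "\<tau>1 > 0" and \<alpha>0: "\<alpha> 0 = \<one>\<^bsub>G\<^esub>" and \<alpha>U: "\<And>t. \<alpha> t \<in> OG"
    and \<alpha>d: "\<And>t. \<bar>t\<bar> < \<tau>1 \<Longrightarrow> G.tang (at 0) (\<lambda>s. inv\<^bsub>G\<^esub> (\<alpha> t) \<otimes>\<^bsub>G\<^esub> \<alpha> (t + s)) a"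
    using G.log_derivative_exists[of "\<lambda>_. a"] by auto
  have \<alpha>c: "\<alpha> t \<in> carrier G" for t using G.U_carrier[OF \<alpha>U] .
  \<comment> \<open>As functions of \<open>s\<close>, both sides start at \<open>\<alpha> t\<close>
    and have logarithmic derivative \<open>a\<close>, which left translation does not
    change.\<close>
  have \<alpha>h: "\<alpha> (t + s) = \<alpha> t \<otimes>\<^bsub>G\<^esub> \<alpha> s" if t: "\<bar>t\<bar> < \<tau>1 / 2" and s: "\<bar>s\<bar> < \<tau>1 / 2" for t s
  proof (rule G.log_derivative_unique_sym[where X = "\<lambda>_. a" and K = "norm a" and t = s and \<tau> = "\<tau>1 / 2"])
    fix u assume u: "\<bar>u\<bar> < \<tau>1 / 2"
    have "\<bar>t + u\<bar> < \<tau>1" using t u by linarith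
    from \<alpha>d[OF this] show "G.tang (at 0) (\<lambda>h. inv\<^bsub>G\<^esub> (\<alpha> (t + u)) \<otimes>\<^bsub>G\<^esub> \<alpha> (t + (u + h))) a"
      by (simp add: add.assoc)
    have "inv\<^bsub>G\<^esub> (\<alpha> t \<otimes>\<^bsub>G\<^esub> \<alpha> u) \<otimes>\<^bsub>G\<^esub> (\<alpha> t \<otimes>\<^bsub>G\<^esub> \<alpha> (u + h)) = inv\<^bsub>G\<^esub> (\<alpha> u) \<otimes>\<^bsub>G\<^esub> \<alpha> (u + h)" for h
      using \<alpha>c by (simp add: G.inv_mult_group G.m_assoc) (simp flip: G.m_assoc)
    then show "G.tang (at 0) (\<lambda>h. inv\<^bsub>G\<^esub> (\<alpha> t \<otimes>\<^bsub>G\<^esub> \<alpha> u) \<otimes>\<^bsub>G\<^esub> (\<alpha> t \<otimes>\<^bsub>G\<^esub> \<alpha> (u + h))) a"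
      using \<alpha>d[of u] u \<tau>1 by simp
  qed (use \<alpha>0 \<alpha>c s in auto)
  \<comment> \<open>Continuity of \<open>\<alpha>\<close> is known for
    \<open>\<bar>t\<bar> < \<tau>1\<close> only, while \<open>log_derivative_exists\<close> asks for
    a curve \<open>X\<close> that is continuous on \<open>{-1..1}\<close>; freezing the time changes
    nothing near \<open>0\<close>.\<close>
  define cl where "cl t = max (- \<tau>1 / 4) (min (\<tau>1 / 4) t)" for t
  have cl: "\<bar>cl t\<bar> < \<tau>1" for t using \<tau>1 by (auto simp: cl_def)
  have clid: "cl t = t" if "\<bar>t\<bar> < \<tau>1 / 4" for t using that by (auto simp: cl_def)
  define X where "X t = A (\<alpha> (cl t)) w" for t
  have Xc: "continuous_on {-1..1} X"
  proof -
    have "continuous_on {t. \<bar>t\<bar> < \<tau>1} (\<lambda>t. A (\<alpha> t) w)"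
      unfolding continuous_on_def
      by (auto intro!: A_tendsto limitin_within G.tang_limitin_shift[OF \<alpha>d \<alpha>c])
    then have *: "continuous_on (range cl) (\<lambda>t. A (\<alpha> t) w)"
      by (rule continuous_on_subset) (use cl in auto)
    have "continuous_on UNIV ((\<lambda>t. A (\<alpha> t) w) \<circ> cl)"
      by (rule continuous_on_compose[OF _ *]) (unfold cl_def, intro continuous_intros)
    then show ?thesis by (rule_tac continuous_on_subset[of UNIV]) (auto simp: X_def[abs_def] o_def)
  qed
  then have "compact (X ` {-1..1})" by (intro compact_continuous_image) auto
  then obtain K where K: "\<And>t. t \<in> {-1..1} \<Longrightarrow> norm (X t) \<le> K"
    by (meson bounded_iff compact_imp_bounded imageI)
  obtain \<tau>2 \<beta> where \<tau>2: "\<tau>2 > 0" and \<beta>0: "\<beta> 0 = \<one>\<^bsub>N\<^esub>" and \<beta>U: "\<And>t. \<beta> t \<in> ON"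
    and \<beta>d: "\<And>t. \<bar>t\<bar> < \<tau>2 \<Longrightarrow> N.tang (at 0) (\<lambda>s. inv\<^bsub>N\<^esub> (\<beta> t) \<otimes>\<^bsub>N\<^esub> \<beta> (t + s)) (X t)"
    using N.log_derivative_exists[OF Xc] by auto
  have \<beta>c: "\<beta> t \<in> carrier N" for t using N.U_carrier[OF \<beta>U] .
  define \<tau> where "\<tau> = Min {\<tau>1 / 8, \<tau>2 / 2, 1 / 2}"
  have \<tau>: "\<tau> > 0" "\<tau> \<le> \<tau>1 / 8" "\<tau> \<le> \<tau>2 / 2" "\<tau> \<le> 1 / 2" using \<tau>1 \<tau>2 by (auto simp: \<tau>_def)
  have \<beta>h: "\<beta> (t + s) = \<beta> t \<otimes>\<^bsub>N\<^esub> \<pi> (\<alpha> t) (\<beta> s)" if t: "\<bar>t\<bar> < \<tau>" and s: "\<bar>s\<bar> < \<tau>" for t s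
  proof (rule N.log_derivative_unique_sym[where X = "\<lambda>s. X (t + s)" and K = K and t = s and \<tau> = \<tau>])
    fix u assume u: "\<bar>u\<bar> < \<tau>"
    have tu: "\<bar>t + u\<bar> < \<tau>2" "\<bar>t + u\<bar> < \<tau>1 / 4" "\<bar>t + u\<bar> < 1" using t u \<tau> by linarith+
    from \<beta>d[OF tu(1)] show "N.tang (at 0) (\<lambda>h. inv\<^bsub>N\<^esub> (\<beta> (t + u)) \<otimes>\<^bsub>N\<^esub> \<beta> (t + (u + h))) (X (t + u))"
      by (simp add: add.assoc)
    show "norm (X (t + u)) \<le> K" using tu(3) by (intro K) auto
    have "\<bar>u\<bar> < \<tau>2" "\<bar>u\<bar> < \<tau>1 / 4" "\<bar>u\<bar> < \<tau>1 / 2" "\<bar>t\<bar> < \<tau>1 / 2" using t u \<tau> \<tau>1 by linarith+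
    \<comment> \<open>The logarithmic derivative of \<open>u \<mapsto> \<beta> t \<otimes> \<pi>
      (\<alpha> t) (\<beta> u)\<close> is that of \<open>\<beta>\<close> transformed by
      \<open>A (\<alpha> t)\<close>. Multiplicativity of \<open>A\<close> shows that it agrees with
      the one of \<open>u \<mapsto> \<beta> (t + u)\<close>.\<close>
    then have X: "A (\<alpha> t) (X u) = X (t + u)"
      using \<alpha>h[of t u] A_mult[OF \<alpha>c \<alpha>c] clid tu by (simp add: X_def)
    have "inv\<^bsub>N\<^esub> (\<beta> t \<otimes>\<^bsub>N\<^esub> \<pi> (\<alpha> t) (\<beta> u)) \<otimes>\<^bsub>N\<^esub> (\<beta> t \<otimes>\<^bsub>N\<^esub> \<pi> (\<alpha> t) (\<beta> (u + h))) =
        \<pi> (\<alpha> t) (inv\<^bsub>N\<^esub> (\<beta> u) \<otimes>\<^bsub>N\<^esub> \<beta> (u + h))" for h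
      using \<alpha>c \<beta>c pi_closed
      by (simp add: pi_mult_N pi_inv_N N.inv_mult_group N.m_assoc) (simp flip: N.m_assoc)
    then show "N.tang (at 0) (\<lambda>h. inv\<^bsub>N\<^esub> (\<beta> t \<otimes>\<^bsub>N\<^esub> \<pi> (\<alpha> t) (\<beta> u)) \<otimes>\<^bsub>N\<^esub> (\<beta> t \<otimes>\<^bsub>N\<^esub> \<pi> (\<alpha> t) (\<beta> (u + h)))) (X (t + u))"
      using action_tang_const[OF \<beta>d[OF \<open>\<bar>u\<bar> < \<tau>2\<close>] order_refl \<alpha>c[of t]] X by simp
  qed (use \<beta>0 \<beta>c \<alpha>c pi_closed pi_one_N s in auto)
  define f where "f t = (\<beta> t, \<alpha> t)" for t
  have "\<exists>F. (\<forall>t. F t \<in> carrier H) \<and> (\<forall>s t. F (s + t) = F s \<otimes>\<^bsub>H\<^esub> F t) \<and> (\<forall>t. \<bar>t\<bar> \<le> \<tau> / 2 \<longrightarrow> F t = f t)"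
  proof (rule group.local_hom_extends[OF H_group])
    fix s t assume "\<bar>s\<bar> \<le> \<tau> / 2" "\<bar>t\<bar> \<le> \<tau> / 2"
    then have "\<bar>s\<bar> < \<tau>" "\<bar>t\<bar> < \<tau>" "\<bar>s\<bar> < \<tau>1 / 2" "\<bar>t\<bar> < \<tau>1 / 2" using \<tau> \<tau>1 by linarith+
    then show "f (s + t) = f s \<otimes>\<^bsub>H\<^esub> f t" using \<alpha>h \<beta>h by (simp add: f_def H_simps)
  qed (use \<tau> \<alpha>c \<beta>c in \<open>auto simp: f_def H_simps\<close>)
  then obtain F where F: "\<And>t. F t \<in> carrier H" "\<And>s t. F (s + t) = F s \<otimes>\<^bsub>H\<^esub> F t"
    "\<And>t. \<bar>t\<bar> \<le> \<tau> / 2 \<Longrightarrow> F t = f t" by blast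
  have ev: "\<forall>\<^sub>F t in at 0. F t = f t"
    using eventually_abs_less[OF order_refl, of "\<tau> / 2"] \<tau> by (auto elim!: eventually_mono intro!: F(3))
  have "one_par (\<lambda>t. fst (F t)) (\<lambda>t. snd (F t)) w a"
    unfolding one_par_def
  proof (intro conjI allI)
    fix s t
    show "fst (F t) \<in> carrier N" "snd (F t) \<in> carrier G" using F(1)[of t] by (auto simp: H_simps)
    show "snd (F (s + t)) = snd (F s) \<otimes>\<^bsub>G\<^esub> snd (F t)"
      "fst (F (s + t)) = fst (F s) \<otimes>\<^bsub>N\<^esub> \<pi> (snd (F s)) (fst (F t))"
      unfolding F(2) by (cases "F s"; cases "F t"; simp add: H_simps)+
  next
    have "N.tang (at 0) \<beta> w"
      using \<beta>d[of 0] \<tau>2 \<tau>1 \<beta>0 \<beta>c by (simp add: X_def clid \<alpha>0 A_one)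
    then show "N.tang (at 0) (\<lambda>t. fst (F t)) w"
      by (rule N.tang_cong) (use ev in \<open>auto elim: eventually_mono simp: f_def\<close>)
    have "G.tang (at 0) \<alpha> a"
      using \<alpha>d[of 0] \<tau>1 \<alpha>0 \<alpha>c by simp
    then show "G.tang (at 0) (\<lambda>t. snd (F t)) a"
      by (rule G.tang_cong) (use ev in \<open>auto elim: eventually_mono simp: f_def\<close>)
  qed
  then show ?thesis by blast
qed

lemma one_par_facts:
  assumes "one_par \<beta> \<alpha> w a"
  shows one_par_carrier: "\<beta> t \<in> carrier N" "\<alpha> t \<in> carrier G"
    and one_par_add: "\<alpha> (s + t) = \<alpha> s \<otimes>\<^bsub>G\<^esub> \<alpha> t" "\<beta> (s + t) = \<beta> s \<otimes>\<^bsub>N\<^esub> \<pi> (\<alpha> s) (\<beta> t)"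
    and one_par_zero: "\<alpha> 0 = \<one>\<^bsub>G\<^esub>" "\<beta> 0 = \<one>\<^bsub>N\<^esub>"
    and one_par_tang: "N.tang (at 0) \<beta> w" "G.tang (at 0) \<alpha> a"
    and one_par_log: "G.tang (at 0) (\<lambda>s. inv\<^bsub>G\<^esub> (\<alpha> t) \<otimes>\<^bsub>G\<^esub> \<alpha> (t + s)) a"
      "N.tang (at 0) (\<lambda>s. inv\<^bsub>N\<^esub> (\<beta> t) \<otimes>\<^bsub>N\<^esub> \<beta> (t + s)) (A (\<alpha> t) w)"
    and one_par_lim: "limitin TG \<alpha> (\<alpha> t) (at t)" "limitin TN \<beta> (\<beta> t) (at t)"
proof -
  show c: "\<beta> t \<in> carrier N" "\<alpha> t \<in> carrier G" for t using assms by (auto simp: one_par_def)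
  show add: "\<alpha> (s + t) = \<alpha> s \<otimes>\<^bsub>G\<^esub> \<alpha> t" "\<beta> (s + t) = \<beta> s \<otimes>\<^bsub>N\<^esub> \<pi> (\<alpha> s) (\<beta> t)" for s t
    using assms unfolding one_par_def by blast+
  show z: "\<alpha> 0 = \<one>\<^bsub>G\<^esub>" using add(1)[of 0 0] c[of 0] by simp
  then show "\<beta> 0 = \<one>\<^bsub>N\<^esub>" using add(2)[of 0 0] c[of 0] by (simp add: pi_one)
  show t: "N.tang (at 0) \<beta> w" "G.tang (at 0) \<alpha> a" using assms by (auto simp: one_par_def)
  have d: "inv\<^bsub>G\<^esub> (\<alpha> t) \<otimes>\<^bsub>G\<^esub> \<alpha> (t + s) = \<alpha> s" "inv\<^bsub>N\<^esub> (\<beta> t) \<otimes>\<^bsub>N\<^esub> \<beta> (t + s) = \<pi> (\<alpha> t) (\<beta> s)" for s t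
    using c pi_closed by (simp_all add: add flip: G.m_assoc N.m_assoc)
  show l: "G.tang (at 0) (\<lambda>s. inv\<^bsub>G\<^esub> (\<alpha> t) \<otimes>\<^bsub>G\<^esub> \<alpha> (t + s)) a"
    "N.tang (at 0) (\<lambda>s. inv\<^bsub>N\<^esub> (\<beta> t) \<otimes>\<^bsub>N\<^esub> \<beta> (t + s)) (A (\<alpha> t) w)"
    unfolding d by (rule t(2), rule action_tang_const[OF t(1) order_refl c(2)])
  show "limitin TG \<alpha> (\<alpha> t) (at t)" "limitin TN \<beta> (\<beta> t) (at t)"
    by (rule G.tang_limitin_shift[OF l(1) c(2)], rule N.tang_limitin_shift[OF l(2) c(1)])
qed

lemma one_par_A_continuous:
  assumes "one_par \<beta> \<alpha> w a"
  shows "continuous_on UNIV (\<lambda>t. A (\<alpha> t) w)"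
  unfolding continuous_on_def using A_tendsto[OF one_par_lim(1)[OF assms]] by simp

text \<open>The tangency hypotheses are the components of the left quotient in \<open>H\<close>,
  where the \<open>N\<close>-part carries the twist \<open>\<pi> (inv (\<alpha>' t))\<close>.
  Uniqueness in \<open>G\<close> comes first; with \<open>\<alpha>' = \<alpha>\<close> the twist can
  be undone by \<open>\<pi> (\<alpha> t)\<close>, which changes \<open>w\<close> to
  \<open>A (\<alpha> t) w\<close> and leaves a uniqueness question in \<open>N\<close>.\<close>

lemma one_par_unique:
  assumes op: "one_par \<beta> \<alpha> w a"
    and lim: "\<And>t. t \<in> {0..b} \<Longrightarrow> limitin TN \<beta>' (\<beta>' t) (at t within {0..b})"
      "\<And>t. t \<in> {0..b} \<Longrightarrow> limitin TG \<alpha>' (\<alpha>' t) (at t within {0..b})"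
    and init: "\<beta>' 0 = \<one>\<^bsub>N\<^esub>" "\<alpha>' 0 = \<one>\<^bsub>G\<^esub>"
    and tan: "\<And>t. 0 \<le> t \<Longrightarrow> t < b \<Longrightarrow> G.tang (at_right 0) (\<lambda>s. inv\<^bsub>G\<^esub> (\<alpha>' t) \<otimes>\<^bsub>G\<^esub> \<alpha>' (t + s)) a"
      "\<And>t. 0 \<le> t \<Longrightarrow> t < b \<Longrightarrow>
        N.tang (at_right 0) (\<lambda>s. \<pi> (inv\<^bsub>G\<^esub> (\<alpha>' t)) (inv\<^bsub>N\<^esub> (\<beta>' t) \<otimes>\<^bsub>N\<^esub> \<beta>' (t + s))) w"
    and t: "t \<in> {0..b}"
  shows "\<alpha>' t = \<alpha> t" "\<beta>' t = \<beta> t"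
proof -
  have F: "at_right 0 \<le> at (0::real)" by (rule at_le) simp
  have \<alpha>: "\<alpha>' t = \<alpha> t" if t: "t \<in> {0..b}" for t
  proof (rule G.log_derivative_unique[where X = "\<lambda>_. a" and K = "norm a", OF lim(2) _ _ _ _ _ t])
    show "limitin TG \<alpha> (\<alpha> t) (at t within {0..b})" for t
      by (rule limitin_within[OF one_par_lim(1)[OF op]])
    show "G.tang (at_right 0) (\<lambda>s. inv\<^bsub>G\<^esub> (\<alpha> t) \<otimes>\<^bsub>G\<^esub> \<alpha> (t + s)) a" for t
      by (rule G.tang_mono[OF one_par_log(1)[OF op] F])
  qed (use init one_par_zero[OF op] tan in auto)
  show "\<alpha>' t = \<alpha> t" by (rule \<alpha>[OF t])
  have "compact ((\<lambda>t. A (\<alpha> t) w) ` {0..b})"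
    by (intro compact_continuous_image continuous_on_subset[OF one_par_A_continuous[OF op]]) auto
  then obtain K where K: "\<And>t. t \<in> {0..b} \<Longrightarrow> norm (A (\<alpha> t) w) \<le> K"
    by (meson bounded_iff compact_imp_bounded imageI)
  show "\<beta>' t = \<beta> t"
  proof (rule N.log_derivative_unique[where X = "\<lambda>t. A (\<alpha> t) w" and K = K, OF lim(1) _ _ _ _ _ t])
    show "limitin TN \<beta> (\<beta> t) (at t within {0..b})" for t
      by (rule limitin_within[OF one_par_lim(2)[OF op]])
    show "N.tang (at_right 0) (\<lambda>s. inv\<^bsub>N\<^esub> (\<beta> t) \<otimes>\<^bsub>N\<^esub> \<beta> (t + s)) (A (\<alpha> t) w)" for t
      by (rule N.tang_mono[OF one_par_log(2)[OF op] F])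
    fix t assume t: "0 \<le> t" "t < b"
    note c = one_par_carrier(2)[OF op, of t]
    have N: "\<beta>' s \<in> carrier N" if "s \<in> {0..b}" for s
      using limitin_topspace[OF lim(1)[OF that]] by (simp add: N.topsp)
    have "\<forall>\<^sub>F s in at_right 0. s < b - t \<and> s > 0"
      unfolding eventually_at_right_field using t by (intro exI[of _ "b - t"]) auto
    then have "\<forall>\<^sub>F s in at_right 0. \<pi> (\<alpha> t) (\<pi> (inv\<^bsub>G\<^esub> (\<alpha>' t)) (inv\<^bsub>N\<^esub> (\<beta>' t) \<otimes>\<^bsub>N\<^esub> \<beta>' (t + s))) =
        inv\<^bsub>N\<^esub> (\<beta>' t) \<otimes>\<^bsub>N\<^esub> \<beta>' (t + s)"
    proof eventually_elim
      case (elim s)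
      then have "inv\<^bsub>N\<^esub> (\<beta>' t) \<otimes>\<^bsub>N\<^esub> \<beta>' (t + s) \<in> carrier N" using N[of t] N[of "t + s"] t by simp
      then show ?case using t c by (simp add: \<alpha> pi_one flip: pi_mult)
    qed
    from N.tang_cong[OF action_tang_const[OF tan(2)[OF t] F c] this]
    show "N.tang (at_right 0) (\<lambda>s. inv\<^bsub>N\<^esub> (\<beta>' t) \<otimes>\<^bsub>N\<^esub> \<beta>' (t + s)) (A (\<alpha> t) w)" .
    show "norm (A (\<alpha> t) w) \<le> K" using K t by simp
  qed (use init one_par_zero[OF op] in auto)
qed

text \<open>\<open>action_bound\<close> is used near the identity only and iterated:
  \<open>\<alpha> t\<close> is the \<open>m\<close>-th power of \<open>\<alpha> (t / m)\<close>,
  which lies in the good neighbourhood for one fixed \<open>m\<close> and all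
  \<open>\<bar>t\<bar> \<le> T\<close>.\<close>

lemma one_par_action_bound:
  assumes op: "one_par \<beta> \<alpha> w a" and T: "T \<ge> 0"
  shows "\<exists>K \<delta>. K > 0 \<and> \<delta> > 0 \<and> \<delta> \<le> rN \<and> (\<forall>t. \<bar>t\<bar> \<le> T \<longrightarrow>
    (\<forall>x\<in>N.nb \<delta>. \<pi> (\<alpha> t) x \<in> N.nb rN \<and> norm (LN (\<pi> (\<alpha> t) x)) \<le> K * norm (LN x)))"
proof -
  note c = one_par_carrier[OF op]
  obtain V K0 \<delta>0 where V: "openin TG V" "\<one>\<^bsub>G\<^esub> \<in> V" and K0: "K0 > 0" and \<delta>0: "\<delta>0 > 0" "\<delta>0 \<le> rN"
    and bd0: "\<And>g x. g \<in> V \<Longrightarrow> x \<in> N.nb \<delta>0 \<Longrightarrow> \<pi> g x \<in> N.nb rN \<and> norm (LN (\<pi> g x)) \<le> K0 * norm (LN x)"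
    using action_bound[OF G.one_closed] by metis
  define K where "K = max K0 1"
  have K: "K \<ge> 1" by (simp add: K_def)
  have bd: "\<pi> g x \<in> N.nb rN \<and> norm (LN (\<pi> g x)) \<le> K * norm (LN x)" if "g \<in> V" "x \<in> N.nb \<delta>0" for g x
    using bd0[OF that] mult_right_mono[of K0 K "norm (LN x)"] by (auto simp: K_def)
  have "\<forall>\<^sub>F s in at 0. \<alpha> s \<in> V"
    using limitinD[OF one_par_lim(1)[OF op, of 0]] V one_par_zero[OF op] by auto
  then obtain \<sigma> where \<sigma>: "\<sigma> > 0" "\<And>s. s \<noteq> 0 \<Longrightarrow> \<bar>s\<bar> < \<sigma> \<Longrightarrow> \<alpha> s \<in> V"
    unfolding eventually_at by auto
  have \<alpha>V: "\<alpha> s \<in> V" if "\<bar>s\<bar> < \<sigma>" for s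
    using \<sigma>(2)[of s] that V one_par_zero[OF op] by (cases "s = 0") auto
  obtain m :: nat where m: "T / \<sigma> < real m" using reals_Archimedean2 by blast
  have "0 \<le> T / \<sigma>" using T \<sigma> by simp
  with m have mp: "real m > 0" by linarith
  have Tm: "T < real m * \<sigma>" using m \<sigma> by (simp add: field_simps)
  \<comment> \<open>Each of the \<open>m\<close> applications may enlarge the norm by the factor
    \<open>K \<ge> 1\<close>; with this radius all intermediate points stay in the
    \<open>\<delta>0\<close>-ball.\<close>
  define \<delta> where "\<delta> = \<delta>0 / K ^ m"
  have \<delta>: "\<delta> > 0" "\<delta> \<le> \<delta>0" using \<delta>0 K one_le_power[OF K, of m] by (auto simp: \<delta>_def divide_le_eq)
  have "\<pi> (\<alpha> t) x \<in> N.nb rN \<and> norm (LN (\<pi> (\<alpha> t) x)) \<le> K ^ m * norm (LN x)"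
    if t: "\<bar>t\<bar> \<le> T" and x: "x \<in> N.nb \<delta>" for t x
  proof -
    define u where "u = t / real m"
    have "\<bar>t\<bar> < real m * \<sigma>" using t Tm by linarith
    then have u: "\<alpha> u \<in> V" using mp by (intro \<alpha>V) (simp add: u_def field_simps)
    have "j \<le> m \<Longrightarrow> \<pi> (\<alpha> (real j * u)) x \<in> N.nb rN \<and>
        norm (LN (\<pi> (\<alpha> (real j * u)) x)) \<le> K ^ j * norm (LN x)" for j
    proof (induction j)
      case 0
      then show ?case
        using N.nb_mono[OF x, of rN] \<delta> \<delta>0 one_par_zero[OF op] pi_one[OF N.nb_carrier[OF x]] by simp
    next
      case (Suc j)
      define y where "y = \<pi> (\<alpha> (real j * u)) x"
      have y: "y \<in> N.nb rN" "norm (LN y) \<le> K ^ j * norm (LN x)" using Suc by (auto simp: y_def)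
      have "K ^ j * norm (LN x) \<le> K ^ m * norm (LN x)"
        using Suc.prems K by (intro mult_right_mono power_increasing) auto
      also have "\<dots> < K ^ m * \<delta>" using N.nb_norm[OF x] K by (intro mult_strict_left_mono) auto
      also have "\<dots> = \<delta>0" using K by (simp add: \<delta>_def)
      finally have "y \<in> N.nb \<delta>0" using y by (auto intro: N.nbI N.nb_U)
      from bd[OF u this] have "\<pi> (\<alpha> u) y \<in> N.nb rN" "norm (LN (\<pi> (\<alpha> u) y)) \<le> K * norm (LN y)" by auto
      moreover have "K * norm (LN y) \<le> K * (K ^ j * norm (LN x))" using y K by (intro mult_left_mono) auto
      moreover have "\<pi> (\<alpha> u) y = \<pi> (\<alpha> (real (Suc j) * u)) x"
        using c N.nb_carrier[OF x] one_par_add(1)[OF op, of u "real j * u"]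
        by (simp add: y_def pi_mult algebra_simps)
      ultimately show ?case by simp
    qed
    from this[of m] show ?thesis using mp by (simp add: u_def)
  qed
  then show ?thesis
    by (intro exI[of _ "K ^ m"] exI[of _ \<delta>]) (use K \<delta> \<delta>0 in auto)
qed

subsection \<open>The Trotter limit\<close>

text \<open>Comparison of the products with constant factors \<open>c s\<close> and
  \<open>\<alpha> s\<close>, whose quotient is \<open>o(s)\<close> because both curves have velocity
  \<open>a\<close>. All intermediate powers are included, as they occur as arguments of
  \<open>\<pi>\<close> in the fibre.\<close>

lemma trotter_base:
  assumes op: "one_par \<beta> \<alpha> w a" and c: "\<And>s. c s \<in> carrier G" "c 0 = \<one>\<^bsub>G\<^esub>" "G.tang (at 0) c a"
    and T: "T \<ge> 0" and d: "d > 0"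
  shows "\<forall>\<^sub>F n in sequentially. \<forall>t. \<bar>t\<bar> \<le> T \<longrightarrow> (\<forall>k\<le>n.
    inv\<^bsub>G\<^esub> (\<alpha> (real k * (t / real n))) \<otimes>\<^bsub>G\<^esub> c (t / real n) [^]\<^bsub>G\<^esub> k \<in> G.nb d)"
proof -
  note r = G.radii
  define \<kappa> where "\<kappa> = (norm a + 1) * T"
  have \<kappa>: "\<kappa> \<ge> 0" using T by (simp add: \<kappa>_def)
  define d' where "d' = min d rG"
  have d': "d' > 0" "d' \<le> d" "d' \<le> rG" using d r by (auto simp: d'_def)
  define X where "X = exp (4 * CG * \<kappa>)"
  have X: "X > 0" by (simp add: X_def)
  define T1 where "T1 = T + 1"
  have T1: "T1 > 0" "T \<le> T1" using T by (auto simp: T1_def)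
  \<comment> \<open>Chosen so that the accumulated error \<open>2 * (\<epsilon> * T) * X\<close> is
    at most \<open>d' / 2\<close>; \<open>T1\<close> replaces \<open>T\<close> in the denominator
    because \<open>T\<close> may be \<open>0\<close>.\<close>
  define \<epsilon> where "\<epsilon> = d' / (4 * T1 * X)"
  have \<epsilon>: "\<epsilon> > 0" using d' T1 X by (simp add: \<epsilon>_def)
  have "\<epsilon> * T \<le> \<epsilon> * T1" using \<epsilon> T1 by (intro mult_left_mono) auto
  also have "\<dots> = d' / (4 * X)" using T1 X by (simp add: \<epsilon>_def field_simps)
  finally have "2 * (\<epsilon> * T) * X \<le> 2 * (d' / (4 * X)) * X" using X by (intro mult_right_mono mult_left_mono) auto
  also have "\<dots> < d'" using d' X by simp
  finally have small: "2 * (\<epsilon> * T) * exp (4 * CG * \<kappa>) < d'" by (simp add: X_def)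
  note ta = one_par_tang(2)[OF op]
  have "\<forall>\<^sub>F s in at 0. \<alpha> s \<in> G.nb rG \<and> norm (LG (\<alpha> s)) \<le> (norm a + 1) * \<bar>s\<bar> \<and>
      inv\<^bsub>G\<^esub> (\<alpha> s) \<otimes>\<^bsub>G\<^esub> c s \<in> G.nb rG \<and> norm (LG (inv\<^bsub>G\<^esub> (\<alpha> s) \<otimes>\<^bsub>G\<^esub> c s)) \<le> \<epsilon> * \<bar>s\<bar>"
    using G.tang_nb[OF ta order_refl r(1)] G.tang_bound[OF ta order_refl] G.tang_div_small[OF ta c(3) order_refl \<epsilon>]
    by eventually_elim auto
  from eventually_div_small[OF this, of T]
  have "\<forall>\<^sub>F n in sequentially. \<forall>t. \<bar>t\<bar> \<le> T \<longrightarrow> (\<alpha> (t / real n) \<in> G.nb rG \<and>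
      norm (LG (\<alpha> (t / real n))) \<le> (norm a + 1) * \<bar>t / real n\<bar> \<and>
      inv\<^bsub>G\<^esub> (\<alpha> (t / real n)) \<otimes>\<^bsub>G\<^esub> c (t / real n) \<in> G.nb rG \<and>
      norm (LG (inv\<^bsub>G\<^esub> (\<alpha> (t / real n)) \<otimes>\<^bsub>G\<^esub> c (t / real n))) \<le> \<epsilon> * \<bar>t / real n\<bar>)"
    using one_par_zero[OF op] c r G.one_nb G.L_one by auto
  then show ?thesis
  proof eventually_elim
    case (elim n)
    show ?case
    proof (intro allI impI)
      fix t k assume t: "\<bar>t\<bar> \<le> T" and k: "k \<le> n"
      define s where "s = t / real n"
      note E = elim[rule_format, OF t, folded s_def]
      have sT: "\<bar>s\<bar> \<le> T / real n" using t by (simp add: s_def divide_right_mono)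
      have "inv\<^bsub>G\<^esub> (\<alpha> (real k * s)) \<otimes>\<^bsub>G\<^esub> c s [^]\<^bsub>G\<^esub> k \<in> G.nb d'"
      proof (rule G.product_comparison[where u = "\<lambda>_. c s" and v = "\<lambda>_. \<alpha> s" and n = n, OF _ _ _ _ _ _ _ _ _ small d'(3) \<kappa> _ k])
        show "\<alpha> (real (Suc k) * s) = \<alpha> (real k * s) \<otimes>\<^bsub>G\<^esub> \<alpha> s" for k
          using one_par_add(1)[OF op, of "real k * s" s] by (simp add: algebra_simps)
        have "(norm a + 1) * \<bar>s\<bar> \<le> (norm a + 1) * (T / real n)" using sT by (intro mult_left_mono) auto
        then show "norm (LG (\<alpha> s)) \<le> \<kappa> / real n" using E by (simp add: \<kappa>_def)
        have "\<epsilon> * \<bar>s\<bar> \<le> \<epsilon> * (T / real n)" using sT \<epsilon> by (intro mult_left_mono) auto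
        then show "norm (LG (inv\<^bsub>G\<^esub> (\<alpha> s) \<otimes>\<^bsub>G\<^esub> c s)) \<le> \<epsilon> * T / real n" using E by simp
      qed (use one_par_zero[OF op] c E \<epsilon> T in auto)
      then show "inv\<^bsub>G\<^esub> (\<alpha> (real k * (t / real n))) \<otimes>\<^bsub>G\<^esub> c (t / real n) [^]\<^bsub>G\<^esub> k \<in> G.nb d"
        using G.nb_mono d' by (simp add: s_def)
    qed
  qed
qed

text \<open>The factors are \<open>u k = \<pi> (c(s)\<^sup>k) (b s)\<close> and
  \<open>v k = \<pi> (\<alpha> (ks)) (\<beta> s)\<close>. With \<open>\<gamma>\<close> the quotient
  of \<open>c(s)\<^sup>k\<close> by \<open>\<alpha> (ks)\<close>, the error
  \<open>inv (v k) \<otimes> u k\<close> is \<open>\<pi> (\<alpha> (ks))\<close> applied to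
  \<open>inv (\<beta> s) \<otimes> \<pi> \<gamma> (b s)\<close>. By \<open>trotter_base\<close>
  \<open>\<gamma>\<close> is near the identity, so the inner quotient is \<open>o(s)\<close>
  uniformly in \<open>k\<close>, and the outer map is Lipschitz uniformly in
  \<open>k\<close>.\<close>

lemma trotter_fibre:
  assumes op: "one_par \<beta> \<alpha> w a" and c: "\<And>s. c s \<in> carrier G" "c 0 = \<one>\<^bsub>G\<^esub>" "G.tang (at 0) c a"
    and b: "\<And>s. b s \<in> carrier N" "b 0 = \<one>\<^bsub>N\<^esub>" "N.tang (at 0) b w"
    and P: "\<And>s. P s 0 = \<one>\<^bsub>N\<^esub>" "\<And>s k. P s (Suc k) = P s k \<otimes>\<^bsub>N\<^esub> \<pi> (c s [^]\<^bsub>G\<^esub> k) (b s)"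
    and T: "T \<ge> 0" and d: "d > 0"
  shows "\<forall>\<^sub>F n in sequentially. \<forall>t. \<bar>t\<bar> \<le> T \<longrightarrow> inv\<^bsub>N\<^esub> (\<beta> t) \<otimes>\<^bsub>N\<^esub> P (t / real n) n \<in> N.nb d"
proof -
  note r = N.radii
  obtain K \<delta> where K: "K > 0" and \<delta>: "\<delta> > 0" "\<delta> \<le> rN"
    and bd: "\<And>t x. \<bar>t\<bar> \<le> T \<Longrightarrow> x \<in> N.nb \<delta> \<Longrightarrow> \<pi> (\<alpha> t) x \<in> N.nb rN \<and> norm (LN (\<pi> (\<alpha> t) x)) \<le> K * norm (LN x)"
    using one_par_action_bound[OF op T] by metis
  define \<kappa> where "\<kappa> = K * (norm w + 1) * T"
  have \<kappa>: "\<kappa> \<ge> 0" using T K by (simp add: \<kappa>_def)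
  define d' where "d' = min d rN"
  have d': "d' > 0" "d' \<le> d" "d' \<le> rN" using d r by (auto simp: d'_def)
  define X where "X = exp (4 * CN * \<kappa>)"
  have X: "X > 0" by (simp add: X_def)
  define T1 where "T1 = T + 1"
  have T1: "T1 > 0" "T \<le> T1" using T by (auto simp: T1_def)
  \<comment> \<open>Two tangency errors \<open>\<epsilon> * \<bar>s\<bar>\<close>, doubled by the
    quotient estimate and multiplied by \<open>K\<close>, give
    \<open>K * (4 * \<epsilon>) * \<bar>s\<bar>\<close> per factor; the remaining factor
    \<open>4\<close> makes the accumulated error at most \<open>d' / 2\<close>.\<close>
  define \<epsilon> where "\<epsilon> = d' / (16 * T1 * K * X)"
  have \<epsilon>: "\<epsilon> > 0" using d' T1 X K by (simp add: \<epsilon>_def)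
  define e where "e = K * (4 * \<epsilon>) * T"
  have e: "e \<ge> 0" using K \<epsilon> T by (simp add: e_def)
  have "e \<le> K * (4 * \<epsilon>) * T1" unfolding e_def using \<epsilon> K T1 by (intro mult_left_mono) auto
  also have "\<dots> = d' / (4 * X)" using T1 X K by (simp add: \<epsilon>_def field_simps)
  finally have "2 * e * X \<le> 2 * (d' / (4 * X)) * X" using X by (intro mult_right_mono mult_left_mono) auto
  also have "\<dots> < d'" using d' X by simp
  finally have small: "2 * e * exp (4 * CN * \<kappa>) < d'" by (simp add: X_def)
  obtain V where V: "openin TG V" "\<one>\<^bsub>G\<^esub> \<in> V" and
    ev: "\<forall>\<^sub>F s in at 0. \<forall>g\<in>V. \<pi> g (b s) \<in> N.nb rN \<and> norm (LN (\<pi> g (b s)) - s *\<^sub>R w) \<le> \<epsilon> * \<bar>s\<bar>"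
    using action_tang_uniform[OF b(3) order_refl G.one_closed \<epsilon>] unfolding A_one by blast
  obtain dG where dG: "dG > 0" "G.nb dG \<subseteq> V" using G.nhd_nb[OF V] by blast
  note tb = one_par_tang(1)[OF op]
  \<comment> \<open>For \<open>\<bar>s\<bar>\<close> below this bound the inner quotient, of norm at
    most \<open>4 * \<epsilon> * \<bar>s\<bar>\<close>, lies in the \<open>\<delta>\<close>-ball
    where the Lipschitz bound for \<open>\<pi> (\<alpha> (ks))\<close> holds.\<close>
  have \<delta>\<epsilon>: "\<delta> / (4 * \<epsilon> + 1) > 0" using \<delta> \<epsilon> by simp
  have "\<forall>\<^sub>F s in at 0. (\<forall>g\<in>V. \<pi> g (b s) \<in> N.nb rN \<and> norm (LN (\<pi> g (b s)) - s *\<^sub>R w) \<le> \<epsilon> * \<bar>s\<bar>) \<and>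
      \<beta> s \<in> N.nb \<delta> \<and> norm (LN (\<beta> s)) \<le> (norm w + 1) * \<bar>s\<bar> \<and> norm (LN (\<beta> s) - s *\<^sub>R w) \<le> \<epsilon> * \<bar>s\<bar> \<and>
      \<bar>s\<bar> < \<delta> / (4 * \<epsilon> + 1)"
    using ev N.tang_nb[OF tb order_refl \<delta>(1)] N.tang_bound[OF tb order_refl] N.tangD[OF tb \<epsilon>]
      eventually_abs_less[OF order_refl \<delta>\<epsilon>]
    by eventually_elim auto
  from eventually_div_small[OF this, of T]
  have ev2: "\<forall>\<^sub>F n in sequentially. \<forall>t. \<bar>t\<bar> \<le> T \<longrightarrow> ((\<forall>g\<in>V. \<pi> g (b (t / real n)) \<in> N.nb rN \<and>
        norm (LN (\<pi> g (b (t / real n))) - (t / real n) *\<^sub>R w) \<le> \<epsilon> * \<bar>t / real n\<bar>) \<and>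
      \<beta> (t / real n) \<in> N.nb \<delta> \<and> norm (LN (\<beta> (t / real n))) \<le> (norm w + 1) * \<bar>t / real n\<bar> \<and>
      norm (LN (\<beta> (t / real n)) - (t / real n) *\<^sub>R w) \<le> \<epsilon> * \<bar>t / real n\<bar> \<and> \<bar>t / real n\<bar> < \<delta> / (4 * \<epsilon> + 1))"
    using one_par_zero[OF op] b r \<delta> \<delta>\<epsilon> N.one_nb N.L_one pi_one_N openin_carrier_G[OF V(1)] by auto
  show ?thesis
    using ev2 trotter_base[OF op c T dG(1)] eventually_gt_at_top[of 0]
  proof eventually_elim
    case (elim n)
    show ?case
    proof (intro allI impI)
      fix t assume t: "\<bar>t\<bar> \<le> T"
      define s where "s = t / real n"
      note E = elim(1)[rule_format, OF t, folded s_def]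
      have Ec: "inv\<^bsub>G\<^esub> (\<alpha> (real k * s)) \<otimes>\<^bsub>G\<^esub> c s [^]\<^bsub>G\<^esub> k \<in> V" if "k \<le> n" for k
        using elim(2) t that dG(2) unfolding s_def by blast
      have sT: "\<bar>s\<bar> \<le> T / real n" using t by (simp add: s_def divide_right_mono)
      have ks: "\<bar>real k * s\<bar> \<le> T" if "k \<le> n" for k
      proof -
        have "\<bar>real k * s\<bar> \<le> real n * (T / real n)"
          unfolding abs_mult using that sT by (intro mult_mono) auto
        then show ?thesis using elim(3) by simp
      qed
      note oc = one_par_carrier[OF op]
      have \<beta>\<delta>: "\<beta> s \<in> N.nb \<delta>" using E by blast
      define v where "v k = \<pi> (\<alpha> (real k * s)) (\<beta> s)" for k
      define u where "u k = \<pi> (c s [^]\<^bsub>G\<^esub> k) (b s)" for k :: nat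
      have vu: "v k \<in> N.nb rN \<and> norm (LN (v k)) \<le> \<kappa> / real n \<and> inv\<^bsub>N\<^esub> (v k) \<otimes>\<^bsub>N\<^esub> u k \<in> N.nb rN \<and>
          norm (LN (inv\<^bsub>N\<^esub> (v k) \<otimes>\<^bsub>N\<^esub> u k)) \<le> e / real n" if k: "k < n" for k
      proof -
        have kn: "k \<le> n" using k by simp
        define \<gamma> where "\<gamma> = inv\<^bsub>G\<^esub> (\<alpha> (real k * s)) \<otimes>\<^bsub>G\<^esub> c s [^]\<^bsub>G\<^esub> k"
        have \<gamma>: "\<gamma> \<in> V" using Ec[OF kn] by (simp add: \<gamma>_def)
        have \<gamma>c: "\<gamma> \<in> carrier G" using openin_carrier_G[OF V(1) \<gamma>] .
        have v: "v k \<in> N.nb rN" "norm (LN (v k)) \<le> K * norm (LN (\<beta> s))"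
          using bd[OF ks[OF kn] \<beta>\<delta>] by (auto simp: v_def)
        have "K * norm (LN (\<beta> s)) \<le> K * ((norm w + 1) * (T / real n))"
          using E K sT by (intro mult_left_mono order_trans[OF _ mult_left_mono[OF sT]]) auto
        with v have v2: "norm (LN (v k)) \<le> \<kappa> / real n" by (simp add: \<kappa>_def mult_ac)
        define z where "z = inv\<^bsub>N\<^esub> (\<beta> s) \<otimes>\<^bsub>N\<^esub> \<pi> \<gamma> (b s)"
        have \<gamma>b: "\<pi> \<gamma> (b s) \<in> N.nb rN" "norm (LN (\<pi> \<gamma> (b s)) - s *\<^sub>R w) \<le> \<epsilon> * \<bar>s\<bar>" using E \<gamma> by auto
        note dz = N.nb_div_est[OF N.nb_mono[OF \<beta>\<delta> \<delta>(2)] \<gamma>b(1), folded z_def]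
        have "norm (LN (\<pi> \<gamma> (b s)) - LN (\<beta> s)) \<le> \<epsilon> * \<bar>s\<bar> + \<epsilon> * \<bar>s\<bar>"
          using norm_triangle_ineq4[of "LN (\<pi> \<gamma> (b s)) - s *\<^sub>R w" "LN (\<beta> s) - s *\<^sub>R w"] \<gamma>b E by simp
        with dz have zn: "norm (LN z) \<le> 4 * \<epsilon> * \<bar>s\<bar>" by simp
        have "(4 * \<epsilon> + 1) * \<bar>s\<bar> < \<delta>" using E \<epsilon> by (simp add: field_simps)
        then have "4 * \<epsilon> * \<bar>s\<bar> < \<delta>" by (simp add: distrib_right)
        with zn dz have z: "z \<in> N.nb \<delta>" by (auto intro: N.nbI N.nb_U)
        have "\<alpha> (real k * s) \<otimes>\<^bsub>G\<^esub> \<gamma> = c s [^]\<^bsub>G\<^esub> k"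
          using oc c(1) by (simp add: \<gamma>_def flip: G.m_assoc)
        then have "u k = \<pi> (\<alpha> (real k * s)) (\<pi> \<gamma> (b s))"
          using oc \<gamma>c b(1) by (simp add: u_def flip: pi_mult)
        then have eq: "inv\<^bsub>N\<^esub> (v k) \<otimes>\<^bsub>N\<^esub> u k = \<pi> (\<alpha> (real k * s)) z"
          using oc \<gamma>c b(1) pi_closed by (simp add: v_def z_def pi_mult_N pi_inv_N)
        have "norm (LN (\<pi> (\<alpha> (real k * s)) z)) \<le> K * norm (LN z)" using bd[OF ks[OF kn] z] by simp
        also have "\<dots> \<le> K * (4 * \<epsilon> * (T / real n))"
          using zn K \<epsilon> by (intro mult_left_mono order_trans[OF _ mult_left_mono[OF sT]]) auto
        finally have "norm (LN (inv\<^bsub>N\<^esub> (v k) \<otimes>\<^bsub>N\<^esub> u k)) \<le> e / real n" by (simp add: eq e_def mult_ac)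
        with v v2 bd[OF ks[OF kn] z] show ?thesis by (simp add: eq)
      qed
      have "inv\<^bsub>N\<^esub> (\<beta> (real n * s)) \<otimes>\<^bsub>N\<^esub> P s n \<in> N.nb d'"
      proof (rule N.product_comparison[where u = u and v = v and n = n and Q = "\<lambda>k. \<beta> (real k * s)", OF _ _ _ _ _ _ _ _ _ small d'(3) \<kappa> e order_refl])
        show "\<beta> (real (Suc k) * s) = \<beta> (real k * s) \<otimes>\<^bsub>N\<^esub> v k" for k
          using one_par_add(2)[OF op, of "real k * s" s] by (simp add: v_def algebra_simps)
      qed (use one_par_zero[OF op] P vu in \<open>auto simp: u_def pi_closed b c\<close>)
      moreover have "real n * s = t" using elim(3) by (simp add: s_def)
      ultimately show "inv\<^bsub>N\<^esub> (\<beta> t) \<otimes>\<^bsub>N\<^esub> P (t / real n) n \<in> N.nb d"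
        using N.nb_mono d' by (simp add: s_def)
    qed
  qed
qed

text \<open>The left quotient in \<open>H\<close> has \<open>N\<close>-component
  \<open>\<pi> (inv (\<alpha> t))\<close> applied to the quotient from \<open>trotter_fibre\<close>.
  As \<open>inv (\<alpha> t) = \<alpha> (- t)\<close>, the uniform bound for the action on
  \<open>{-T..T}\<close> keeps this small as well.\<close>

lemma trotter_limit:
  assumes op: "one_par \<beta> \<alpha> w a" and c: "\<And>s. c s \<in> carrier G" "c 0 = \<one>\<^bsub>G\<^esub>" "G.tang (at 0) c a"
    and b: "\<And>s. b s \<in> carrier N" "b 0 = \<one>\<^bsub>N\<^esub>" "N.tang (at 0) b w"
    and U: "openin (prod_topology TN TG) U" "\<one>\<^bsub>H\<^esub> \<in> U" and K: "compact K"
  shows "\<forall>\<^sub>F n in sequentially. \<forall>t\<in>K.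
    inv\<^bsub>H\<^esub> (\<beta> t, \<alpha> t) \<otimes>\<^bsub>H\<^esub> (b (t / real n), c (t / real n)) [^]\<^bsub>H\<^esub> n \<in> U"
proof -
  obtain T where T: "\<And>t. t \<in> K \<Longrightarrow> \<bar>t\<bar> \<le> T" "T \<ge> 0"
  proof -
    obtain B where "\<And>t. t \<in> K \<Longrightarrow> norm t \<le> B" using compact_imp_bounded[OF K] by (auto simp: bounded_iff)
    then show ?thesis by (intro that[of "max B 0"]) fastforce+
  qed
  obtain W V where W: "openin TN W" "\<one>\<^bsub>N\<^esub> \<in> W" and V: "openin TG V" "\<one>\<^bsub>G\<^esub> \<in> V" and WV: "W \<times> V \<subseteq> U"
    using U(1)[unfolded openin_prod_topology_alt, rule_format, of "\<one>\<^bsub>N\<^esub>" "\<one>\<^bsub>G\<^esub>"] U(2) by (auto simp: H_simps)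
  obtain dN where dN: "dN > 0" "N.nb dN \<subseteq> W" using N.nhd_nb[OF W] by blast
  obtain dG where dG: "dG > 0" "G.nb dG \<subseteq> V" using G.nhd_nb[OF V] by blast
  obtain K' \<delta> where K': "K' > 0" and \<delta>: "\<delta> > 0" "\<delta> \<le> rN"
    and bd: "\<And>t x. \<bar>t\<bar> \<le> T \<Longrightarrow> x \<in> N.nb \<delta> \<Longrightarrow> \<pi> (\<alpha> t) x \<in> N.nb rN \<and> norm (LN (\<pi> (\<alpha> t) x)) \<le> K' * norm (LN x)"
    using one_par_action_bound[OF op T(2)] by metis
  define d where "d = min \<delta> (dN / K')"
  have d: "d > 0" "d \<le> \<delta>" "K' * d \<le> dN" using \<delta> dN K' by (auto simp: d_def min_def field_simps)
  note oc = one_par_carrier[OF op]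
  have "group H" by (rule H_group)
  then interpret H: group H .
  define P where "P s k = fst ((b s, c s) [^]\<^bsub>H\<^esub> (k::nat))" for s k
  have pow: "(b s, c s) [^]\<^bsub>H\<^esub> k = (P s k, c s [^]\<^bsub>G\<^esub> k) \<and> P s k \<in> carrier N" for s k
  proof -
    have "snd ((b s, c s) [^]\<^bsub>H\<^esub> k) = c s [^]\<^bsub>G\<^esub> k"
    proof (induction k)
      case (Suc k)
      then show ?case by (cases "(b s, c s) [^]\<^bsub>H\<^esub> k") (simp add: H_simps)
    qed (simp add: H_simps)
    moreover have "(b s, c s) [^]\<^bsub>H\<^esub> k \<in> carrier H"
      using b c by (intro H.nat_pow_closed) (simp add: H_simps)
    ultimately show ?thesis by (auto simp: P_def H_simps prod_eq_iff mem_Times_iff)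
  qed
  have P0: "P s 0 = \<one>\<^bsub>N\<^esub>" for s by (simp add: P_def H_simps)
  have P: "P s (Suc k) = P s k \<otimes>\<^bsub>N\<^esub> \<pi> (c s [^]\<^bsub>G\<^esub> k) (b s)" for s k
  proof -
    have e: "(b s, c s) [^]\<^bsub>H\<^esub> k = (P s k, c s [^]\<^bsub>G\<^esub> k)" using pow by blast
    have "P s (Suc k) = fst ((b s, c s) [^]\<^bsub>H\<^esub> k \<otimes>\<^bsub>H\<^esub> (b s, c s))" by (simp add: P_def)
    then show ?thesis unfolding e by (simp add: H_simps)
  qed
  show ?thesis
    using trotter_base[OF op c T(2) dG(1)] trotter_fibre[OF op c b P0 P T(2) d(1)] eventually_gt_at_top[of 0]
  proof eventually_elim
    case (elim n)
    show ?case
    proof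
      fix t assume t: "t \<in> K"
      have g: "inv\<^bsub>G\<^esub> (\<alpha> t) \<otimes>\<^bsub>G\<^esub> c (t / real n) [^]\<^bsub>G\<^esub> n \<in> V"
        using elim(1)[rule_format, OF T(1)[OF t] order_refl] elim(3) dG(2) by auto
      define x where "x = inv\<^bsub>N\<^esub> (\<beta> t) \<otimes>\<^bsub>N\<^esub> P (t / real n) n"
      have x: "x \<in> N.nb d" using elim(2) T(1)[OF t] by (simp add: x_def)
      have tT: "\<bar>- t\<bar> \<le> T" using T(1)[OF t] by simp
      note B = bd[OF tT N.nb_mono[OF x d(2)]]
      have "norm (LN (\<pi> (\<alpha> (- t)) x)) < dN"
        using B mult_strict_left_mono[OF N.nb_norm[OF x] K'] d(3) by linarith
      then have "\<pi> (\<alpha> (- t)) x \<in> W" using B dN(2) N.nbI N.nb_U by blast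
      moreover have "\<alpha> (- t) = inv\<^bsub>G\<^esub> (\<alpha> t)"
        using G.inv_equality[OF _ oc(2) oc(2), of "- t" t] one_par_add(1)[OF op, of "- t" t] one_par_zero[OF op] by simp
      ultimately have "(\<pi> (inv\<^bsub>G\<^esub> (\<alpha> t)) x, inv\<^bsub>G\<^esub> (\<alpha> t) \<otimes>\<^bsub>G\<^esub> c (t / real n) [^]\<^bsub>G\<^esub> n) \<in> U"
        using WV g by auto
      then show "inv\<^bsub>H\<^esub> (\<beta> t, \<alpha> t) \<otimes>\<^bsub>H\<^esub> (b (t / real n), c (t / real n)) [^]\<^bsub>H\<^esub> n \<in> U"
        using pow[of "t / real n" n] oc c by (simp add: H_div x_def)
    qed
  qed
qed

end

section \<open>Charts of Banach--Lie groups\<close>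

text \<open>Differentiability at \<open>p\<close> of the second derivative bounds it near
  \<open>p\<close> by its values of order two and three at \<open>p\<close>, with \<open>1\<close>
  for the remainder; this is the constant \<open>C\<close>. The mean value theorem then makes the
  first derivative Lipschitz in operator norm.\<close>

lemma smooth_on_C1:
  assumes f: "smooth_on W f" and p: "p \<in> W"
  shows "\<exists>D \<rho> C. \<rho> > 0 \<and> C \<ge> 0 \<and> ball p \<rho> \<subseteq> W \<and> (\<forall>x\<in>ball p \<rho>. (f has_derivative D x) (at x)) \<and>
    (\<forall>x\<in>ball p \<rho>. \<forall>y\<in>ball p \<rho>. \<forall>v. norm (D x v - D y v) \<le> C * norm (x - y) * norm v)"
proof -
  obtain Dt where tower: "smooth_tower W f Dt" and W: "open W"
    using f unfolding smooth_on_def by blast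
  have nil: "Dt x [] = f x" if "x \<in> W" for x using tower that unfolding smooth_tower_def by blast
  have bnd: "\<exists>C. \<forall>vs. length vs = k \<longrightarrow> norm (Dt p vs) \<le> C * prod_list (map norm vs)" for k
    using tower p unfolding smooth_tower_def by blast
  obtain C2 where C2: "\<And>vs. length vs = 2 \<Longrightarrow> norm (Dt p vs) \<le> C2 * prod_list (map norm vs)"
    using bnd[of 2] by blast
  obtain C3 where C3: "\<And>vs. length vs = 3 \<Longrightarrow> norm (Dt p vs) \<le> C3 * prod_list (map norm vs)"
    using bnd[of 3] by blast
  have "\<forall>k. \<forall>e>0. \<exists>d>0. \<forall>y\<in>W. norm (y - p) < d \<longrightarrow> (\<forall>vs. length vs = k \<longrightarrow>
      norm (Dt y vs - Dt p vs - Dt p ((y - p) # vs)) \<le> e * norm (y - p) * prod_list (map norm vs))"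
    using tower p unfolding smooth_tower_def by fast
  from this[rule_format, OF zero_less_one, of 2] obtain d where d: "d > 0"
    "\<And>y vs. y \<in> W \<Longrightarrow> norm (y - p) < d \<Longrightarrow> length vs = 2 \<Longrightarrow>
      norm (Dt y vs - Dt p vs - Dt p ((y - p) # vs)) \<le> 1 * norm (y - p) * prod_list (map norm vs)"
    by blast
  obtain \<rho>0 where \<rho>0: "\<rho>0 > 0" "ball p \<rho>0 \<subseteq> W" using W p open_contains_ball by blast
  define \<rho> where "\<rho> = Min {\<rho>0, d, 1}"
  have \<rho>: "\<rho> > 0" "\<rho> \<le> \<rho>0" "\<rho> \<le> d" "\<rho> \<le> 1" using \<rho>0 d by (auto simp: \<rho>_def)
  have sub: "ball p \<rho> \<subseteq> W" using \<rho>0 \<rho> by (auto intro: subset_ball[THEN subsetD])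
  define C where "C = \<bar>C2\<bar> + \<bar>C3\<bar> + 1"
  have second: "norm (Dt y [h, v]) \<le> C * norm h * norm v" if y: "y \<in> ball p \<rho>" for y h v
  proof -
    have n: "norm (y - p) < d" "norm (y - p) \<le> 1"
      using y \<rho> by (auto simp: dist_norm norm_minus_commute)
    have P: "norm h * norm v \<ge> 0" by simp
    have 1: "norm (Dt y [h, v] - Dt p [h, v] - Dt p [y - p, h, v]) \<le> norm (y - p) * (norm h * norm v)"
      using d(2)[of y "[h, v]"] y sub n by auto
    have 2: "norm (Dt p [h, v]) \<le> C2 * (norm h * norm v)" using C2[of "[h, v]"] by simp
    have 3: "norm (Dt p [y - p, h, v]) \<le> C3 * (norm (y - p) * (norm h * norm v))"
      using C3[of "[y - p, h, v]"] by simp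
    have "norm (y - p) * (norm h * norm v) \<le> 1 * (norm h * norm v)" using n P by (intro mult_right_mono) auto
    moreover have "C2 * (norm h * norm v) \<le> \<bar>C2\<bar> * (norm h * norm v)" using P by (intro mult_right_mono) auto
    moreover have "C3 * (norm (y - p) * (norm h * norm v)) \<le> \<bar>C3\<bar> * (1 * (norm h * norm v))"
      using n P by (intro mult_mono) auto
    ultimately have "norm (Dt y [h, v]) \<le> \<bar>C2\<bar> * (norm h * norm v) + \<bar>C3\<bar> * (norm h * norm v) + norm h * norm v"
      using 1 2 3 norm_triangle_ineq2[of "Dt y [h, v] - Dt p [h, v]" "Dt p [y - p, h, v]"]
        norm_triangle_ineq2[of "Dt y [h, v]" "Dt p [h, v]"] by linarith
    then show ?thesis by (simp add: C_def algebra_simps)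
  qed
  have der: "((\<lambda>y. Dt y vs) has_derivative (\<lambda>h. Dt x (h # vs))) (at x)" if "x \<in> ball p \<rho>" for x vs
    using smooth_tower_has_derivative[OF tower W] that sub by blast
  show ?thesis
  proof (rule exI[of _ "\<lambda>x v. Dt x [v]"], rule exI[of _ \<rho>], rule exI[of _ C], intro conjI ballI allI \<rho> sub)
    show "C \<ge> 0" by (simp add: C_def)
    fix x assume x: "x \<in> ball p \<rho>"
    show "(f has_derivative (\<lambda>v. Dt x [v])) (at x)"
      by (rule has_derivative_transform_within_open[OF der[OF x] open_ball x]) (use nil sub in auto)
    fix y v assume y: "y \<in> ball p \<rho>"
    have "norm (Dt x [v] - Dt y [v]) \<le> (C * norm v) * norm (x - y)"
    proof (rule differentiable_bound[of "ball p \<rho>"])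
      fix z assume z: "z \<in> ball p \<rho>"
      show "((\<lambda>x. Dt x [v]) has_derivative (\<lambda>h. Dt z [h, v])) (at z within ball p \<rho>)"
        by (rule has_derivative_at_withinI[OF der[OF z]])
      show "onorm (\<lambda>h. Dt z [h, v]) \<le> C * norm v"
        by (rule onorm_bound) (use second[OF z] in \<open>simp_all add: mult_ac C_def\<close>)
    qed (use x y in auto)
    then show "norm (Dt x [v] - Dt y [v]) \<le> C * norm (x - y) * norm v" by (simp add: mult_ac)
  qed
qed

lemma smooth_on_derivative_tendsto:
  assumes f: "smooth_on W f" and p: "p \<in> W" and x: "(x \<longlongrightarrow> p) F" and v: "(v \<longlongrightarrow> v0) F"
  shows "((\<lambda>s. frechet_derivative f (at (x s)) (v s)) \<longlongrightarrow> frechet_derivative f (at p) v0) F"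
proof -
  obtain D \<rho> C where \<rho>: "\<rho> > 0" and C: "C \<ge> 0"
    and D: "\<And>x. x \<in> ball p \<rho> \<Longrightarrow> (f has_derivative D x) (at x)"
    and lip: "\<And>x y v. x \<in> ball p \<rho> \<Longrightarrow> y \<in> ball p \<rho> \<Longrightarrow> norm (D x v - D y v) \<le> C * norm (x - y) * norm v"
    using smooth_on_C1[OF f p] by metis
  have FD: "frechet_derivative f (at y) = D y" if "y \<in> ball p \<rho>" for y
    using frechet_derivative_at[OF D[OF that]] by simp
  have pb: "p \<in> ball p \<rho>" using \<rho> by simp
  have Dp: "bounded_linear (D p)" using has_derivative_bounded_linear[OF D[OF pb]] .
  have ev: "\<forall>\<^sub>F s in F. x s \<in> ball p \<rho>" using tendstoD[OF x \<rho>] by (simp add: dist_commute)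
  have "((\<lambda>s. D (x s) (v s) - D p (v s)) \<longlongrightarrow> 0) F"
  proof (rule Lim_null_comparison)
    show "\<forall>\<^sub>F s in F. norm (D (x s) (v s) - D p (v s)) \<le> C * norm (x s - p) * norm (v s)"
      using ev by eventually_elim (rule lip[OF _ pb])
    have "((\<lambda>s. C * norm (x s - p) * norm (v s)) \<longlongrightarrow> C * norm (p - p) * norm v0) F"
      by (intro tendsto_intros x v)
    then show "((\<lambda>s. C * norm (x s - p) * norm (v s)) \<longlongrightarrow> 0) F" by simp
  qed
  from tendsto_add[OF this bounded_linear.tendsto[OF Dp v]]
  have "((\<lambda>s. D (x s) (v s)) \<longlongrightarrow> D p v0) F" by simp
  then show ?thesis unfolding FD[OF pb]
    by (rule Lim_transform_eventually) (use ev in \<open>auto elim: eventually_mono simp: FD\<close>)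
qed

lemma chart_facts:
  assumes M: "banach_manifold M" and c: "(U, \<phi>) \<in> atlas M"
  shows chart_open: "openin (mfd_top M) U" and chart_image_open: "open (\<phi> ` U)"
    and chart_inj: "inj_on \<phi> U"
    and chart_continuous: "continuous_map (subtopology (mfd_top M) U) euclidean \<phi>"
    and chart_open_map: "openin (mfd_top M) W \<Longrightarrow> W \<subseteq> U \<Longrightarrow> open (\<phi> ` W)"
proof -
  show U: "openin (mfd_top M) U" and o: "open (\<phi> ` U)"
    using M c unfolding banach_manifold_def by blast+
  have hom: "homeomorphic_map (subtopology (mfd_top M) U) (top_of_set (\<phi> ` U)) \<phi>"
    using M c unfolding banach_manifold_def by blast
  have ts: "topspace (subtopology (mfd_top M) U) = U"
    using openin_subset[OF U] by (simp add: topspace_subtopology Int_absorb1)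
  show "inj_on \<phi> U" using homeomorphic_imp_injective_map[OF hom] ts by simp
  show "continuous_map (subtopology (mfd_top M) U) euclidean \<phi>"
    using homeomorphic_imp_continuous_map[OF hom] continuous_map_in_subtopology by blast
  show "open (\<phi> ` W)" if "openin (mfd_top M) W" "W \<subseteq> U"
  proof -
    have "openin (subtopology (mfd_top M) U) W" using that openin_subtopology_Int2[of "mfd_top M" W U]
      by (simp add: Int_absorb1)
    then have "openin (top_of_set (\<phi> ` U)) (\<phi> ` W)"
      using homeomorphic_imp_open_map[OF hom] unfolding open_map_def by blast
    then show ?thesis using o openin_open_trans by blast
  qed
qed

lemma chart_nhd:
  assumes M: "banach_manifold M" and c: "(U, \<phi>) \<in> atlas M"
    and W: "openin (mfd_top M) W" and p: "p \<in> U" "p \<in> W"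
  shows "\<exists>d>0. \<forall>v. norm (v - \<phi> p) < d \<longrightarrow> v \<in> \<phi> ` U \<and> inv_into U \<phi> v \<in> W"
proof -
  have "open (\<phi> ` (W \<inter> U))"
    by (rule chart_open_map[OF M c]) (use W chart_open[OF M c] in auto)
  then obtain d where d: "d > 0" "ball (\<phi> p) d \<subseteq> \<phi> ` (W \<inter> U)"
    using p open_contains_ball by blast
  have "v \<in> \<phi> ` U \<and> inv_into U \<phi> v \<in> W" if "norm (v - \<phi> p) < d" for v
  proof -
    have "v \<in> \<phi> ` (W \<inter> U)" using d that by (auto simp: dist_norm norm_minus_commute)
    then show ?thesis using inv_into_f_f[OF chart_inj[OF M c]] by auto
  qed
  with d show ?thesis by blast
qed

lemma inv_into_map_prod:
  assumes "inj_on f A" "inj_on g B" "a \<in> f ` A" "b \<in> g ` B"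
  shows "inv_into (A \<times> B) (map_prod f g) (a, b) = (inv_into A f a, inv_into B g b)"
proof -
  have "inj_on (map_prod f g) (A \<times> B)" using assms by (rule_tac map_prod_inj_on)
  moreover have "(a, b) = map_prod f g (inv_into A f a, inv_into B g b)"
    using assms by (simp add: f_inv_into_f)
  moreover have "(inv_into A f a, inv_into B g b) \<in> A \<times> B" using assms by (simp add: inv_into_into)
  ultimately show ?thesis by (metis inv_into_f_f)
qed

lemma mult_chart_smooth:
  assumes N: "banach_lie_group N MN" and "(U, \<phi>) \<in> atlas MN" "(V, \<psi>) \<in> atlas MN" "(W, \<theta>) \<in> atlas MN"
  shows "smooth_on (map_prod \<phi> \<psi> ` (U \<times> V \<inter> (\<lambda>(x, y). x \<otimes>\<^bsub>N\<^esub> y) -` W))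
    (\<theta> \<circ> (\<lambda>(x, y). x \<otimes>\<^bsub>N\<^esub> y) \<circ> inv_into (U \<times> V) (map_prod \<phi> \<psi>))"
proof -
  have "(U \<times> V, map_prod \<phi> \<psi>) \<in> atlas (prod_manifold MN MN)"
    using assms by (auto simp: prod_manifold_def)
  then show ?thesis using assms unfolding banach_lie_group_def smooth_map_def by blast
qed

lemma banach_lie_group_facts:
  assumes "banach_lie_group N MN"
  shows blg_group: "group N" and blg_manifold: "banach_manifold MN"
    and blg_topspace: "topspace (mfd_top MN) = carrier N"
    and blg_mult: "continuous_map (prod_topology (mfd_top MN) (mfd_top MN)) (mfd_top MN) (\<lambda>(x, y). x \<otimes>\<^bsub>N\<^esub> y)"
    and blg_inv: "continuous_map (mfd_top MN) (mfd_top MN) (\<lambda>x. inv\<^bsub>N\<^esub> x)"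
  using assms by (auto simp: banach_lie_group_def smooth_map_def prod_manifold_def)

text \<open>Let \<open>F\<close> be the multiplication in the chart. Its derivative is Lipschitz
  near the base point, and \<open>F (o1, b) = b\<close> fixes its second partial derivative along
  \<open>a = o1\<close> as the identity. Everything else is the mean value theorem and continuity of
  the group operations at the identity.\<close>

lemma banach_lie_group_local:
  fixes N :: "('n, 'c) monoid_scheme" (structure) and MN :: "('n, 'e::banach) manifold"
  assumes N: "banach_lie_group N MN" and c: "(U, \<phi>) \<in> atlas MN" and one: "\<one>\<^bsub>N\<^esub> \<in> U"
  shows "\<exists>R r C D. local_group N (mfd_top MN) U (\<lambda>x. \<phi> x - \<phi> \<one>\<^bsub>N\<^esub>) R r C D"
proof -
  interpret group N by (rule blg_group[OF N])
  let ?m = "\<lambda>(x, y). x \<otimes>\<^bsub>N\<^esub> y"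
  let ?T = "mfd_top MN"
  note M = blg_manifold[OF N] and top = blg_topspace[OF N] and cm = blg_mult[OF N] and ci = blg_inv[OF N]
  note U = chart_open[OF M c] and inj = chart_inj[OF M c]
  have carr: "x \<in> carrier N" if "x \<in> U" for x using openin_subset[OF U] top that by auto
  define o1 where "o1 = \<phi> \<one>\<^bsub>N\<^esub>"
  define L where "L x = \<phi> x - o1" for x
  define E where "E = inv_into U \<phi>"
  have E: "E (\<phi> x) = x" if "x \<in> U" for x using inv_into_f_f[OF inj that] by (simp add: E_def)
  have E2: "E a \<in> U" "\<phi> (E a) = a" if "a \<in> \<phi> ` U" for a
    using that by (simp_all add: E_def inv_into_into f_inv_into_f)
  have invL: "inv_into U L v = E (v + o1)" if "v + o1 \<in> \<phi> ` U" for v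
  proof -
    have "inj_on L U" using inj by (auto simp: L_def inj_on_def)
    moreover have "L (E (v + o1)) = v" using E2[OF that] by (simp add: L_def)
    ultimately show ?thesis using inv_into_f_f[of L U "E (v + o1)"] E2[OF that] by simp
  qed
  define W where "W = map_prod \<phi> \<phi> ` (U \<times> U \<inter> ?m -` U)"
  define F where "F = \<phi> \<circ> ?m \<circ> inv_into (U \<times> U) (map_prod \<phi> \<phi>)"
  have F: "smooth_on W F" unfolding W_def F_def by (rule mult_chart_smooth[OF N c c c])
  have Fe: "F (a, b) = \<phi> (E a \<otimes> E b)" if "a \<in> \<phi> ` U" "b \<in> \<phi> ` U" for a b
    using inv_into_map_prod[OF inj inj that] by (simp add: F_def E_def)
  have WD: "a \<in> \<phi> ` U \<and> b \<in> \<phi> ` U \<and> E a \<otimes> E b \<in> U" if "(a, b) \<in> W" for a b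
    using that E by (auto simp: W_def)
  have "(o1, o1) \<in> W" using one by (auto simp: W_def o1_def intro!: image_eqI[of _ _ "(\<one>, \<one>)"])
  from smooth_on_C1[OF F this] obtain D \<rho> C where \<rho>: "\<rho> > 0" and C: "C \<ge> 0" and bW: "ball (o1, o1) \<rho> \<subseteq> W"
    and D: "\<And>x. x \<in> ball (o1, o1) \<rho> \<Longrightarrow> (F has_derivative D x) (at x)"
    and lip: "\<And>x y v. x \<in> ball (o1, o1) \<rho> \<Longrightarrow> y \<in> ball (o1, o1) \<rho> \<Longrightarrow>
      norm (D x v - D y v) \<le> C * norm (x - y) * norm v" by metis
  \<comment> \<open>\<open>\<rho> / 2\<close> puts pairs of coordinates from the
    \<open>R\<close>-ball into the ball where \<open>F\<close> is controlled; the other bound gives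
    \<open>C * R \<le> 1/4\<close>.\<close>
  define R where "R = min (\<rho> / 2) (1 / (4 * (C + 1)))"
  have R: "R > 0" "R \<le> \<rho> / 2" "R \<le> 1 / (4 * (C + 1))" using \<rho> C by (auto simp: R_def)
  have CR: "C * R \<le> 1/4"
  proof -
    have "C * R \<le> (C + 1) * (1 / (4 * (C + 1)))" using C R by (intro mult_mono) auto
    also have "\<dots> = 1/4" using C by (simp add: field_simps)
    finally show ?thesis .
  qed
  have ball: "(a, b) \<in> ball (o1, o1) \<rho>" if "norm (a - o1) < R" "norm (b - o1) < R" for a b
  proof -
    have "norm (o1 - a, o1 - b) \<le> norm (a - o1) + norm (b - o1)"
      using norm_Pair_le[of "o1 - a" "o1 - b"] by (simp add: norm_minus_commute)
    then show ?thesis using that R by (simp add: dist_norm)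
  qed
  have img: "a \<in> \<phi> ` U" if "norm (a - o1) < R" for a
    using WD[OF subsetD[OF bW ball[of a o1]]] that R by auto
  have Eo: "E o1 = \<one>" using E[OF one] by (simp add: o1_def)
  have F1: "F (o1, b) = b" and F2: "F (b, o1) = b" if "norm (b - o1) < R" for b
    using Fe img[OF that] img[of o1] R E2[OF img[OF that]] carr Eo by auto
  have Dsnd: "((\<lambda>b. F (a, b)) has_derivative (\<lambda>h. D (a, b) (0, h))) (at b)"
    if "norm (a - o1) < R" "norm (b - o1) < R" for a b
  proof -
    have "((\<lambda>b. (a, b)) has_derivative (\<lambda>h. (0, h))) (at b)" by (auto intro!: derivative_eq_intros)
    from has_derivative_compose[OF this D[OF ball[OF that]]] show ?thesis by simp
  qed
  have D0: "D (o1, b) (0, h) = h" if b: "norm (b - o1) < R" for b h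
  proof -
    have "((\<lambda>b. b) has_derivative (\<lambda>h. D (o1, b) (0, h))) (at b)"
    proof (rule has_derivative_transform_within_open[OF Dsnd[of o1 b]])
      show "open {b. norm (b - o1) < R}" by (intro open_Collect_less continuous_intros)
    qed (use b R F1 in auto)
    from has_derivative_unique[OF this has_derivative_ident] show ?thesis by metis
  qed
  \<comment> \<open>The derivative of \<open>b \<mapsto> F (a, b) - b\<close> is the difference of
    the second partial derivatives of \<open>F\<close> at first arguments \<open>a\<close> and
    \<open>o1\<close>, hence at most \<open>C * norm (a - o1)\<close>. Integrating from
    \<open>o1\<close>, where \<open>F (a, o1) = a\<close>, gives the bilinear bound.\<close>
  have est: "norm (F (a, b) - a - b + o1) \<le> C * norm (a - o1) * norm (b - o1)"
    if a: "norm (a - o1) < R" and b: "norm (b - o1) < R" for a b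
  proof -
    have "norm ((F (a, b) - b) - (F (a, o1) - o1)) \<le> (C * norm (a - o1)) * norm (b - o1)"
    proof (rule differentiable_bound[of "ball o1 R"])
      fix x assume "x \<in> ball o1 R"
      then have x: "norm (x - o1) < R" by (simp add: dist_norm norm_minus_commute)
      show "((\<lambda>b. F (a, b) - b) has_derivative (\<lambda>h. D (a, x) (0, h) - h)) (at x within ball o1 R)"
        by (intro has_derivative_diff has_derivative_at_withinI[OF Dsnd[OF a x]] has_derivative_ident)
      show "onorm (\<lambda>h. D (a, x) (0, h) - h) \<le> C * norm (a - o1)"
      proof (rule onorm_bound)
        show "0 \<le> C * norm (a - o1)" using C by simp
        fix h
        have "norm (D (a, x) (0, h) - D (o1, x) (0, h)) \<le> C * norm ((a, x) - (o1, x)) * norm ((0::'e), h)"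
          by (rule lip) (use ball a x R in auto)
        then show "norm (D (a, x) (0, h) - h) \<le> C * norm (a - o1) * norm h"
          using D0[OF x] by (simp add: norm_Pair)
      qed
    qed (use b R in \<open>auto simp: dist_norm norm_minus_commute\<close>)
    moreover have "F (a, b) - b - (F (a, o1) - o1) = F (a, b) - a - b + o1" using F2[OF a] by simp
    ultimately show ?thesis by metis
  qed
  define Dm where "Dm p v = D (p + o1, o1) (0, v)" for p v
  define B where "B d = {x \<in> U. norm (L x) < d}" for d
  have openB: "openin ?T (B d)" for d
  proof -
    have "openin (subtopology ?T U) {x \<in> topspace (subtopology ?T U). \<phi> x \<in> ball o1 d}"
      using openin_continuous_map_preimage[OF chart_continuous[OF M c], of "ball o1 d"] by simp
    moreover have "{x \<in> topspace (subtopology ?T U). \<phi> x \<in> ball o1 d} = B d"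
      using openin_subset[OF U] by (auto simp: B_def L_def dist_norm norm_minus_commute)
    ultimately show ?thesis using openin_trans_full[OF _ U] by metis
  qed
  have oneB: "\<one> \<in> B d" if "d > 0" for d using that one by (simp add: B_def L_def o1_def)
  have nhd: "\<exists>d>0. \<forall>x\<in>U. norm (L x) < d \<longrightarrow> x \<in> Y" if Y: "openin ?T Y" "\<one> \<in> Y" for Y
  proof -
    obtain d where d: "d > 0" "\<forall>v. norm (v - \<phi> \<one>) < d \<longrightarrow> v \<in> \<phi> ` U \<and> inv_into U \<phi> v \<in> Y"
      using chart_nhd[OF M c Y(1) one Y(2)] by blast
    then have "x \<in> Y" if "x \<in> U" "norm (L x) < d" for x
      using inv_into_f_f[OF inj that(1)] that(2) by (metis L_def o1_def)
    with d show ?thesis by blast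
  qed
  \<comment> \<open>Stated for a general \<open>f\<close> fixing the identity, to be used for
    quotients and for conjugates.\<close>
  have small: "\<exists>r>0. \<forall>x\<in>U. \<forall>y\<in>U. norm (L x) < r \<longrightarrow> norm (L y) < r \<longrightarrow> f (x, y) \<in> B R"
    if cf: "continuous_map (prod_topology ?T ?T) ?T f" and f1: "f (\<one>, \<one>) = \<one>" for f
  proof -
    have op: "openin (prod_topology ?T ?T) {p \<in> topspace (prod_topology ?T ?T). f p \<in> B R}"
      by (rule openin_continuous_map_preimage[OF cf openB])
    have "(\<one>, \<one>) \<in> {p \<in> topspace (prod_topology ?T ?T). f p \<in> B R}"
      using f1 oneB[OF R(1)] by (simp add: top)
    from op[unfolded openin_prod_topology_alt, rule_format, OF this]
    obtain Y Z where Y: "openin ?T Y" "\<one> \<in> Y" and Z: "openin ?T Z" "\<one> \<in> Z"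
      and YZ: "Y \<times> Z \<subseteq> {p \<in> topspace (prod_topology ?T ?T). f p \<in> B R}" by blast
    obtain d1 where d1: "d1 > 0" "\<forall>x\<in>U. norm (L x) < d1 \<longrightarrow> x \<in> Y" using nhd[OF Y] by blast
    obtain d2 where d2: "d2 > 0" "\<forall>x\<in>U. norm (L x) < d2 \<longrightarrow> x \<in> Z" using nhd[OF Z] by blast
    have "f (x, y) \<in> B R" if "x \<in> U" "y \<in> U" "norm (L x) < min d1 d2" "norm (L y) < min d1 d2" for x y
      using subsetD[OF YZ, of "(x, y)"] d1(2) d2(2) that by auto
    then show ?thesis using d1(1) d2(1) by (intro exI[of _ "min d1 d2"]) auto
  qed
  have cfst: "continuous_map (prod_topology ?T ?T) ?T fst" and csnd: "continuous_map (prod_topology ?T ?T) ?T snd"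
    by (rule continuous_map_fst, rule continuous_map_snd)
  have mul: "continuous_map (prod_topology ?T ?T) ?T (\<lambda>p. f p \<otimes> g p)"
    if "continuous_map (prod_topology ?T ?T) ?T f" "continuous_map (prod_topology ?T ?T) ?T g" for f g
    using continuous_map_compose[OF continuous_map_pairedI[OF that] cm] by (simp add: o_def)
  have cif: "continuous_map (prod_topology ?T ?T) ?T (\<lambda>p. inv (fst p))"
    using continuous_map_compose[OF cfst ci] by (simp add: o_def)
  obtain r1 where r1: "r1 > 0" "\<forall>x\<in>U. \<forall>y\<in>U. norm (L x) < r1 \<longrightarrow> norm (L y) < r1 \<longrightarrow> inv x \<otimes> y \<in> B R"
    using small[OF mul[OF cif csnd]] by auto
  obtain r2 where r2: "r2 > 0" "\<forall>x\<in>U. \<forall>y\<in>U. norm (L x) < r2 \<longrightarrow> norm (L y) < r2 \<longrightarrow> inv x \<otimes> y \<otimes> x \<in> B R"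
    using small[OF mul[OF mul[OF cif csnd] cfst]] by auto
  define r where "r = Min {R, r1, r2}"
  have r: "r > 0" "r \<le> R" "r \<le> r1" "r \<le> r2" using R r1 r2 by (auto simp: r_def)
  have "local_group N ?T U L R r C Dm"
  proof (intro local_group.intro local_group_axioms.intro is_group)
    show "topspace ?T = carrier N" "continuous_map (prod_topology ?T ?T) ?T (\<lambda>(x, y). x \<otimes> y)"
      "continuous_map ?T ?T (\<lambda>x. inv x)" "openin ?T U" "\<one> \<in> U" by (fact top cm ci U one)+
    have "Hausdorff_space ?T" using M unfolding banach_manifold_def by blast
    then show "closedin ?T {\<one>}" using top by (intro closedin_t1_singleton Hausdorff_imp_t1_space) auto
    show "L \<one> = 0" by (simp add: L_def o1_def)
    show "inj_on L U" using inj by (auto simp: L_def inj_on_def)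
    show "continuous_map (subtopology ?T U) euclidean L"
      unfolding L_def using chart_continuous[OF M c] by (intro continuous_map_diff) auto
    show "\<exists>d>0. \<forall>x\<in>U. norm (L x) < d \<longrightarrow> x \<in> W" if "openin ?T W" "\<one> \<in> W" for W using nhd that by blast
    show "0 < r" "r \<le> R" "0 \<le> C" "C * R \<le> 1/4" by (fact r C CR)+
    show "v \<in> L ` U" if "norm v < R" for v
    proof -
      have "v + o1 \<in> \<phi> ` U" using that by (intro img) simp
      then obtain x where "x \<in> U" "v + o1 = \<phi> x" by blast
      then show ?thesis by (intro image_eqI[of _ _ x]) (auto simp: L_def algebra_simps)
    qed
    show "x \<otimes> y \<in> U \<and> norm (L (x \<otimes> y) - L x - L y) \<le> C * norm (L x) * norm (L y)"
      if "x \<in> U" "y \<in> U" "norm (L x) < R" "norm (L y) < R" for x y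
    proof -
      have n: "norm (\<phi> x - o1) < R" "norm (\<phi> y - o1) < R" using that by (auto simp: L_def)
      have "x \<otimes> y \<in> U" using WD[OF subsetD[OF bW ball[OF n]]] E that by simp
      moreover have "F (\<phi> x, \<phi> y) = \<phi> (x \<otimes> y)" using Fe E that by simp
      ultimately show ?thesis using est[OF n] by (simp add: L_def algebra_simps)
    qed
    show "inv x \<otimes> y \<in> U \<and> norm (L (inv x \<otimes> y)) < R"
      if "x \<in> U" "y \<in> U" "norm (L x) < r" "norm (L y) < r" for x y
      using r1(2) that r by (force simp: B_def)
    show "inv x \<otimes> y \<otimes> x \<in> U \<and> norm (L (inv x \<otimes> y \<otimes> x)) < R"
      if "x \<in> U" "y \<in> U" "norm (L x) < r" "norm (L y) < r" for x y
      using r2(2) that r by (force simp: B_def)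
    show "bounded_linear (Dm p)" if "norm p < R" for p
      unfolding Dm_def using Dsnd[of "p + o1" o1] that R by (auto dest: has_derivative_bounded_linear)
    show "norm (Dm p v - Dm q v) \<le> C * norm (p - q) * norm v" if "norm p < R" "norm q < R" for p q v
    proof -
      have "norm (D (p + o1, o1) (0, v) - D (q + o1, o1) (0, v)) \<le>
          C * norm ((p + o1, o1) - (q + o1, o1)) * norm ((0::'e), v)"
        by (rule lip) (use ball that R in auto)
      then show ?thesis by (simp add: Dm_def norm_Pair)
    qed
    show "Dm 0 v = v" for v using D0[of o1 v] R by (simp add: Dm_def)
    show "((\<lambda>v. L (x \<otimes> inv_into U L v)) has_derivative Dm (L x)) (at 0)" if x: "x \<in> U" "norm (L x) < R" for x
    proof -
      have n: "norm (\<phi> x - o1) < R" using x by (simp add: L_def)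
      have "((\<lambda>v. v + o1) has_derivative (\<lambda>v. v)) (at 0)" by (auto intro!: derivative_eq_intros)
      from has_derivative_compose[OF this, of "\<lambda>b. F (\<phi> x, b)" "\<lambda>h. D (\<phi> x, o1) (0, h)"]
      have "((\<lambda>v. F (\<phi> x, v + o1)) has_derivative (\<lambda>h. D (\<phi> x, o1) (0, h))) (at 0)"
        using Dsnd[OF n, of o1] R by simp
      then have "((\<lambda>v. F (\<phi> x, v + o1) - o1) has_derivative (\<lambda>h. D (\<phi> x, o1) (0, h))) (at 0)"
        by (auto intro!: derivative_eq_intros)
      then have "((\<lambda>v. L (x \<otimes> inv_into U L v)) has_derivative (\<lambda>h. D (\<phi> x, o1) (0, h))) (at 0)"
      proof (rule has_derivative_transform_within_open)
        show "open (ball (0::'e) R)" "0 \<in> ball (0::'e) R" using R by auto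
        fix v assume "v \<in> ball (0::'e) R"
        then have v: "v + o1 \<in> \<phi> ` U" by (intro img) (simp add: dist_norm)
        show "F (\<phi> x, v + o1) - o1 = L (x \<otimes> inv_into U L v)"
          using Fe[of "\<phi> x" "v + o1"] v x E by (simp add: invL[OF v] L_def)
      qed
      moreover have "Dm (L x) = (\<lambda>h. D (\<phi> x, o1) (0, h))" by (simp add: Dm_def[abs_def] L_def)
      ultimately show ?thesis by simp
    qed
  qed
  then show ?thesis unfolding L_def[abs_def] o1_def by blast
qed

section \<open>Curves in charts and pointwise differentiable maps between manifolds\<close>

lemma continuous_map_limitin:
  assumes "continuous_map (top_of_set I) T \<gamma>" "t \<in> I"
  shows "limitin T \<gamma> (\<gamma> t) (at t within I)"
  unfolding limitin_def
proof (intro conjI allI impI)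
  show "\<gamma> t \<in> topspace T" using assms continuous_map_image_subset_topspace by fastforce
  fix V assume V: "openin T V \<and> \<gamma> t \<in> V"
  have "openin (top_of_set I) {s \<in> I. \<gamma> s \<in> V}"
    using openin_continuous_map_preimage[OF assms(1)] V by force
  then obtain S where S: "open S" "{s \<in> I. \<gamma> s \<in> V} = I \<inter> S" by (auto simp: openin_open)
  then show "\<forall>\<^sub>F s in at t within I. \<gamma> s \<in> V"
    unfolding eventually_at_topological using V assms(2) by blast
qed

lemma limitin_continuous_map_curve:
  fixes I :: "real set"
  assumes lim: "\<And>t. t \<in> I \<Longrightarrow> limitin T \<gamma> (\<gamma> t) (at t within I)"
  shows "continuous_map (top_of_set I) T \<gamma>"
  unfolding continuous_map_def
proof (intro conjI allI impI)
  show "\<gamma> \<in> topspace (top_of_set I) \<rightarrow> topspace T"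
    using limitin_topspace[OF lim] by auto
  fix V assume V: "openin T V"
  have "\<exists>e>0. \<forall>s\<in>I. dist s t < e \<longrightarrow> \<gamma> s \<in> V" if t: "t \<in> I" "\<gamma> t \<in> V" for t
  proof -
    obtain d where "d > 0" "\<forall>s\<in>I. s \<noteq> t \<and> dist s t < d \<longrightarrow> \<gamma> s \<in> V"
      using limitinD[OF lim[OF t(1)] V t(2)] unfolding eventually_at by blast
    then show ?thesis using t by (intro exI[of _ d]) metis
  qed
  then show "openin (top_of_set I) {x \<in> topspace (top_of_set I). \<gamma> x \<in> V}"
    unfolding openin_euclidean_subtopology_iff by auto
qed

lemma chart_tendsto:
  assumes M: "banach_manifold M" and c: "(U, \<phi>) \<in> atlas M"
    and lim: "limitin (mfd_top M) f p F" and p: "p \<in> U"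
  shows "((\<lambda>s. \<phi> (f s)) \<longlongrightarrow> \<phi> p) F"
proof -
  have "limitin (subtopology (mfd_top M) U) f p F"
    unfolding limitin_subtopology using lim p limitinD[OF lim chart_open[OF M c] p] by simp
  from continuous_map_limit[OF chart_continuous[OF M c] this] show ?thesis by (simp add: o_def)
qed

lemma curve_chain:
  assumes c: "((\<lambda>s. \<phi> (\<eta> s)) has_vector_derivative v) (at t within I)"
    and inj: "inj_on \<phi> U" and \<eta>t: "\<eta> t \<in> U" and ev: "\<forall>\<^sub>F s in at t within I. \<eta> s \<in> U" and t: "t \<in> I"
    and D: "((\<psi> \<circ> f \<circ> inv_into U \<phi>) has_derivative D) (at (\<phi> (\<eta> t)))"
  shows "((\<lambda>s. \<psi> (f (\<eta> s))) has_vector_derivative D v) (at t within I)"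
proof -
  have eq: "(\<psi> \<circ> f \<circ> inv_into U \<phi>) (\<phi> (\<eta> s)) = \<psi> (f (\<eta> s))" if "\<eta> s \<in> U" for s
    using inv_into_f_f[OF inj that] by simp
  have "((\<lambda>s. (\<psi> \<circ> f \<circ> inv_into U \<phi>) (\<phi> (\<eta> s))) has_derivative (\<lambda>s. D (s *\<^sub>R v))) (at t within I)"
    using has_derivative_compose[OF c[unfolded has_vector_derivative_def] D] .
  then have "((\<lambda>s. \<psi> (f (\<eta> s))) has_derivative (\<lambda>s. D (s *\<^sub>R v))) (at t within I)"
    by (rule has_derivative_transform_eventually) (use ev eq \<eta>t t in \<open>auto elim: eventually_mono\<close>)
  moreover have "D (s *\<^sub>R v) = s *\<^sub>R D v" for s
    using has_derivative_linear[OF D] by (simp add: linear_scale)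
  ultimately show ?thesis by (simp add: has_vector_derivative_def)
qed

lemma has_vector_derivative_shift:
  fixes f :: "real \<Rightarrow> 'a::real_normed_vector"
  assumes "((\<lambda>s. f (t + s)) has_vector_derivative v) (at 0)"
  shows "(f has_vector_derivative v) (at t within I)"
proof -
  have "((\<lambda>r. r - t) has_derivative (\<lambda>h. h)) (at t within I)"
    by (auto intro!: derivative_eq_intros)
  from has_derivative_compose[OF this, of "\<lambda>s. f (t + s)" "\<lambda>h. h *\<^sub>R v"]
  show ?thesis using assms by (simp add: has_vector_derivative_def)
qed

text \<open>Tangent maps involve first derivatives only, and these compose by the ordinary chain
  rule, whereas composing the towers behind \<open>smooth_on\<close> would call for higher chain
  rules.\<close>

definition mdiff ::
    "('m, 'a::banach) manifold \<Rightarrow> ('n, 'b::banach) manifold \<Rightarrow> ('m \<Rightarrow> 'n) \<Rightarrow> 'm \<Rightarrow> bool" where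
  "mdiff M M' f p \<longleftrightarrow> (\<forall>U \<phi> V \<psi>. (U, \<phi>) \<in> atlas M \<longrightarrow> (V, \<psi>) \<in> atlas M' \<longrightarrow> p \<in> U \<longrightarrow> f p \<in> V \<longrightarrow>
     (\<psi> \<circ> f \<circ> inv_into U \<phi>) differentiable (at (\<phi> p)))"

lemma mdiffD: "mdiff M M' f p \<Longrightarrow> (U, \<phi>) \<in> atlas M \<Longrightarrow> (V, \<psi>) \<in> atlas M' \<Longrightarrow> p \<in> U \<Longrightarrow> f p \<in> V \<Longrightarrow>
    ((\<psi> \<circ> f \<circ> inv_into U \<phi>) has_derivative frechet_derivative (\<psi> \<circ> f \<circ> inv_into U \<phi>) (at (\<phi> p))) (at (\<phi> p))"
  unfolding mdiff_def using frechet_derivative_works by blast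

lemma smooth_map_mdiff:
  assumes "smooth_map M M' f"
  shows "mdiff M M' f p"
  unfolding mdiff_def
proof (intro allI impI)
  fix U \<phi> V \<psi> assume "(U, \<phi>) \<in> atlas M" "(V, \<psi>) \<in> atlas M'" and p: "p \<in> U" "f p \<in> V"
  then have "smooth_on (\<phi> ` (U \<inter> f -` V)) (\<psi> \<circ> f \<circ> inv_into U \<phi>)"
    using assms unfolding smooth_map_def by blast
  then show "(\<psi> \<circ> f \<circ> inv_into U \<phi>) differentiable (at (\<phi> p))"
    by (rule smooth_on_differentiable) (use p in auto)
qed

lemma chart_exists:
  assumes "banach_manifold M" "p \<in> topspace (mfd_top M)"
  shows "\<exists>U \<phi>. (U, \<phi>) \<in> atlas M \<and> p \<in> U"
  using assms unfolding banach_manifold_def by fast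

lemma mdiff_compose:
  assumes M: "banach_manifold M" and M': "banach_manifold M'"
    and f: "continuous_map (mfd_top M) (mfd_top M') f"
    and df: "mdiff M M' f p" and dg: "mdiff M' M'' g (f p)"
  shows "mdiff M M'' (\<lambda>x. g (f x)) p"
  unfolding mdiff_def
proof (intro allI impI)
  fix U \<phi> W \<theta> assume U: "(U, \<phi>) \<in> atlas M" and W: "(W, \<theta>) \<in> atlas M''" and p: "p \<in> U" "g (f p) \<in> W"
  have pT: "p \<in> topspace (mfd_top M)" using p chart_open[OF M U] openin_subset by blast
  then have "f p \<in> topspace (mfd_top M')" using f continuous_map_image_subset_topspace by blast
  then obtain V \<psi> where V: "(V, \<psi>) \<in> atlas M'" "f p \<in> V" using chart_exists[OF M'] by blast
  have "openin (mfd_top M) {x \<in> topspace (mfd_top M). f x \<in> V}"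
    by (rule openin_continuous_map_preimage[OF f chart_open[OF M' V(1)]])
  from chart_nhd[OF M U this p(1)] pT V obtain d where d: "d > 0"
    "\<And>v. norm (v - \<phi> p) < d \<Longrightarrow> v \<in> \<phi> ` U \<and> f (inv_into U \<phi> v) \<in> V" by auto
  have e: "inv_into U \<phi> (\<phi> p) = p" using inv_into_f_f[OF chart_inj[OF M U] p(1)] .
  have "((\<lambda>x. (\<theta> \<circ> g \<circ> inv_into V \<psi>) ((\<psi> \<circ> f \<circ> inv_into U \<phi>) x)) has_derivative
      (\<lambda>x. frechet_derivative (\<theta> \<circ> g \<circ> inv_into V \<psi>) (at (\<psi> (f p)))
        (frechet_derivative (\<psi> \<circ> f \<circ> inv_into U \<phi>) (at (\<phi> p)) x))) (at (\<phi> p))"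
    using has_derivative_compose[OF mdiffD[OF df U V(1) p(1) V(2)], of "\<theta> \<circ> g \<circ> inv_into V \<psi>"]
      mdiffD[OF dg V(1) W V(2) p(2)] e by simp
  then have "((\<theta> \<circ> (\<lambda>x. g (f x)) \<circ> inv_into U \<phi>) has_derivative
      (\<lambda>x. frechet_derivative (\<theta> \<circ> g \<circ> inv_into V \<psi>) (at (\<psi> (f p)))
        (frechet_derivative (\<psi> \<circ> f \<circ> inv_into U \<phi>) (at (\<phi> p)) x))) (at (\<phi> p))"
  proof (rule has_derivative_transform_within_open)
    show "open (ball (\<phi> p) d)" "\<phi> p \<in> ball (\<phi> p) d" using d by auto
    fix v assume "v \<in> ball (\<phi> p) d"
    then have "f (inv_into U \<phi> v) \<in> V" using d by (simp add: dist_norm norm_minus_commute)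
    then show "(\<theta> \<circ> g \<circ> inv_into V \<psi>) ((\<psi> \<circ> f \<circ> inv_into U \<phi>) v) = (\<theta> \<circ> (\<lambda>x. g (f x)) \<circ> inv_into U \<phi>) v"
      using inv_into_f_f[OF chart_inj[OF M' V(1)]] by simp
  qed
  then show "(\<theta> \<circ> (\<lambda>x. g (f x)) \<circ> inv_into U \<phi>) differentiable (at (\<phi> p))"
    unfolding differentiable_def by blast
qed

lemma mdiff_prod:
  assumes M1: "banach_manifold M1" and M2: "banach_manifold M2"
    and f: "mdiff M1 M1' f p" and g: "mdiff M2 M2' g q"
  shows "mdiff (prod_manifold M1 M2) (prod_manifold M1' M2') (\<lambda>(x, y). (f x, g y)) (p, q)"
  unfolding mdiff_def
proof (intro allI impI)
  fix U' \<phi>' W' \<theta>'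
  assume "(U', \<phi>') \<in> atlas (prod_manifold M1 M2)" "(W', \<theta>') \<in> atlas (prod_manifold M1' M2')"
    and p: "(p, q) \<in> U'" "(case (p, q) of (x, y) \<Rightarrow> (f x, g y)) \<in> W'"
  then obtain U \<phi> V \<psi> W \<theta> X \<xi> where eq: "U' = U \<times> V" "\<phi>' = map_prod \<phi> \<psi>" "W' = W \<times> X" "\<theta>' = map_prod \<theta> \<xi>"
    and U: "(U, \<phi>) \<in> atlas M1" and V: "(V, \<psi>) \<in> atlas M2" and W: "(W, \<theta>) \<in> atlas M1'" and X: "(X, \<xi>) \<in> atlas M2'"
    by (auto simp: prod_manifold_def)
  have pq: "p \<in> U" "q \<in> V" "f p \<in> W" "g q \<in> X" using p eq by auto
  let ?F = "\<theta> \<circ> f \<circ> inv_into U \<phi>" and ?G = "\<xi> \<circ> g \<circ> inv_into V \<psi>"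
  let ?DF = "frechet_derivative ?F (at (\<phi> p))" and ?DG = "frechet_derivative ?G (at (\<psi> q))"
  have FG: "(?F has_derivative ?DF) (at (fst (\<phi> p, \<psi> q)))" "(?G has_derivative ?DG) (at (snd (\<phi> p, \<psi> q)))"
    unfolding fst_conv snd_conv by (rule mdiffD[OF f U W pq(1,3)], rule mdiffD[OF g V X pq(2,4)])
  have "((\<lambda>z. ?F (fst z)) has_derivative (\<lambda>z. ?DF (fst z))) (at (\<phi> p, \<psi> q))"
    and "((\<lambda>z. ?G (snd z)) has_derivative (\<lambda>z. ?DG (snd z))) (at (\<phi> p, \<psi> q))"
    by (rule has_derivative_compose[OF bounded_linear_imp_has_derivative[OF bounded_linear_fst] FG(1)],
        rule has_derivative_compose[OF bounded_linear_imp_has_derivative[OF bounded_linear_snd] FG(2)])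
  then have "((\<lambda>z. (?F (fst z), ?G (snd z))) has_derivative (\<lambda>z. (?DF (fst z), ?DG (snd z)))) (at (\<phi> p, \<psi> q))"
    by (rule has_derivative_Pair)
  then have "((\<theta>' \<circ> (\<lambda>(x, y). (f x, g y)) \<circ> inv_into U' \<phi>') has_derivative (\<lambda>z. (?DF (fst z), ?DG (snd z)))) (at (\<phi> p, \<psi> q))"
  proof (rule has_derivative_transform_within_open)
    show "open (\<phi> ` U \<times> \<psi> ` V)"
      by (intro open_Times chart_image_open[OF M1 U] chart_image_open[OF M2 V])
    show "(\<phi> p, \<psi> q) \<in> \<phi> ` U \<times> \<psi> ` V" using pq by auto
    fix z assume "z \<in> \<phi> ` U \<times> \<psi> ` V"
    then obtain a b where z: "z = (a, b)" "a \<in> \<phi> ` U" "b \<in> \<psi> ` V" by (cases z) blast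
    show "(?F (fst z), ?G (snd z)) = (\<theta>' \<circ> (\<lambda>(x, y). (f x, g y)) \<circ> inv_into U' \<phi>') z"
      using inv_into_map_prod[OF chart_inj[OF M1 U] chart_inj[OF M2 V] z(2,3)] by (simp add: eq z(1))
  qed
  then show "(\<theta>' \<circ> (\<lambda>(x, y). (f x, g y)) \<circ> inv_into U' \<phi>') differentiable (at (\<phi>' (p, q)))"
    unfolding differentiable_def by (auto simp: eq)
qed

text \<open>Writing the derivative of a left translation as a partial derivative of the joint
  multiplication makes its dependence on \<open>n\<close> visible; this yields continuity of
  velocities below.\<close>

lemma left_mult_chart_derivative:
  assumes N: "banach_lie_group N MN" and c1: "(U1, \<phi>1) \<in> atlas MN" "n \<in> U1"
    and c2: "(U2, \<phi>2) \<in> atlas MN" "y \<in> U2" and c3: "(U3, \<phi>3) \<in> atlas MN" "n \<otimes>\<^bsub>N\<^esub> y \<in> U3"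
  shows "((\<phi>3 \<circ> (\<lambda>y. n \<otimes>\<^bsub>N\<^esub> y) \<circ> inv_into U2 \<phi>2) has_derivative
    (\<lambda>v. frechet_derivative (\<phi>3 \<circ> (\<lambda>(x, y). x \<otimes>\<^bsub>N\<^esub> y) \<circ> inv_into (U1 \<times> U2) (map_prod \<phi>1 \<phi>2))
      (at (\<phi>1 n, \<phi>2 y)) (0, v))) (at (\<phi>2 y))"
proof -
  let ?F = "\<phi>3 \<circ> (\<lambda>(x, y). x \<otimes>\<^bsub>N\<^esub> y) \<circ> inv_into (U1 \<times> U2) (map_prod \<phi>1 \<phi>2)"
  note M = blg_manifold[OF N]
  have "(\<phi>1 n, \<phi>2 y) \<in> map_prod \<phi>1 \<phi>2 ` (U1 \<times> U2 \<inter> (\<lambda>(x, y). x \<otimes>\<^bsub>N\<^esub> y) -` U3)"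
    using c1 c2 c3 by (intro image_eqI[of _ _ "(n, y)"]) auto
  from smooth_on_differentiable[OF mult_chart_smooth[OF N c1(1) c2(1) c3(1)] this]
  have F: "(?F has_derivative frechet_derivative ?F (at (\<phi>1 n, \<phi>2 y))) (at (\<phi>1 n, \<phi>2 y))"
    using frechet_derivative_works by blast
  have "((\<lambda>b. (\<phi>1 n, b)) has_derivative (\<lambda>h. (0, h))) (at (\<phi>2 y))" by (auto intro!: derivative_eq_intros)
  from has_derivative_compose[OF this F]
  show ?thesis
  proof (rule has_derivative_transform_within_open)
    show "open (\<phi>2 ` U2)" by (rule chart_image_open[OF M c2(1)])
    show "\<phi>2 y \<in> \<phi>2 ` U2" using c2 by auto
    fix b assume b: "b \<in> \<phi>2 ` U2"
    have "inv_into (U1 \<times> U2) (map_prod \<phi>1 \<phi>2) (\<phi>1 n, b) = (n, inv_into U2 \<phi>2 b)"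
      using inv_into_map_prod[OF chart_inj[OF M c1(1)] chart_inj[OF M c2(1)] _ b, of "\<phi>1 n"] c1
        inv_into_f_f[OF chart_inj[OF M c1(1)] c1(2)] by auto
    then show "?F (\<phi>1 n, b) = (\<phi>3 \<circ> (\<lambda>y. n \<otimes>\<^bsub>N\<^esub> y) \<circ> inv_into U2 \<phi>2) b" by simp
  qed
qed

lemma mdiff_left_mult:
  assumes N: "banach_lie_group N MN" and n: "n \<in> carrier N"
  shows "mdiff MN MN (\<lambda>y. n \<otimes>\<^bsub>N\<^esub> y) y"
  unfolding mdiff_def
proof (intro allI impI)
  fix U2 \<phi>2 U3 \<phi>3 assume c: "(U2, \<phi>2) \<in> atlas MN" "(U3, \<phi>3) \<in> atlas MN" "y \<in> U2" "n \<otimes>\<^bsub>N\<^esub> y \<in> U3"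
  obtain U1 \<phi>1 where "(U1, \<phi>1) \<in> atlas MN" "n \<in> U1"
    using chart_exists[OF blg_manifold[OF N]] blg_topspace[OF N] n by blast
  from left_mult_chart_derivative[OF N this c(1,3,2,4)]
  show "(\<phi>3 \<circ> (\<lambda>y. n \<otimes>\<^bsub>N\<^esub> y) \<circ> inv_into U2 \<phi>2) differentiable (at (\<phi>2 y))"
    unfolding differentiable_def by blast
qed

text \<open>From \<open>\<beta> (t + s) = \<beta> t \<otimes> y s\<close>, where \<open>y s\<close>
  is the left quotient, the velocity in any chart is a partial derivative of the multiplication at
  \<open>(\<beta> t, \<one>)\<close> applied to \<open>X t\<close>. It is continuous in
  \<open>t\<close> because the multiplication is jointly smooth and \<open>X\<close> is
  continuous.\<close>

lemma C1_curve_of_log_derivative: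
  assumes N: "banach_lie_group N MN" and c: "(U, \<phi>) \<in> atlas MN" "\<one>\<^bsub>N\<^esub> \<in> U"
    and \<beta>: "\<And>t. \<beta> t \<in> carrier N" and lim: "\<And>t. limitin (mfd_top MN) \<beta> (\<beta> t) (at t)"
    and U: "\<And>t. \<forall>\<^sub>F s in at 0. inv\<^bsub>N\<^esub> (\<beta> t) \<otimes>\<^bsub>N\<^esub> \<beta> (t + s) \<in> U"
    and X: "\<And>t. ((\<lambda>s. \<phi> (inv\<^bsub>N\<^esub> (\<beta> t) \<otimes>\<^bsub>N\<^esub> \<beta> (t + s))) has_vector_derivative X t) (at 0)"
    and cX: "continuous_on UNIV X"
  shows "C1_curve MN I \<beta>"
proof -
  interpret group N by (rule blg_group[OF N])
  note M = blg_manifold[OF N]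
  have limI: "limitin (mfd_top MN) \<beta> (\<beta> t) (at t within S)" for t S
    by (rule limitin_within[OF lim])
  show ?thesis
    unfolding C1_curve_def
  proof (intro conjI ballI)
    show "continuous_map (top_of_set I) (mfd_top MN) \<beta>" by (rule limitin_continuous_map_curve[OF limI])
    fix c' assume c'_in: "c' \<in> atlas MN"
    obtain U' \<phi>' where c'_eq: "c' = (U', \<phi>')" by (cases c')
    have c': "(U', \<phi>') \<in> atlas MN" using c'_in c'_eq by simp
    define F where "F = \<phi>' \<circ> (\<lambda>(x, y). x \<otimes>\<^bsub>N\<^esub> y) \<circ> inv_into (U' \<times> U) (map_prod \<phi>' \<phi>)"
    define W where "W = map_prod \<phi>' \<phi> ` (U' \<times> U \<inter> (\<lambda>(x, y). x \<otimes>\<^bsub>N\<^esub> y) -` U')"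
    have F: "smooth_on W F" unfolding W_def F_def by (rule mult_chart_smooth[OF N c' c(1) c'])
    define D where "D t = frechet_derivative F (at (\<phi>' (\<beta> t), \<phi> \<one>\<^bsub>N\<^esub>)) (0, X t)" for t
    have W: "(\<phi>' (\<beta> t), \<phi> \<one>\<^bsub>N\<^esub>) \<in> W" if "\<beta> t \<in> U'" for t
      unfolding W_def using that c(2) \<beta> by (intro image_eqI[of _ _ "(\<beta> t, \<one>\<^bsub>N\<^esub>)"]) auto
    have Dc: "continuous_on (I \<inter> \<beta> -` U') D"
      unfolding continuous_on_def
    proof
      fix t assume t: "t \<in> I \<inter> \<beta> -` U'"
      show "(D \<longlongrightarrow> D t) (at t within I \<inter> \<beta> -` U')"
        unfolding D_def
      proof (rule smooth_on_derivative_tendsto[OF F W])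
        show "\<beta> t \<in> U'" using t by auto
        have "((\<lambda>s. \<phi>' (\<beta> s)) \<longlongrightarrow> \<phi>' (\<beta> t)) (at t within I \<inter> \<beta> -` U')"
          by (rule chart_tendsto[OF M c' limI]) (use t in auto)
        then show "((\<lambda>s. (\<phi>' (\<beta> s), \<phi> \<one>\<^bsub>N\<^esub>)) \<longlongrightarrow> (\<phi>' (\<beta> t), \<phi> \<one>\<^bsub>N\<^esub>)) (at t within I \<inter> \<beta> -` U')"
          by (intro tendsto_Pair tendsto_const)
        have "continuous_on (I \<inter> \<beta> -` U') X" by (rule continuous_on_subset[OF cX]) simp
        then have "(X \<longlongrightarrow> X t) (at t within I \<inter> \<beta> -` U')" using t unfolding continuous_on_def by blast
        then show "((\<lambda>s. (0, X s)) \<longlongrightarrow> (0, X t)) (at t within I \<inter> \<beta> -` U')"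
          by (intro tendsto_Pair tendsto_const)
      qed
    qed
    have Dd: "((\<phi>' \<circ> \<beta>) has_vector_derivative D t) (at t within I)" if t: "\<beta> t \<in> U'" for t
    proof (rule has_vector_derivative_shift)
      let ?y = "\<lambda>s. inv\<^bsub>N\<^esub> (\<beta> t) \<otimes>\<^bsub>N\<^esub> \<beta> (t + s)"
      have y0: "?y 0 = \<one>\<^bsub>N\<^esub>" using \<beta> by simp
      have "((\<lambda>s. \<phi>' (\<beta> t \<otimes>\<^bsub>N\<^esub> ?y s)) has_vector_derivative D t) (at 0)"
        unfolding D_def F_def
        by (rule curve_chain[OF X chart_inj[OF M c(1)] _ U, where D = "\<lambda>v. frechet_derivative
            (\<phi>' \<circ> (\<lambda>(x, y). x \<otimes>\<^bsub>N\<^esub> y) \<circ> inv_into (U' \<times> U) (map_prod \<phi>' \<phi>)) (at (\<phi>' (\<beta> t), \<phi> \<one>\<^bsub>N\<^esub>)) (0, v)"])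
          (use y0 c t \<beta> left_mult_chart_derivative[OF N c' t c c'] in auto)
      moreover have "\<beta> t \<otimes>\<^bsub>N\<^esub> ?y s = \<beta> (t + s)" for s using \<beta> by (simp flip: m_assoc)
      ultimately show "((\<lambda>s. (\<phi>' \<circ> \<beta>) (t + s)) has_vector_derivative D t) (at 0)" by simp
    qed
    have "\<exists>D. continuous_on (I \<inter> \<beta> -` U') D \<and>
        (\<forall>t\<in>I \<inter> \<beta> -` U'. ((\<phi>' \<circ> \<beta>) has_vector_derivative D t) (at t within I))"
      using Dc Dd by auto
    then show "case c' of (U, \<phi>) \<Rightarrow> \<exists>D. continuous_on (I \<inter> \<beta> -` U) D \<and>
        (\<forall>t\<in>I \<inter> \<beta> -` U. ((\<phi> \<circ> \<beta>) has_vector_derivative D t) (at t within I))"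
      by (simp add: c'_eq)
  qed
qed

lemma C1_curve_prod:
  assumes "C1_curve M1 I \<beta>" "C1_curve M2 I \<alpha>"
  shows "C1_curve (prod_manifold M1 M2) I (\<lambda>t. (\<beta> t, \<alpha> t))"
  unfolding C1_curve_def
proof (intro conjI ballI)
  show "continuous_map (top_of_set I) (mfd_top (prod_manifold M1 M2)) (\<lambda>t. (\<beta> t, \<alpha> t))"
    using assms by (simp add: prod_manifold_def C1_curve_def continuous_map_pairedI)
  fix c assume "c \<in> atlas (prod_manifold M1 M2)"
  then obtain U \<phi> V \<psi> where c: "c = (U \<times> V, map_prod \<phi> \<psi>)" and U: "(U, \<phi>) \<in> atlas M1" and V: "(V, \<psi>) \<in> atlas M2"
    by (auto simp: prod_manifold_def)
  obtain D1 where D1: "continuous_on (I \<inter> \<beta> -` U) D1"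
    "\<And>t. t \<in> I \<inter> \<beta> -` U \<Longrightarrow> ((\<phi> \<circ> \<beta>) has_vector_derivative D1 t) (at t within I)"
    using assms(1) U unfolding C1_curve_def by blast
  obtain D2 where D2: "continuous_on (I \<inter> \<alpha> -` V) D2"
    "\<And>t. t \<in> I \<inter> \<alpha> -` V \<Longrightarrow> ((\<psi> \<circ> \<alpha>) has_vector_derivative D2 t) (at t within I)"
    using assms(2) V unfolding C1_curve_def by blast
  let ?\<eta> = "\<lambda>t. (\<beta> t, \<alpha> t)"
  have "continuous_on (I \<inter> ?\<eta> -` (U \<times> V)) (\<lambda>t. (D1 t, D2 t))"
    by (intro continuous_on_Pair continuous_on_subset[OF D1(1)] continuous_on_subset[OF D2(1)]) auto
  moreover have "((map_prod \<phi> \<psi> \<circ> ?\<eta>) has_vector_derivative (D1 t, D2 t)) (at t within I)"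
    if "t \<in> I \<inter> ?\<eta> -` (U \<times> V)" for t
    using has_vector_derivative_Pair[OF D1(2)[of t] D2(2)[of t]] that by (simp add: o_def)
  ultimately show "case c of (U, \<phi>) \<Rightarrow> \<exists>D. continuous_on (I \<inter> ?\<eta> -` U) D \<and>
      (\<forall>t\<in>I \<inter> ?\<eta> -` U. ((\<phi> \<circ> ?\<eta>) has_vector_derivative D t) (at t within I))"
    unfolding c by (auto intro!: exI[of _ "\<lambda>t. (D1 t, D2 t)"])
qed

section \<open>Exponential function of the semidirect product\<close>

lemma smooth_action_facts:
  fixes N :: "('n, 'c) monoid_scheme" and MN :: "('n, 'e::banach) manifold"
    and G :: "('g, 'd) monoid_scheme"
  assumes N: "group N" and G: "group G" and \<pi>: "\<pi> \<in> hom G (lie_Aut N MN)"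
  shows "g \<in> carrier G \<Longrightarrow> \<pi> g \<in> hom N N"
    and "g \<in> carrier G \<Longrightarrow> smooth_map MN MN (\<pi> g)"
    and "g \<in> carrier G \<Longrightarrow> h \<in> carrier G \<Longrightarrow> x \<in> carrier N \<Longrightarrow> \<pi> (g \<otimes>\<^bsub>G\<^esub> h) x = \<pi> g (\<pi> h x)"
    and "x \<in> carrier N \<Longrightarrow> \<pi> \<one>\<^bsub>G\<^esub> x = x"
proof -
  interpret G: group G by (rule G)
  have au: "\<pi> g \<in> auto N" and sm: "smooth_map MN MN (\<pi> g)" if "g \<in> carrier G" for g
    using \<pi> that by (auto simp: hom_def lie_Aut_def)
  show "\<pi> g \<in> hom N N" if "g \<in> carrier G" for g using au[OF that] by (simp add: auto_def)
  show "smooth_map MN MN (\<pi> g)" if "g \<in> carrier G" for g using sm[OF that] .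
  have bij: "\<pi> g \<in> Bij (carrier N)" if "g \<in> carrier G" for g using au[OF that] by (simp add: auto_def)
  have m: "\<pi> (g \<otimes>\<^bsub>G\<^esub> h) x = \<pi> g (\<pi> h x)" if "g \<in> carrier G" "h \<in> carrier G" "x \<in> carrier N" for g h x
  proof -
    have "\<pi> (g \<otimes>\<^bsub>G\<^esub> h) = \<pi> g \<otimes>\<^bsub>lie_Aut N MN\<^esub> \<pi> h" using \<pi> that by (simp add: hom_def)
    also have "\<dots> = compose (carrier N) (\<pi> g) (\<pi> h)"
      using bij that by (simp add: lie_Aut_def AutoGroup_def BijGroup_def)
    finally show ?thesis using that by (simp add: compose_eq)
  qed
  then show "\<pi> (g \<otimes>\<^bsub>G\<^esub> h) x = \<pi> g (\<pi> h x)" if "g \<in> carrier G" "h \<in> carrier G" "x \<in> carrier N" for g h x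
    using that by blast
  \<comment> \<open>An idempotent injective self-map of the carrier is the identity there.\<close>
  show "\<pi> \<one>\<^bsub>G\<^esub> x = x" if x: "x \<in> carrier N" for x
  proof -
    have b: "bij_betw (\<pi> \<one>\<^bsub>G\<^esub>) (carrier N) (carrier N)" using bij[OF G.one_closed] by (simp add: Bij_def)
    have "\<pi> \<one>\<^bsub>G\<^esub> x \<in> carrier N" using b x bij_betwE by blast
    moreover have "\<pi> \<one>\<^bsub>G\<^esub> (\<pi> \<one>\<^bsub>G\<^esub> x) = \<pi> \<one>\<^bsub>G\<^esub> x" using m[of "\<one>\<^bsub>G\<^esub>" "\<one>\<^bsub>G\<^esub>" x] x by simp
    ultimately show ?thesis using bij_betw_imp_inj_on[OF b] x by (meson inj_onD)
  qed
qed

lemma unit_interval_nontrivial: "t \<in> {0..1} \<Longrightarrow> at t within {0..1::real} \<noteq> bot"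
  by (simp add: trivial_limit_within islimpt_Icc)

lemma has_vector_derivative_at_right_shift:
  fixes F :: "real \<Rightarrow> 'v::real_normed_vector"
  assumes d: "(F has_vector_derivative w) (at t within {0..1})" and t: "0 \<le> t" "t < 1" and e: "e > 0"
  shows "\<forall>\<^sub>F u in at_right 0. norm (F (t + u) - F t - u *\<^sub>R w) \<le> e * \<bar>u\<bar>"
proof -
  have "\<forall>\<^sub>F s in at t within {0..1}. norm (F s - F t - (s - t) *\<^sub>R w) \<le> e * \<bar>s - t\<bar>"
    using d e unfolding has_vector_derivative_def has_derivative_within_alt2 by auto
  then obtain \<delta> where \<delta>: "\<delta> > 0" "\<And>s. s \<in> {0..1} \<Longrightarrow> s \<noteq> t \<Longrightarrow> dist s t < \<delta> \<Longrightarrow>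
      norm (F s - F t - (s - t) *\<^sub>R w) \<le> e * \<bar>s - t\<bar>"
    unfolding eventually_at by blast
  show ?thesis
    unfolding eventually_at_right_field
  proof (intro exI[of _ "min \<delta> (1 - t)"] conjI allI impI)
    fix u assume "0 < u" "u < min \<delta> (1 - t)"
    then show "norm (F (t + u) - F t - u *\<^sub>R w) \<le> e * \<bar>u\<bar>"
      using \<delta>(2)[of "t + u"] t by (auto simp: dist_real_def)
  qed (use \<delta> t in auto)
qed

text \<open>
  The chart of the product around the identity is the one selected by the choice operator in
  \<^const>\<open>tangent_map\<close>.
\<close>

locale semidirect_lie = local_action N "mfd_top MN" ON "\<lambda>x. \<phi> x - \<phi> \<one>\<^bsub>N\<^esub>" RN rN CN DN
    G "mfd_top MG" OG "\<lambda>x. \<psi> x - \<psi> \<one>\<^bsub>G\<^esub>" RG rG CG DG \<pi> A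
  for N :: "('n, 'c) monoid_scheme" and MN :: "('n, 'e::banach) manifold" and ON :: "'n set"
    and \<phi> :: "'n \<Rightarrow> 'e" and RN rN CN :: real and DN :: "'e \<Rightarrow> 'e \<Rightarrow> 'e"
    and G :: "('g, 'd) monoid_scheme" and MG :: "('g, 'f::banach) manifold" and OG :: "'g set"
    and \<psi> :: "'g \<Rightarrow> 'f" and RG rG CG :: real and DG :: "'f \<Rightarrow> 'f \<Rightarrow> 'f"
    and \<pi> :: "'g \<Rightarrow> 'n \<Rightarrow> 'n" and A :: "'g \<Rightarrow> 'e \<Rightarrow> 'e" +
  assumes blgN: "banach_lie_group N MN" and blgG: "banach_lie_group G MG"
    and smooth_pi: "g \<in> carrier G \<Longrightarrow> smooth_map MN MN (\<pi> g)"
    and c0: "(SOME c. c \<in> atlas (prod_manifold MN MG) \<and> (\<one>\<^bsub>N\<^esub>, \<one>\<^bsub>G\<^esub>) \<in> fst c) = (ON \<times> OG, map_prod \<phi> \<psi>)"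
    and chartN: "(ON, \<phi>) \<in> atlas MN" and chartG: "(OG, \<psi>) \<in> atlas MG"
begin

section \<open>Left translations, one-parameter groups and the exponential equation in charts of the
  product\<close>

abbreviation M0 where "M0 \<equiv> prod_manifold MN MG"
abbreviation \<Theta> where "\<Theta> \<equiv> map_prod \<phi> \<psi>"
abbreviation O0 where "O0 \<equiv> ON \<times> OG"

lemma M0_simps: "mfd_top M0 = prod_topology (mfd_top MN) (mfd_top MG)"
    "(O0, \<Theta>) \<in> atlas M0" "inj_on \<Theta> O0"
  using chartN chartG chart_inj[OF blg_manifold[OF blgN] chartN] chart_inj[OF blg_manifold[OF blgG] chartG]
  by (auto simp: prod_manifold_def map_prod_inj_on)

lemma M0_chart: "(U, \<theta>) \<in> atlas M0 \<Longrightarrow> inj_on \<theta> U \<and> openin (mfd_top M0) U"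
proof -
  assume "(U, \<theta>) \<in> atlas M0"
  then obtain V \<phi>' W \<psi>' where eq: "U = V \<times> W" "\<theta> = map_prod \<phi>' \<psi>'"
    and V: "(V, \<phi>') \<in> atlas MN" and W: "(W, \<psi>') \<in> atlas MG"
    by (auto simp: prod_manifold_def)
  note MN = blg_manifold[OF blgN] and MG = blg_manifold[OF blgG]
  show ?thesis unfolding eq M0_simps
    using chart_inj[OF MN V] chart_inj[OF MG W] chart_open[OF MN V] chart_open[OF MG W]
    by (simp add: map_prod_inj_on openin_prod_Times_iff)
qed

lemma M0_chart_exists: "h \<in> carrier H \<Longrightarrow> \<exists>U \<theta>. (U, \<theta>) \<in> atlas M0 \<and> h \<in> U"
proof -
  assume "h \<in> carrier H"
  then obtain n g where h: "h = (n, g)" "n \<in> carrier N" "g \<in> carrier G" by (auto simp: H_simps)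
  obtain V \<phi>' where V: "(V, \<phi>') \<in> atlas MN" "n \<in> V"
    using chart_exists[OF blg_manifold[OF blgN]] N.topsp h by blast
  obtain W \<psi>' where W: "(W, \<psi>') \<in> atlas MG" "g \<in> W"
    using chart_exists[OF blg_manifold[OF blgG]] G.topsp h by blast
  have "(V \<times> W, map_prod \<phi>' \<psi>') \<in> atlas M0" using V W by (auto simp: prod_manifold_def)
  then show ?thesis using V W h by blast
qed

text \<open>For fixed \<open>h = (n, g)\<close> the translation is the product of the maps
  \<open>x \<mapsto> n \<otimes> \<pi> g x\<close> and \<open>y \<mapsto> g \<otimes> y\<close>, so
  differentiability follows from smoothness of the single automorphism \<open>\<pi> g\<close> and of
  the two multiplications.\<close>

lemma mdiff_translate:
  assumes "h \<in> carrier H" "p \<in> carrier H"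
  shows "mdiff M0 M0 (\<lambda>x. h \<otimes>\<^bsub>H\<^esub> x) p"
proof -
  obtain n g where h: "h = (n, g)" "n \<in> carrier N" "g \<in> carrier G" using assms by (auto simp: H_simps)
  obtain x y where p: "p = (x, y)" using assms by (cases p)
  have cont: "continuous_map (mfd_top MN) (mfd_top MN) (\<pi> g)"
    using smooth_pi[OF h(3)] unfolding smooth_map_def by blast
  have "mdiff MN MN (\<lambda>x. n \<otimes>\<^bsub>N\<^esub> \<pi> g x) x"
    by (rule mdiff_compose[OF blg_manifold[OF blgN] blg_manifold[OF blgN] cont smooth_map_mdiff[OF smooth_pi[OF h(3)]]
        mdiff_left_mult[OF blgN h(2)]])
  from mdiff_prod[OF blg_manifold[OF blgN] blg_manifold[OF blgG] this mdiff_left_mult[OF blgG h(3)]]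
  have "mdiff M0 M0 (\<lambda>(x, y). (n \<otimes>\<^bsub>N\<^esub> \<pi> g x, g \<otimes>\<^bsub>G\<^esub> y)) (x, y)" .
  moreover have "(\<lambda>(x, y). (n \<otimes>\<^bsub>N\<^esub> \<pi> g x, g \<otimes>\<^bsub>G\<^esub> y)) = (\<lambda>x. h \<otimes>\<^bsub>H\<^esub> x)"
    by (auto simp: h H_simps)
  ultimately show ?thesis by (simp add: p)
qed

text \<open>\<open>transl h U \<theta>\<close> is the tangent map at the identity of the left translation by \<open>h\<close>, in charts.\<close>

definition transl :: "('n \<times> 'g) \<Rightarrow> ('n \<times> 'g) set \<Rightarrow> ('n \<times> 'g \<Rightarrow> 'e \<times> 'f) \<Rightarrow> 'e \<times> 'f \<Rightarrow> 'e \<times> 'f" where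
  "transl h U \<theta> = frechet_derivative (\<theta> \<circ> (\<lambda>x. h \<otimes>\<^bsub>H\<^esub> x) \<circ> inv_into O0 \<Theta>) (at (\<Theta> \<one>\<^bsub>H\<^esub>))"

text \<open>\<open>c0\<close> evaluates the choice operator in \<open>tangent_map\<close>, so a
  tangent vector at the identity enters only through its coordinates in the chart on which the local
  analysis is built.\<close>

lemma left_translate_eq:
  assumes "h \<in> carrier H"
  shows "left_translate H M0 h x = (\<lambda>(U, \<theta>). if (U, \<theta>) \<in> atlas M0 \<and> h \<in> U then transl h U \<theta> (x (O0, \<Theta>)) else 0)"
proof -
  interpret H: group H by (rule H_group)
  show ?thesis
    unfolding left_translate_def tangent_map_def transl_def
    using c0 assms by (auto simp: H_simps fun_eq_iff pi_one_N)
qed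

lemma one_par_derivative:
  assumes op: "one_par \<beta> \<alpha> w a"
  shows "((\<lambda>s. \<Theta> (\<beta> s, \<alpha> s)) has_vector_derivative (w, a)) (at 0)"
    and "\<forall>\<^sub>F s in at 0. (\<beta> s, \<alpha> s) \<in> O0"
proof -
  have 1: "(\<forall>\<^sub>F s in at 0. \<beta> s \<in> ON) \<and> ((\<lambda>s. \<phi> (\<beta> s) - \<phi> \<one>\<^bsub>N\<^esub>) has_vector_derivative w) (at 0)"
    using N.tang_iff_derivative[of \<beta> UNIV w] one_par_zero[OF op] one_par_tang[OF op] by simp
  have 2: "(\<forall>\<^sub>F s in at 0. \<alpha> s \<in> OG) \<and> ((\<lambda>s. \<psi> (\<alpha> s) - \<psi> \<one>\<^bsub>G\<^esub>) has_vector_derivative a) (at 0)"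
    using G.tang_iff_derivative[of \<alpha> UNIV a] one_par_zero[OF op] one_par_tang[OF op] by simp
  have "((\<lambda>s. (\<phi> (\<beta> s) - \<phi> \<one>\<^bsub>N\<^esub> + \<phi> \<one>\<^bsub>N\<^esub>, \<psi> (\<alpha> s) - \<psi> \<one>\<^bsub>G\<^esub> + \<psi> \<one>\<^bsub>G\<^esub>)) has_vector_derivative (w + 0, a + 0)) (at 0)"
    using 1 2 by (intro has_vector_derivative_Pair has_vector_derivative_add has_vector_derivative_const) auto
  then show "((\<lambda>s. \<Theta> (\<beta> s, \<alpha> s)) has_vector_derivative (w, a)) (at 0)" by simp
  show "\<forall>\<^sub>F s in at 0. (\<beta> s, \<alpha> s) \<in> O0"
    using conjunct1[OF 1] conjunct1[OF 2] by eventually_elim simp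
qed

lemma one_par_translate_derivative:
  assumes op: "one_par \<beta> \<alpha> w a" and h: "h \<in> carrier H" and U: "(U, \<theta>) \<in> atlas M0" "h \<in> U"
  shows "((\<lambda>s. \<theta> (h \<otimes>\<^bsub>H\<^esub> (\<beta> s, \<alpha> s))) has_vector_derivative transl h U \<theta> (w, a)) (at 0)"
proof -
  interpret H: group H by (rule H_group)
  have z: "(\<beta> 0, \<alpha> 0) = \<one>\<^bsub>H\<^esub>" using one_par_zero[OF op] by (simp add: H_simps)
  have o: "\<one>\<^bsub>H\<^esub> \<in> O0" using N.oneU G.oneU by (simp add: H_simps)
  show ?thesis
  proof (rule curve_chain[where \<phi> = \<Theta> and \<psi> = \<theta> and f = "\<lambda>x. h \<otimes>\<^bsub>H\<^esub> x",
        OF one_par_derivative(1)[OF op] M0_simps(3) _ one_par_derivative(2)[OF op]])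
    show "(\<theta> \<circ> (\<lambda>x. h \<otimes>\<^bsub>H\<^esub> x) \<circ> inv_into O0 \<Theta> has_derivative transl h U \<theta>) (at (\<Theta> (\<beta> 0, \<alpha> 0)))"
      unfolding z transl_def
      by (rule mdiffD[OF mdiff_translate[OF h H.one_closed] M0_simps(2) U(1) o]) (use h U in simp)
  qed (use z o in auto)
qed

lemma one_par_curve_derivative:
  assumes op: "one_par \<beta> \<alpha> w a" and U: "(U, \<theta>) \<in> atlas M0" "(\<beta> t, \<alpha> t) \<in> U"
  shows "((\<theta> \<circ> (\<lambda>t. (\<beta> t, \<alpha> t))) has_vector_derivative transl (\<beta> t, \<alpha> t) U \<theta> (w, a)) (at t within I)"
proof (rule has_vector_derivative_shift)
  have "(\<beta> t, \<alpha> t) \<in> carrier H" using one_par_carrier[OF op] by (simp add: H_simps)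
  from one_par_translate_derivative[OF op this U]
  show "((\<lambda>s. (\<theta> \<circ> (\<lambda>t. (\<beta> t, \<alpha> t))) (t + s)) has_vector_derivative transl (\<beta> t, \<alpha> t) U \<theta> (w, a)) (at 0)"
    using one_par_add[OF op, of t] by (simp add: H_simps)
qed

text \<open>Each component is handled in its own Lie group: the logarithmic derivatives are
  \<open>A (\<alpha> t) w\<close> and the constant \<open>a\<close>, both continuous in
  \<open>t\<close>.\<close>

lemma one_par_C1:
  assumes op: "one_par \<beta> \<alpha> w a"
  shows "C1_curve M0 I (\<lambda>t. (\<beta> t, \<alpha> t))"
proof (rule C1_curve_prod)
  have der: "((\<lambda>s. \<phi> (inv\<^bsub>N\<^esub> (\<beta> t) \<otimes>\<^bsub>N\<^esub> \<beta> (t + s))) has_vector_derivative A (\<alpha> t) w) (at 0)"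
    and ev: "\<forall>\<^sub>F s in at 0. inv\<^bsub>N\<^esub> (\<beta> t) \<otimes>\<^bsub>N\<^esub> \<beta> (t + s) \<in> ON" for t
  proof -
    have *: "(\<forall>\<^sub>F s in at 0. inv\<^bsub>N\<^esub> (\<beta> t) \<otimes>\<^bsub>N\<^esub> \<beta> (t + s) \<in> ON) \<and>
        ((\<lambda>s. \<phi> (inv\<^bsub>N\<^esub> (\<beta> t) \<otimes>\<^bsub>N\<^esub> \<beta> (t + s)) - \<phi> \<one>\<^bsub>N\<^esub>) has_vector_derivative A (\<alpha> t) w) (at 0)"
      using N.tang_iff_derivative[of "\<lambda>s. inv\<^bsub>N\<^esub> (\<beta> t) \<otimes>\<^bsub>N\<^esub> \<beta> (t + s)" UNIV] one_par_log(2)[OF op, of t]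
        one_par_carrier[OF op] by simp
    from has_vector_derivative_add[OF conjunct2[OF *] has_vector_derivative_const[of "\<phi> \<one>\<^bsub>N\<^esub>"]]
    show "((\<lambda>s. \<phi> (inv\<^bsub>N\<^esub> (\<beta> t) \<otimes>\<^bsub>N\<^esub> \<beta> (t + s))) has_vector_derivative A (\<alpha> t) w) (at 0)" by simp
    show "\<forall>\<^sub>F s in at 0. inv\<^bsub>N\<^esub> (\<beta> t) \<otimes>\<^bsub>N\<^esub> \<beta> (t + s) \<in> ON" using * by blast
  qed
  show "C1_curve MN I \<beta>"
    by (rule C1_curve_of_log_derivative[OF blgN chartN N.oneU one_par_carrier(1)[OF op] one_par_lim(2)[OF op] ev der
          one_par_A_continuous[OF op]])
  have der: "((\<lambda>s. \<psi> (inv\<^bsub>G\<^esub> (\<alpha> t) \<otimes>\<^bsub>G\<^esub> \<alpha> (t + s))) has_vector_derivative a) (at 0)"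
    and ev: "\<forall>\<^sub>F s in at 0. inv\<^bsub>G\<^esub> (\<alpha> t) \<otimes>\<^bsub>G\<^esub> \<alpha> (t + s) \<in> OG" for t
  proof -
    have *: "(\<forall>\<^sub>F s in at 0. inv\<^bsub>G\<^esub> (\<alpha> t) \<otimes>\<^bsub>G\<^esub> \<alpha> (t + s) \<in> OG) \<and>
        ((\<lambda>s. \<psi> (inv\<^bsub>G\<^esub> (\<alpha> t) \<otimes>\<^bsub>G\<^esub> \<alpha> (t + s)) - \<psi> \<one>\<^bsub>G\<^esub>) has_vector_derivative a) (at 0)"
      using G.tang_iff_derivative[of "\<lambda>s. inv\<^bsub>G\<^esub> (\<alpha> t) \<otimes>\<^bsub>G\<^esub> \<alpha> (t + s)" UNIV] one_par_log(1)[OF op, of t]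
        one_par_carrier[OF op] by simp
    from has_vector_derivative_add[OF conjunct2[OF *] has_vector_derivative_const[of "\<psi> \<one>\<^bsub>G\<^esub>"]]
    show "((\<lambda>s. \<psi> (inv\<^bsub>G\<^esub> (\<alpha> t) \<otimes>\<^bsub>G\<^esub> \<alpha> (t + s))) has_vector_derivative a) (at 0)" by simp
    show "\<forall>\<^sub>F s in at 0. inv\<^bsub>G\<^esub> (\<alpha> t) \<otimes>\<^bsub>G\<^esub> \<alpha> (t + s) \<in> OG" using * by blast
  qed
  show "C1_curve MG I \<alpha>"
    by (rule C1_curve_of_log_derivative[OF blgG chartG G.oneU one_par_carrier(2)[OF op] one_par_lim(1)[OF op] ev der])
      (rule continuous_on_const)
qed

lemma one_par_exp_solution:
  assumes op: "one_par \<beta> \<alpha> w a" and x: "x (O0, \<Theta>) = (w, a)"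
  shows "exp_solution H M0 x (\<lambda>t. (\<beta> t, \<alpha> t))"
  unfolding exp_solution_def
proof (intro conjI ballI)
  show "C1_curve M0 {0..1} (\<lambda>t. (\<beta> t, \<alpha> t))" by (rule one_par_C1[OF op])
  show "(\<beta> 0, \<alpha> 0) = \<one>\<^bsub>H\<^esub>" using one_par_zero[OF op] by (simp add: H_simps)
  fix t :: real assume t: "t \<in> {0..1}"
  have c: "(\<beta> t, \<alpha> t) \<in> carrier H" using one_par_carrier[OF op] by (simp add: H_simps)
  have "vector_derivative (\<theta> \<circ> (\<lambda>t. (\<beta> t, \<alpha> t))) (at t within {0..1}) = transl (\<beta> t, \<alpha> t) U \<theta> (w, a)"
    if "(U, \<theta>) \<in> atlas M0" "(\<beta> t, \<alpha> t) \<in> U" for U \<theta>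
    by (rule vector_derivative_within[OF unit_interval_nontrivial[OF t] one_par_curve_derivative[OF op that]])
  then show "velocity M0 {0..1} (\<lambda>t. (\<beta> t, \<alpha> t)) t = left_translate H M0 (\<beta> t, \<alpha> t) x"
    unfolding left_translate_eq[OF c] velocity_def x by (auto simp: fun_eq_iff)
qed

text \<open>The equation is posed in all charts along the curve; translating by
  \<open>inv (\<eta> t)\<close> moves it to the chart at the identity, where the right-hand side
  becomes the constant \<open>(w, a)\<close>.\<close>

lemma exp_solution_log_derivative:
  assumes sol: "exp_solution H M0 x \<eta>" and x: "x (O0, \<Theta>) = (w, a)" and t: "t \<in> {0..1}"
  shows "\<eta> t \<in> carrier H"
    and "((\<lambda>s. \<Theta> (inv\<^bsub>H\<^esub> (\<eta> t) \<otimes>\<^bsub>H\<^esub> \<eta> s)) has_vector_derivative (w, a)) (at t within {0..1})"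
proof -
  interpret H: group H by (rule H_group)
  have cont: "continuous_map (top_of_set {0..1}) (mfd_top M0) \<eta>"
    and C1: "C1_curve M0 {0..1} \<eta>"
    using sol by (auto simp: exp_solution_def C1_curve_def)
  have "\<eta> t \<in> topspace (mfd_top M0)"
    using limitin_topspace[OF continuous_map_limitin[OF cont t]] .
  then show h: "\<eta> t \<in> carrier H" by (simp add: M0_simps N.topsp G.topsp H_simps)
  define h where "h = \<eta> t"
  have hc: "h \<in> carrier H" "inv\<^bsub>H\<^esub> h \<in> carrier H" using h by (auto simp: h_def)
  obtain U \<theta> where U: "(U, \<theta>) \<in> atlas M0" "h \<in> U" using M0_chart_exists[OF hc(1)] by blast
  define v where "v = transl h U \<theta> (w, a)"
  obtain v' where v': "((\<theta> \<circ> \<eta>) has_vector_derivative v') (at t within {0..1})"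
    using C1 U t unfolding C1_curve_def h_def by blast
  have "v' = vector_derivative (\<theta> \<circ> \<eta>) (at t within {0..1})"
    using vector_derivative_within[OF unit_interval_nontrivial[OF t] v'] by simp
  also have "\<dots> = velocity M0 {0..1} \<eta> t (U, \<theta>)" using U by (simp add: velocity_def h_def)
  also have "\<dots> = left_translate H M0 h x (U, \<theta>)" using sol t by (simp add: exp_solution_def h_def)
  also have "\<dots> = v" using left_translate_eq[OF hc(1)] U x by (simp add: v_def)
  finally have vd: "((\<lambda>s. \<theta> (\<eta> s)) has_vector_derivative v) (at t within {0..1})" using v' by (simp add: o_def)
  define D where "D = frechet_derivative (\<Theta> \<circ> (\<lambda>x. inv\<^bsub>H\<^esub> h \<otimes>\<^bsub>H\<^esub> x) \<circ> inv_into U \<theta>) (at (\<theta> h))"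
  have o: "\<one>\<^bsub>H\<^esub> \<in> O0" using N.oneU G.oneU by (simp add: H_simps)
  have D: "((\<Theta> \<circ> (\<lambda>x. inv\<^bsub>H\<^esub> h \<otimes>\<^bsub>H\<^esub> x) \<circ> inv_into U \<theta>) has_derivative D) (at (\<theta> h))"
    unfolding D_def
    by (rule mdiffD[OF mdiff_translate[OF hc(2,1)] U(1) M0_simps(2) U(2)]) (use hc o in simp)
  have ev: "\<forall>\<^sub>F s in at t within {0..1}. \<eta> s \<in> U"
    by (rule limitinD[OF continuous_map_limitin[OF cont t]]) (use M0_chart[OF U(1)] U(2) in \<open>auto simp: h_def\<close>)
  have main: "((\<lambda>s. \<Theta> (inv\<^bsub>H\<^esub> h \<otimes>\<^bsub>H\<^esub> \<eta> s)) has_vector_derivative D v) (at t within {0..1})"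
    by (rule curve_chain[OF vd _ _ ev t]) (use M0_chart[OF U(1)] U(2) D in \<open>auto simp: h_def\<close>)
  \<comment> \<open>\<open>D\<close> is inverse to \<open>transl h U \<theta>\<close>: compare the two along a one-parameter group with velocity \<open>(w, a)\<close>.\<close>
  have "D v = (w, a)"
  proof -
    obtain \<beta> \<alpha> where op: "one_par \<beta> \<alpha> w a" using one_par_exists by blast
    have oc: "(\<beta> s, \<alpha> s) \<in> carrier H" for s using one_par_carrier[OF op] by (simp add: H_simps)
    let ?\<gamma> = "\<lambda>s. h \<otimes>\<^bsub>H\<^esub> (\<beta> s, \<alpha> s)"
    have g0: "?\<gamma> 0 = h" using one_par_zero[OF op] hc H.r_one[OF hc(1)] by (simp add: H_simps)
    have lim: "limitin (mfd_top M0) ?\<gamma> h (at 0)"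
    proof -
      obtain n g where ng: "h = (n, g)" "n \<in> carrier N" "g \<in> carrier G" using hc by (auto simp: H_simps)
      have 1: "limitin (mfd_top MN) (\<lambda>s. n \<otimes>\<^bsub>N\<^esub> \<pi> g (\<beta> s)) (n \<otimes>\<^bsub>N\<^esub> \<pi> g (\<beta> 0)) (at 0)"
        by (intro N.limitin_mult limitin_pi one_par_lim[OF op]) (use ng in \<open>auto simp: N.topsp G.topsp\<close>)
      have 2: "limitin (mfd_top MG) (\<lambda>s. g \<otimes>\<^bsub>G\<^esub> \<alpha> s) (g \<otimes>\<^bsub>G\<^esub> \<alpha> 0) (at 0)"
        by (intro G.limitin_mult one_par_lim[OF op]) (use ng in \<open>auto simp: G.topsp\<close>)
      show ?thesis using 1 2 one_par_zero[OF op] ng pi_one_N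
        by (simp add: M0_simps limitin_pairwise o_def H_simps)
    qed
    have evg: "\<forall>\<^sub>F s in at 0. ?\<gamma> s \<in> U"
      by (rule limitinD[OF lim]) (use M0_chart[OF U(1)] U(2) in auto)
    have "((\<lambda>s. \<Theta> (inv\<^bsub>H\<^esub> h \<otimes>\<^bsub>H\<^esub> ?\<gamma> s)) has_vector_derivative D v) (at 0)"
      unfolding v_def
      by (rule curve_chain[OF one_par_translate_derivative[OF op hc(1) U] _ _ evg])
        (use M0_chart[OF U(1)] U(2) D g0 in auto)
    moreover have "inv\<^bsub>H\<^esub> h \<otimes>\<^bsub>H\<^esub> ?\<gamma> s = (\<beta> s, \<alpha> s)" for s
      using hc oc by (simp flip: H.m_assoc)
    ultimately have "((\<lambda>s. \<Theta> (\<beta> s, \<alpha> s)) has_vector_derivative D v) (at 0)" by simp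
    from vector_derivative_unique_at[OF this one_par_derivative(1)[OF op]] show ?thesis .
  qed
  with main show "((\<lambda>s. \<Theta> (inv\<^bsub>H\<^esub> (\<eta> t) \<otimes>\<^bsub>H\<^esub> \<eta> s)) has_vector_derivative (w, a)) (at t within {0..1})"
    by (simp add: h_def)
qed

text \<open>By \<open>H_div\<close>, the components of the translated equation are the tangency
  hypotheses of \<open>one_par_unique\<close>. Derivatives within \<open>{0..1}\<close> have to be
  restated as one-sided limits from the right first.\<close>

lemma exp_solution_unique:
  assumes sol: "exp_solution H M0 x \<eta>" and x: "x (O0, \<Theta>) = (w, a)" and op: "one_par \<beta> \<alpha> w a"
  shows "\<eta> 1 = (\<beta> 1, \<alpha> 1)"
proof -
  define \<beta>' where "\<beta>' t = fst (\<eta> t)" for t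
  define \<alpha>' where "\<alpha>' t = snd (\<eta> t)" for t
  have \<eta>: "\<eta> t = (\<beta>' t, \<alpha>' t)" for t by (simp add: \<beta>'_def \<alpha>'_def)
  have cont: "continuous_map (top_of_set {0..1}) (mfd_top M0) \<eta>"
    using sol by (simp add: exp_solution_def C1_curve_def)
  have lim: "limitin (mfd_top MN) \<beta>' (\<beta>' t) (at t within {0..1})" "limitin (mfd_top MG) \<alpha>' (\<alpha>' t) (at t within {0..1})"
    if "t \<in> {0..1}" for t
    using continuous_map_limitin[OF cont that]
    by (simp_all add: M0_simps limitin_pairwise o_def \<beta>'_def[abs_def] \<alpha>'_def[abs_def])
  have car: "\<beta>' t \<in> carrier N" "\<alpha>' t \<in> carrier G" if "t \<in> {0..1}" for t
    using limitin_topspace[OF lim(1)[OF that]] limitin_topspace[OF lim(2)[OF that]] by (auto simp: N.topsp G.topsp)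
  have init: "\<beta>' 0 = \<one>\<^bsub>N\<^esub>" "\<alpha>' 0 = \<one>\<^bsub>G\<^esub>" using sol by (auto simp: exp_solution_def H_simps \<beta>'_def \<alpha>'_def)
  have tan: "G.tang (at_right 0) (\<lambda>s. inv\<^bsub>G\<^esub> (\<alpha>' t) \<otimes>\<^bsub>G\<^esub> \<alpha>' (t + s)) a \<and>
      N.tang (at_right 0) (\<lambda>s. \<pi> (inv\<^bsub>G\<^esub> (\<alpha>' t)) (inv\<^bsub>N\<^esub> (\<beta>' t) \<otimes>\<^bsub>N\<^esub> \<beta>' (t + s))) w" if t: "0 \<le> t" "t < 1" for t
  proof -
    have ti: "t \<in> {0..1}" using t by auto
    define P where "P s = \<pi> (inv\<^bsub>G\<^esub> (\<alpha>' t)) (inv\<^bsub>N\<^esub> (\<beta>' t) \<otimes>\<^bsub>N\<^esub> \<beta>' s)" for s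
    define Q where "Q s = inv\<^bsub>G\<^esub> (\<alpha>' t) \<otimes>\<^bsub>G\<^esub> \<alpha>' s" for s
    have PQt: "P t = \<one>\<^bsub>N\<^esub>" "Q t = \<one>\<^bsub>G\<^esub>" using car[OF ti] pi_one_N by (auto simp: P_def Q_def)
    have eq: "inv\<^bsub>H\<^esub> (\<eta> t) \<otimes>\<^bsub>H\<^esub> \<eta> s = (P s, Q s)" if "s \<in> {0..1}" for s
      using H_div[OF car[OF ti] car[OF that]] by (simp add: \<eta> P_def Q_def)
    have "((\<lambda>s. (\<phi> (P s), \<psi> (Q s))) has_vector_derivative (w, a)) (at t within {0..1})"
      by (rule has_vector_derivative_transform[OF ti _ exp_solution_log_derivative(2)[OF sol x ti]]) (simp add: eq)
    then have d: "((\<lambda>s. \<phi> (P s)) has_vector_derivative w) (at t within {0..1})"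
      "((\<lambda>s. \<psi> (Q s)) has_vector_derivative a) (at t within {0..1})"
      using bounded_linear.has_vector_derivative[OF bounded_linear_fst, of "\<lambda>s. (\<phi> (P s), \<psi> (Q s))" "(w, a)"]
        bounded_linear.has_vector_derivative[OF bounded_linear_snd, of "\<lambda>s. (\<phi> (P s), \<psi> (Q s))" "(w, a)"] by auto
    have "limitin (mfd_top MN) P (P t) (at t within {0..1})"
      unfolding P_def by (intro limitin_pi N.limitin_mult lim ti) (use car[OF ti] in \<open>auto simp: N.topsp G.topsp\<close>)
    from limitinD[OF this N.openU] have evP: "\<forall>\<^sub>F s in at t within {0..1}. P s \<in> ON" using PQt N.oneU by simp
    have "limitin (mfd_top MG) Q (Q t) (at t within {0..1})"
      unfolding Q_def by (intro G.limitin_mult lim ti) (use car[OF ti] in \<open>auto simp: G.topsp\<close>)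
    from limitinD[OF this G.openU] have evQ: "\<forall>\<^sub>F s in at t within {0..1}. Q s \<in> OG" using PQt G.oneU by simp
    have shift: "\<forall>\<^sub>F u in at_right 0. S (t + u)" if ev: "\<forall>\<^sub>F s in at t within {0..1}. S s" for S
    proof -
      obtain \<delta> where \<delta>: "\<delta> > 0" "\<And>s. s \<in> {0..1} \<Longrightarrow> s \<noteq> t \<Longrightarrow> dist s t < \<delta> \<Longrightarrow> S s"
        using ev unfolding eventually_at by blast
      then show ?thesis unfolding eventually_at_right_field using t
        by (intro exI[of _ "min \<delta> (1 - t)"]) (auto simp: dist_real_def)
    qed
    have "G.tang (at_right 0) (\<lambda>s. Q (t + s)) a"
      unfolding G.tang_def
    proof (intro allI impI)
      fix e :: real assume e: "e > 0"
      show "\<forall>\<^sub>F s in at_right 0. Q (t + s) \<in> OG \<and> norm (\<psi> (Q (t + s)) - \<psi> \<one>\<^bsub>G\<^esub> - s *\<^sub>R a) \<le> e * \<bar>s\<bar>"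
        using shift[OF evQ] has_vector_derivative_at_right_shift[OF d(2) t e] by eventually_elim (simp add: PQt)
    qed
    moreover have "N.tang (at_right 0) (\<lambda>s. P (t + s)) w"
      unfolding N.tang_def
    proof (intro allI impI)
      fix e :: real assume e: "e > 0"
      show "\<forall>\<^sub>F s in at_right 0. P (t + s) \<in> ON \<and> norm (\<phi> (P (t + s)) - \<phi> \<one>\<^bsub>N\<^esub> - s *\<^sub>R w) \<le> e * \<bar>s\<bar>"
        using shift[OF evP] has_vector_derivative_at_right_shift[OF d(1) t e] by eventually_elim (simp add: PQt)
    qed
    ultimately show ?thesis by (simp add: P_def Q_def)
  qed
  have one: "(1::real) \<in> {0..1}" by simp
  have "\<alpha>' 1 = \<alpha> 1" "\<beta>' 1 = \<beta> 1"
    by (rule one_par_unique[OF op lim init conjunct1[OF tan] conjunct2[OF tan] one], assumption+)+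
  then show ?thesis by (simp add: \<eta>)
qed

lemma lie_exp_one_par:
  assumes op: "one_par \<beta> \<alpha> w a" and x: "x (O0, \<Theta>) = (w, a)"
  shows "lie_exp H M0 x = (\<beta> 1, \<alpha> 1)"
  unfolding lie_exp_def
proof (rule the_equality)
  show "\<exists>\<eta>. exp_solution H M0 x \<eta> \<and> (\<beta> 1, \<alpha> 1) = \<eta> 1"
    using one_par_exp_solution[where x = x, OF op x] by (intro exI[of _ "\<lambda>t. (\<beta> t, \<alpha> t)"]) simp
  show "h = (\<beta> 1, \<alpha> 1)" if "\<exists>\<eta>. exp_solution H M0 x \<eta> \<and> h = \<eta> 1" for h
    using that exp_solution_unique[where x = x, OF _ x op] by blast
qed

text \<open>Evaluation at time \<open>1\<close> identifies the exponential of \<open>t\<close> times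
  the velocity with \<open>(\<beta> t, \<alpha> t)\<close>.\<close>

lemma one_par_scale:
  assumes op: "one_par \<beta> \<alpha> w a"
  shows "one_par (\<lambda>s. \<beta> (t * s)) (\<lambda>s. \<alpha> (t * s)) (t *\<^sub>R w) (t *\<^sub>R a)"
proof -
  have z: "\<beta> 0 = \<one>\<^bsub>N\<^esub>" "\<alpha> 0 = \<one>\<^bsub>G\<^esub>" using one_par_zero[OF op] by auto
  \<comment> \<open>\<open>t = 0\<close> is allowed; then \<open>t * s\<close> is always
    \<open>0\<close>, a point that \<open>at 0\<close> does not see, hence
    \<open>P 0\<close>.\<close>
  have ev0: "\<forall>\<^sub>F s in at 0. P (t * s)" if P: "\<forall>\<^sub>F s in at (0::real). P s" "P 0" for P
  proof -
    obtain \<delta> where \<delta>: "\<delta> > 0" "\<And>s. s \<noteq> 0 \<Longrightarrow> \<bar>s\<bar> < \<delta> \<Longrightarrow> P s"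
      using P(1) unfolding eventually_at by auto
    have "\<delta> / (\<bar>t\<bar> + 1) > 0" using \<delta> by (intro divide_pos_pos) auto
    from eventually_abs_less[OF order_refl this] show ?thesis
    proof eventually_elim
      case (elim s)
      have "\<bar>s\<bar> * (\<bar>t\<bar> + 1) < \<delta>" using elim by (subst (asm) pos_less_divide_eq) auto
      then have "\<bar>t * s\<bar> < \<delta>" by (simp add: abs_mult algebra_simps)
      then show ?case using \<delta>(2)[of "t * s"] P(2) by (cases "t * s = 0") auto
    qed
  qed
  have d1: "((\<lambda>s. \<Theta> (\<beta> (t * s), \<alpha> (t * s))) has_vector_derivative t *\<^sub>R (w, a)) (at 0)"
  proof -
    have "((\<lambda>s. t * s) has_derivative (\<lambda>h. t * h)) (at 0)" by (auto intro!: derivative_eq_intros)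
    from has_derivative_compose[OF this, of "\<lambda>s. \<Theta> (\<beta> s, \<alpha> s)" "\<lambda>h. h *\<^sub>R (w, a)"] one_par_derivative(1)[OF op]
    show ?thesis by (simp add: has_vector_derivative_def mult.commute)
  qed
  then have d0: "((\<lambda>s. \<phi> (\<beta> (t * s))) has_vector_derivative t *\<^sub>R w) (at 0)"
    "((\<lambda>s. \<psi> (\<alpha> (t * s))) has_vector_derivative t *\<^sub>R a) (at 0)"
    using bounded_linear.has_vector_derivative[OF bounded_linear_fst d1] bounded_linear.has_vector_derivative[OF bounded_linear_snd d1]
    by simp_all
  have d2: "((\<lambda>s. \<phi> (\<beta> (t * s)) - \<phi> \<one>\<^bsub>N\<^esub>) has_vector_derivative t *\<^sub>R w - 0) (at 0)"
    "((\<lambda>s. \<psi> (\<alpha> (t * s)) - \<psi> \<one>\<^bsub>G\<^esub>) has_vector_derivative t *\<^sub>R a - 0) (at 0)"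
    by (rule has_vector_derivative_diff[OF d0(1) has_vector_derivative_const],
        rule has_vector_derivative_diff[OF d0(2) has_vector_derivative_const])
  have "\<forall>\<^sub>F s in at 0. (\<beta> (t * s), \<alpha> (t * s)) \<in> O0"
    by (rule ev0[OF one_par_derivative(2)[OF op]]) (use z N.oneU G.oneU in auto)
  then have e: "\<forall>\<^sub>F s in at 0. \<beta> (t * s) \<in> ON" "\<forall>\<^sub>F s in at 0. \<alpha> (t * s) \<in> OG"
    by (auto elim: eventually_mono)
  show ?thesis
    unfolding one_par_def
  proof (intro conjI allI)
    show "N.tang (at 0) (\<lambda>s. \<beta> (t * s)) (t *\<^sub>R w)"
      using N.tang_iff_derivative[of "\<lambda>s. \<beta> (t * s)" UNIV "t *\<^sub>R w"] z e d2 by simp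
    show "G.tang (at 0) (\<lambda>s. \<alpha> (t * s)) (t *\<^sub>R a)"
      using G.tang_iff_derivative[of "\<lambda>s. \<alpha> (t * s)" UNIV "t *\<^sub>R a"] z e d2 by simp
  qed (use one_par_carrier[OF op] one_par_add[OF op] in \<open>auto simp: distrib_left\<close>)
qed

lemma one_parameter_group_tang:
  assumes \<gamma>: "C1_one_parameter_group H M0 \<gamma>" and v: "velocity M0 UNIV \<gamma> 0 (O0, \<Theta>) = (w, a)"
  shows "\<gamma> 0 = \<one>\<^bsub>H\<^esub>" and "N.tang (at 0) (\<lambda>s. fst (\<gamma> s)) w" and "G.tang (at 0) (\<lambda>s. snd (\<gamma> s)) a"
    and "limitin (mfd_top MG) (\<lambda>s. snd (\<gamma> s)) \<one>\<^bsub>G\<^esub> (at 0)"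
    and "fst (\<gamma> s) \<in> carrier N" and "snd (\<gamma> s) \<in> carrier G"
proof -
  interpret H: group H by (rule H_group)
  have C1: "C1_curve M0 UNIV \<gamma>" and car: "\<And>s. \<gamma> s \<in> carrier H" and add: "\<And>s t. \<gamma> (s + t) = \<gamma> s \<otimes>\<^bsub>H\<^esub> \<gamma> t"
    using \<gamma> by (auto simp: C1_one_parameter_group_def)
  show "fst (\<gamma> s) \<in> carrier N" "snd (\<gamma> s) \<in> carrier G" using car[of s] by (auto simp: H_simps)
  show z: "\<gamma> 0 = \<one>\<^bsub>H\<^esub>" using add[of 0 0] car[of 0] by simp
  have z0: "\<gamma> 0 = (\<one>\<^bsub>N\<^esub>, \<one>\<^bsub>G\<^esub>)" using z by (simp add: H_simps)
  have o: "\<gamma> 0 \<in> O0" using z0 N.oneU G.oneU by simp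
  have "continuous_map (top_of_set UNIV) (mfd_top M0) \<gamma>" using C1 by (simp add: C1_curve_def)
  from continuous_map_limitin[OF this, of 0] have lim: "limitin (mfd_top M0) \<gamma> (\<gamma> 0) (at 0)" by simp
  then show "limitin (mfd_top MG) (\<lambda>s. snd (\<gamma> s)) \<one>\<^bsub>G\<^esub> (at 0)"
    using z0 by (simp add: M0_simps limitin_pairwise o_def)
  have ev: "\<forall>\<^sub>F s in at 0. \<gamma> s \<in> O0"
    by (rule limitinD[OF lim]) (use M0_chart[OF M0_simps(2)] o in auto)
  obtain v' where v': "((\<Theta> \<circ> \<gamma>) has_vector_derivative v') (at 0)"
    using C1 M0_simps(2) o unfolding C1_curve_def by fastforce
  have "v' = (w, a)"
    using vector_derivative_at[OF v'] v o M0_simps(2) by (simp add: velocity_def)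
  then have d1: "((\<lambda>s. (\<phi> (fst (\<gamma> s)), \<psi> (snd (\<gamma> s)))) has_vector_derivative (w, a)) (at 0)"
    using v' by (simp add: o_def map_prod_def split_beta)
  then have d0: "((\<lambda>s. \<phi> (fst (\<gamma> s))) has_vector_derivative w) (at 0)"
    "((\<lambda>s. \<psi> (snd (\<gamma> s))) has_vector_derivative a) (at 0)"
    using bounded_linear.has_vector_derivative[OF bounded_linear_fst d1] bounded_linear.has_vector_derivative[OF bounded_linear_snd d1]
    by simp_all
  have d2: "((\<lambda>s. \<phi> (fst (\<gamma> s)) - \<phi> \<one>\<^bsub>N\<^esub>) has_vector_derivative w - 0) (at 0)"
    "((\<lambda>s. \<psi> (snd (\<gamma> s)) - \<psi> \<one>\<^bsub>G\<^esub>) has_vector_derivative a - 0) (at 0)"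
    by (rule has_vector_derivative_diff[OF d0(1) has_vector_derivative_const],
        rule has_vector_derivative_diff[OF d0(2) has_vector_derivative_const])
  have e: "\<forall>\<^sub>F s in at 0. fst (\<gamma> s) \<in> ON" "\<forall>\<^sub>F s in at 0. snd (\<gamma> s) \<in> OG"
    using ev by (auto elim!: eventually_mono simp: mem_Times_iff)
  show "N.tang (at 0) (\<lambda>s. fst (\<gamma> s)) w"
    using N.tang_iff_derivative[of "\<lambda>s. fst (\<gamma> s)" UNIV w] z0 e d2 by simp
  show "G.tang (at 0) (\<lambda>s. snd (\<gamma> s)) a"
    using G.tang_iff_derivative[of "\<lambda>s. snd (\<gamma> s)" UNIV a] z0 e d2 by simp
qed

lemma trotter_property_H: "trotter_property H M0"
  unfolding trotter_property_def
proof (intro allI impI)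
  fix \<gamma>1 \<gamma>2 :: "real \<Rightarrow> 'n \<times> 'g" and K :: "real set"
  assume \<gamma>: "C1_one_parameter_group H M0 \<gamma>1 \<and> C1_one_parameter_group H M0 \<gamma>2" and K: "compact K"
  obtain w1 a1 where v1: "velocity M0 UNIV \<gamma>1 0 (O0, \<Theta>) = (w1, a1)" by (cases "velocity M0 UNIV \<gamma>1 0 (O0, \<Theta>)")
  obtain w2 a2 where v2: "velocity M0 UNIV \<gamma>2 0 (O0, \<Theta>) = (w2, a2)" by (cases "velocity M0 UNIV \<gamma>2 0 (O0, \<Theta>)")
  note g1 = one_parameter_group_tang[OF conjunct1[OF \<gamma>] v1] and g2 = one_parameter_group_tang[OF conjunct2[OF \<gamma>] v2]
  obtain \<beta> \<alpha> where op: "one_par \<beta> \<alpha> (w1 + w2) (a1 + a2)" using one_par_exists by blast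
  define x where "x = tangent_add (velocity M0 UNIV \<gamma>1 0) (velocity M0 UNIV \<gamma>2 0)"
  have exp: "lie_exp H M0 (tangent_scale t x) = (\<beta> t, \<alpha> t)" for t
    using lie_exp_one_par[OF one_par_scale[OF op, of t], of "tangent_scale t x"] v1 v2
    by (simp add: x_def tangent_scale_def tangent_add_def)
  define b where "b s = fst (\<gamma>1 s) \<otimes>\<^bsub>N\<^esub> \<pi> (snd (\<gamma>1 s)) (fst (\<gamma>2 s))" for s
  define c where "c s = snd (\<gamma>1 s) \<otimes>\<^bsub>G\<^esub> snd (\<gamma>2 s)" for s
  have prod: "\<gamma>1 s \<otimes>\<^bsub>H\<^esub> \<gamma>2 s = (b s, c s)" for s
    by (cases "\<gamma>1 s"; cases "\<gamma>2 s") (simp add: b_def c_def H_simps)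
  have bc: "b s \<in> carrier N" "c s \<in> carrier G" for s
    using g1(5,6) g2(5,6) pi_closed by (auto simp: b_def c_def)
  have z: "b 0 = \<one>\<^bsub>N\<^esub>" "c 0 = \<one>\<^bsub>G\<^esub>"
    using g1(1) g2(1) by (auto simp: b_def c_def H_simps pi_one_N)
  \<comment> \<open>The twist by \<open>snd (\<gamma>1 s)\<close> tends to the identity, so it acts
    on the velocity \<open>w2\<close> as \<open>A \<one>\<close>, which fixes it.\<close>
  have tb: "N.tang (at 0) b (w1 + w2)"
    unfolding b_def using N.tang_mult[OF g1(2) action_tang[OF g2(2) order_refl g1(4)] order_refl] by (simp add: A_one)
  have tc: "G.tang (at 0) c (a1 + a2)"
    unfolding c_def by (rule G.tang_mult[OF g1(3) g2(3) order_refl])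
  show "group_uniform_limit_on H (mfd_top M0) K (\<lambda>n t. (\<gamma>1 (t / real n) \<otimes>\<^bsub>H\<^esub> \<gamma>2 (t / real n)) [^]\<^bsub>H\<^esub> n)
      (\<lambda>t. lie_exp H M0 (tangent_scale t (tangent_add (velocity M0 UNIV \<gamma>1 0) (velocity M0 UNIV \<gamma>2 0))))"
    unfolding group_uniform_limit_on_def x_def[symmetric] exp prod
  proof (intro allI impI, elim conjE)
    fix U assume "openin (mfd_top M0) U" "\<one>\<^bsub>H\<^esub> \<in> U"
    then show "\<forall>\<^sub>F n in sequentially. \<forall>t\<in>K.
        inv\<^bsub>H\<^esub> (\<beta> t, \<alpha> t) \<otimes>\<^bsub>H\<^esub> (b (t / real n), c (t / real n)) [^]\<^bsub>H\<^esub> n \<in> U"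
      unfolding M0_simps by (intro trotter_limit[OF op bc(2) z(2) tc bc(1) z(1) tb _ _ K])
  qed
qed

end

theorem theorem3:
  fixes N :: "('n, 'c) monoid_scheme" and MN :: "('n, 'e::banach) manifold"
    and G :: "('g, 'd) monoid_scheme" and MG :: "('g, 'f::banach) manifold"
    and \<pi> :: "'g \<Rightarrow> 'n \<Rightarrow> 'n"
  assumes "banach_lie_group N MN"
    and "banach_lie_group G MG"
    and "\<pi> \<in> hom G (lie_Aut N MN)"
    and "continuous_action MG MN \<pi>"
  shows "trotter_property (semidirect_product N G \<pi>) (prod_manifold MN MG)"
proof -
  note N = blg_group[OF assms(1)] and G = blg_group[OF assms(2)]
  interpret N: group N by (rule N)
  interpret G: group G by (rule G)
  note act = smooth_action_facts[OF N G assms(3)]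
  \<comment> \<open>The predicate under the choice operator of \<open>tangent_map\<close> at the
    identity. All charts of the product manifold are products, so the chosen one splits, and the
    coordinates of \<open>N\<close> and \<open>G\<close> are taken from its factors.\<close>
  let ?P = "\<lambda>c. c \<in> atlas (prod_manifold MN MG) \<and> (\<one>\<^bsub>N\<^esub>, \<one>\<^bsub>G\<^esub>) \<in> fst c"
  obtain V \<phi>' where V: "(V, \<phi>') \<in> atlas MN" "\<one>\<^bsub>N\<^esub> \<in> V"
    using chart_exists[OF blg_manifold[OF assms(1)]] blg_topspace[OF assms(1)] by blast
  obtain W \<psi>' where W: "(W, \<psi>') \<in> atlas MG" "\<one>\<^bsub>G\<^esub> \<in> W"
    using chart_exists[OF blg_manifold[OF assms(2)]] blg_topspace[OF assms(2)] by blast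
  have "?P (V \<times> W, map_prod \<phi>' \<psi>')" using V W by (auto simp: prod_manifold_def)
  then have "?P (SOME c. ?P c)" by (rule someI)
  moreover obtain X \<theta> where X: "(SOME c. ?P c) = (X, \<theta>)" by (cases "SOME c. ?P c")
  ultimately obtain ON \<phi> OG \<psi> where c0: "(SOME c. ?P c) = (ON \<times> OG, map_prod \<phi> \<psi>)"
    and cN: "(ON, \<phi>) \<in> atlas MN" "\<one>\<^bsub>N\<^esub> \<in> ON" and cG: "(OG, \<psi>) \<in> atlas MG" "\<one>\<^bsub>G\<^esub> \<in> OG"
    unfolding X by (auto simp: prod_manifold_def)
  obtain RN rN CN DN where LN: "local_group N (mfd_top MN) ON (\<lambda>x. \<phi> x - \<phi> \<one>\<^bsub>N\<^esub>) RN rN CN DN"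
    using banach_lie_group_local[OF assms(1) cN] by blast
  obtain RG rG CG DG where LG: "local_group G (mfd_top MG) OG (\<lambda>x. \<psi> x - \<psi> \<one>\<^bsub>G\<^esub>) RG rG CG DG"
    using banach_lie_group_local[OF assms(2) cG] by blast
  interpret LN: local_group N "mfd_top MN" ON "\<lambda>x. \<phi> x - \<phi> \<one>\<^bsub>N\<^esub>" RN rN CN DN by (rule LN)
  define A where "A g = frechet_derivative (\<phi> \<circ> \<pi> g \<circ> inv_into ON \<phi>) (at (\<phi> \<one>\<^bsub>N\<^esub>))" for g
  note inj = chart_inj[OF blg_manifold[OF assms(1)] cN(1)]
  have A: "((\<lambda>v. \<phi> (\<pi> g (inv_into ON (\<lambda>x. \<phi> x - \<phi> \<one>\<^bsub>N\<^esub>) v)) - \<phi> \<one>\<^bsub>N\<^esub>) has_derivative A g) (at 0)"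
    if g: "g \<in> carrier G" for g
  proof -
    have "\<pi> g \<one>\<^bsub>N\<^esub> = \<one>\<^bsub>N\<^esub>" using hom_one[OF act(1)[OF g] N N] .
    then have d: "((\<phi> \<circ> \<pi> g \<circ> inv_into ON \<phi>) has_derivative A g) (at (0 + \<phi> \<one>\<^bsub>N\<^esub>))"
      unfolding A_def using mdiffD[OF smooth_map_mdiff[OF act(2)[OF g]] cN(1) cN(1) cN(2)] cN(2) by simp
    have "((\<lambda>v. v + \<phi> \<one>\<^bsub>N\<^esub>) has_derivative (\<lambda>v. v)) (at 0)" by (auto intro!: derivative_eq_intros)
    from has_derivative_compose[OF this d]
    have "((\<lambda>v. (\<phi> \<circ> \<pi> g \<circ> inv_into ON \<phi>) (v + \<phi> \<one>\<^bsub>N\<^esub>) - \<phi> \<one>\<^bsub>N\<^esub>) has_derivative A g) (at 0)"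
      using has_derivative_diff[OF _ has_derivative_const] by fastforce
    then show ?thesis
    proof (rule has_derivative_transform_within_open)
      show "open (ball (0::'e) RN)" "0 \<in> ball (0::'e) RN" using LN.R_pos by auto
      fix v assume "v \<in> ball (0::'e) RN"
      then have v: "norm v < RN" by (simp add: dist_norm)
      define y where "y = inv_into ON (\<lambda>x. \<phi> x - \<phi> \<one>\<^bsub>N\<^esub>) v"
      have y: "y \<in> ON" "\<phi> y - \<phi> \<one>\<^bsub>N\<^esub> = v" using LN.E_U[OF v] LN.L_E[OF v] by (auto simp: y_def)
      then have "inv_into ON \<phi> (v + \<phi> \<one>\<^bsub>N\<^esub>) = y" using inv_into_f_f[OF inj y(1)] by auto
      then show "(\<phi> \<circ> \<pi> g \<circ> inv_into ON \<phi>) (v + \<phi> \<one>\<^bsub>N\<^esub>) - \<phi> \<one>\<^bsub>N\<^esub> =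
          \<phi> (\<pi> g (inv_into ON (\<lambda>x. \<phi> x - \<phi> \<one>\<^bsub>N\<^esub>) v)) - \<phi> \<one>\<^bsub>N\<^esub>" by (simp add: y_def)
    qed
  qed
  have "semidirect_lie N MN ON \<phi> RN rN CN DN G MG OG \<psi> RG rG CG DG \<pi> A"
  proof (intro semidirect_lie.intro local_action.intro LN LG local_action_axioms.intro semidirect_lie_axioms.intro)
    show "continuous_map (prod_topology (mfd_top MG) (mfd_top MN)) (mfd_top MN) (\<lambda>(g, x). \<pi> g x)"
      using assms(4) by (simp add: continuous_action_def)
  qed (use act A assms c0 cN cG in auto)
  then show ?thesis by (rule semidirect_lie.trotter_property_H)
qed

end
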